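(* Let $p>1$, $\alpha=1/(p-1)$, $0<\ell<\infty$, $I=(0,\ell)$. Let $a\in C([0,\ell])\cap C^1(I)$ with $a'(u)>0$ in $I$ and $a(0)=0$, and let $c\in C([0,\ell])$ with $c(0)=c(\ell)=0$. Suppose that for some $u_0\in(0,\ell)$ one has $c\le 0$ in $[0,u_0]$ and $c\ge 0$ in $[u_0,\ell]$. Let $$\kappa:=\int_0^\ell c(s)a'(s)\,ds,\quad G(u):=\Bigl|(\alpha+1)\int_0^u c(r)a'(r)\,dr\Bigr|^{\frac1{\alpha+1}},\quad H(u):=\Bigl|(\alpha+1)\int_u^\ell c(r)a'(r)\,dr\Bigr|^{\frac1{\alpha+1}}.$$ Suppose also that one of the following holds: (i) $\kappa>0$ and $c>0$ in $(u_0,\ell)$; (ii) $\kappa=0$, $G(u)>0$ for $u\in(0,u_0)$ and $H(u)>0$ for $u\in(u_0,\ell)$; (iii) $\kappa<0$ and $c<0$ in $(0,u_0)$. Then there exists a real number $\sigma^*$ for which the equation $u_t=\Delta_p(a(u))+c(u)$, $x\in\mathbb R$, has exactly one distinct wavefront profile from $\ell$ to $0$ with speed $\sigma^*$, and no wavefront profile from $\ell$ to $0$ with any other speed.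
   Context: Here $\Delta_p w=(|w_x|^{p-2}w_x)_x$ in one space dimension. A (global) travelling-wave profile with speed $\sigma\in\mathbb R$ of $u_t=\Delta_p(a(u))+c(u)$ is a function $V\in C(\mathbb R)$ with values in $[0,\ell]$ such that $|(a(V))'|^{p-2}(a(V))'$ and $c(V)$ belong to $L^1_{\rm loc}(\mathbb R)$ and $$\int_{\mathbb R}\Bigl(|(a(V))'|^{p-2}(a(V))'\varphi'+\sigma V\varphi'-c(V)\varphi\Bigr)\,d\xi=0\quad\text{for every }\varphi\in C_0^\infty(\mathbb R)$$ (it corresponds to the solution $u(x,t)=V(x-\sigma t)$). A wavefront profile from $\ell$ to $0$ is such a profile which is monotonic, not constant, and satisfies $V(\xi)\to\ell$ as $\xi\to-\infty$ and $V(\xi)\to0$ as $\xi\to+\infty$. Two wavefront profiles are indistinct if one is a translation of the other, and distinct otherwise; "exactly one distinct wavefront profile" means existence and uniqueness up to translation. *)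

theory Defs
  imports "HOL-Analysis.Analysis"
begin

definition smooth_real :: "(real \<Rightarrow> real) \<Rightarrow> bool" where
  "smooth_real \<phi> \<longleftrightarrow> (\<forall>k x. (deriv ^^ k) \<phi> differentiable (at x))"

definition test_function :: "(real \<Rightarrow> real) \<Rightarrow> bool" where
  "test_function \<phi> \<longleftrightarrow> smooth_real \<phi> \<and> compact (closure {x. \<phi> x \<noteq> 0})"

definition locally_integrable :: "(real \<Rightarrow> real) \<Rightarrow> bool" where
  "locally_integrable f \<longleftrightarrow> (\<forall>K. compact K \<longrightarrow> f absolutely_integrable_on K)"

definition weak_derivative :: "(real \<Rightarrow> real) \<Rightarrow> (real \<Rightarrow> real) \<Rightarrow> bool" where
  "weak_derivative w g \<longleftrightarrow> locally_integrable w \<and> locally_integrable g \<and>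
     (\<forall>\<phi>. test_function \<phi> \<longrightarrow>
        (LINT x|lebesgue. w x * deriv \<phi> x) = - (LINT x|lebesgue. g x * \<phi> x))"

(* At y = 0 this is 0 for every p > 1, also when p < 2. *)
definition p_flux :: "real \<Rightarrow> real \<Rightarrow> real" where
  "p_flux p y = \<bar>y\<bar> powr (p - 2) * y"

(* (a(V))' is the distributional derivative, required to be a function. The classical
   almost-everywhere derivative would not do: it does not see Cantor-type profiles.
   Only the values of a and c on [0, l] matter, since V takes its values there. *)
definition travelling_wave_profile ::
  "real \<Rightarrow> (real \<Rightarrow> real) \<Rightarrow> (real \<Rightarrow> real) \<Rightarrow> real \<Rightarrow> real \<Rightarrow> (real \<Rightarrow> real) \<Rightarrow> bool" where
  "travelling_wave_profile p a c l \<sigma> V \<longleftrightarrow>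
     continuous_on UNIV V \<and> (\<forall>\<xi>. V \<xi> \<in> {0..l}) \<and>
     (\<exists>g. weak_derivative (\<lambda>\<xi>. a (V \<xi>)) g \<and>
          locally_integrable (\<lambda>\<xi>. p_flux p (g \<xi>)) \<and>
          locally_integrable (\<lambda>\<xi>. c (V \<xi>)) \<and>
          (\<forall>\<phi>. test_function \<phi> \<longrightarrow>
             (LINT \<xi>|lebesgue. p_flux p (g \<xi>) * deriv \<phi> \<xi> + \<sigma> * V \<xi> * deriv \<phi> \<xi>
                                - c (V \<xi>) * \<phi> \<xi>) = 0))"

definition wavefront_profile ::
  "real \<Rightarrow> (real \<Rightarrow> real) \<Rightarrow> (real \<Rightarrow> real) \<Rightarrow> real \<Rightarrow> real \<Rightarrow> (real \<Rightarrow> real) \<Rightarrow> bool" where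
  "wavefront_profile p a c l \<sigma> V \<longleftrightarrow>
     travelling_wave_profile p a c l \<sigma> V \<and>
     (mono V \<or> antimono V) \<and> \<not> V constant_on UNIV \<and>
     (V \<longlongrightarrow> l) at_bot \<and> (V \<longlongrightarrow> 0) at_top"

definition indistinct :: "(real \<Rightarrow> real) \<Rightarrow> (real \<Rightarrow> real) \<Rightarrow> bool" where
  "indistinct V W \<longleftrightarrow> (\<exists>\<tau>. \<forall>\<xi>. W \<xi> = V (\<xi> + \<tau>))"

end

theory Submission
  imports Defs "HOL-Computational_Algebra.Polynomial" "HOL-Real_Asymp.Real_Asymp"
begin

text \<open>
A decreasing profile solves a first-order system for \<open>V\<close> and the flux
\<open>w = |(a(V))'| powr (p - 1) \<ge> 0\<close>, namely \<open>(a(V))' = - w powr \<alpha>\<close> and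
\<open>(w - \<sigma> V)' = c(V)\<close>. Passing from the weak formulation to this system is an application of the lemma of
du Bois-Reymond (\<open>wavefront_profile_imp_front\<close>, \<open>front_imp_wavefront_profile\<close>). Where
\<open>w > 0\<close>, the flux is a function \<open>\<omega>\<close> of the value \<open>u\<close> of the profile, and

\<open>\<omega>' = \<sigma> - c a' / \<omega> powr \<alpha>\<close> on \<open>(0, l)\<close>, with
\<open>\<omega>(0) = \<omega>(l) = 0\<close>.

Conversely such an \<open>\<omega>\<close> determines the front up to translation by separation of variables. The
theorem is therefore equivalent to the existence of exactly one pair \<open>(\<sigma>, \<omega>)\<close> with
\<open>\<omega> > 0\<close> on \<open>(0, l)\<close>, once it is known that the flux of a front does not vanish in between.

Let \<open>K u\<close> be the integral of \<open>c a'\<close> from 0 to \<open>u\<close>. The energy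
\<open>w powr (\<alpha> + 1) / (\<alpha> + 1) + K(V)\<close> of a front is monotone, with a direction that depends on the sign
of \<open>\<sigma>\<close>, and goes from \<open>K l\<close> to 0. This relates the sign of the speed to that of \<open>K l\<close>, and
with it each of the three alternatives of the theorem forces the flux to be positive
(\<open>front_flux_pos\<close>).

Uniqueness (\<open>phase_profile_unique\<close>): with a larger speed the flux is at least as large on
\<open>[0, u0]\<close>, by comparison from the left end, where \<open>c \<le> 0\<close>, and at most as large on
\<open>[u0, l]\<close>, by comparison from the right end, where \<open>c \<ge> 0\<close>. At \<open>u0\<close> the two meet, and the
slopes there rule out different speeds.

Existence (\<open>phase_profile_exists\<close>): if \<open>K l = 0\<close>, then \<open>\<sigma> = 0\<close> and
\<open>\<omega> powr (\<alpha> + 1) / (\<alpha> + 1) = - K\<close>. The case \<open>K l < 0\<close> reduces to \<open>K l > 0\<close> by reflection. In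
the latter case the substitution \<open>W = \<omega> powr (\<alpha> + 1) / (\<alpha> + 1)\<close> removes the singularity and leads to
an integral equation with a monotone operator. Its maximal solution with \<open>W(0) = 0\<close> increases with the
speed; its value at \<open>l\<close> is negative for \<open>\<sigma> = 0\<close>, nonnegative for large \<open>\<sigma>\<close>, and it depends on
\<open>\<sigma>\<close> continuously enough to vanish for some speed in between.
\<close>

section \<open>Smooth bump functions\<close>

text \<open>Smoothness is the largest class of differentiable functions that is closed under
differentiation, so exhibiting any such class that contains the function is enough.\<close>

lemma smooth_coinduct:
  assumes "P f"
    and step: "\<And>f. P f \<Longrightarrow> (\<forall>x. f differentiable (at x)) \<and> P (deriv f)"
  shows "smooth_real f"
proof -
  have "\<forall>x. (deriv ^^ k) f differentiable (at x)" if "P f" for k f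
    using that
  proof (induction k arbitrary: f)
    case 0
    then show ?case using step by simp
  next
    case (Suc k)
    then show ?case using step[of f] by (simp add: funpow_Suc_right del: funpow.simps)
  qed
  then show ?thesis using assms(1) by (simp add: smooth_real_def)
qed

lemma smooth_real_differentiable: "smooth_real f \<Longrightarrow> f differentiable (at x)"
  unfolding smooth_real_def by (metis funpow_0)

lemma smooth_real_deriv: "smooth_real f \<Longrightarrow> smooth_real (deriv f)"
  unfolding smooth_real_def by (metis funpow_Suc_right comp_apply)

lemma smooth_real_DERIV: "smooth_real f \<Longrightarrow> (f has_real_derivative deriv f x) (at x)"
  by (simp add: DERIV_deriv_iff_real_differentiable smooth_real_differentiable)

lemma smooth_real_continuous: "smooth_real f \<Longrightarrow> continuous_on A f"
  by (meson DERIV_isCont continuous_at_imp_continuous_on smooth_real_DERIV)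

lemma smooth_realI:
  assumes "\<And>x. (f has_real_derivative g x) (at x)" "smooth_real g"
  shows "smooth_real f"
proof -
  have "deriv f = g" using assms(1) by (auto intro!: DERIV_imp_deriv)
  have "(deriv ^^ k) f differentiable (at x)" for k x
  proof (cases k)
    case 0
    then show ?thesis using assms(1) by (auto simp: real_differentiable_def)
  next
    case (Suc j)
    then show ?thesis using assms(2) \<open>deriv f = g\<close>
      by (simp add: funpow_Suc_right smooth_real_def del: funpow.simps)
  qed
  then show ?thesis by (simp add: smooth_real_def)
qed

lemma smooth_real_affine:
  assumes "smooth_real f"
  shows "smooth_real (\<lambda>x. c * f (m * x + b))"
proof (rule smooth_coinduct[where P = "\<lambda>g. \<exists>f c. smooth_real f \<and> g = (\<lambda>x. c * f (m * x + b))"])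
  show "\<exists>h d. smooth_real h \<and> (\<lambda>x. c * f (m * x + b)) = (\<lambda>x. d * h (m * x + b))"
    using assms by blast
next
  fix g :: "real \<Rightarrow> real"
  assume "\<exists>f c. smooth_real f \<and> g = (\<lambda>x. c * f (m * x + b))"
  then obtain f c where f: "smooth_real f" and g: "g = (\<lambda>x. c * f (m * x + b))" by blast
  have D: "(g has_real_derivative (c * m) * deriv f (m * x + b)) (at x)" for x
    unfolding g by (auto intro!: derivative_eq_intros DERIV_chain'[OF _ smooth_real_DERIV[OF f]])
  then have "deriv g = (\<lambda>x. (c * m) * deriv f (m * x + b))"
    by (auto intro!: DERIV_imp_deriv)
  then show "(\<forall>x. g differentiable at x) \<and>
      (\<exists>h d. smooth_real h \<and> deriv g = (\<lambda>x. d * h (m * x + b)))"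
    using D smooth_real_deriv[OF f] by (auto simp: real_differentiable_def)
qed

text \<open>The products themselves are not closed under differentiation, but finite sums of products are, by the
Leibniz rule.\<close>

lemma smooth_real_mult:
  assumes "smooth_real f" "smooth_real g"
  shows "smooth_real (\<lambda>x. f x * g x)"
proof (rule smooth_coinduct[where P = "\<lambda>h. \<exists>(S :: ((real \<Rightarrow> real) \<times> (real \<Rightarrow> real)) list).
     (\<forall>(u, v) \<in> set S. smooth_real u \<and> smooth_real v) \<and> h = (\<lambda>x. \<Sum>(u, v)\<leftarrow>S. u x * v x)"])
  show "\<exists>S. (\<forall>(u, v) \<in> set S. smooth_real u \<and> smooth_real v) \<and>
      (\<lambda>x. f x * g x) = (\<lambda>x. \<Sum>(u, v)\<leftarrow>S. u x * v x)"
    by (rule exI[of _ "[(f, g)]"]) (use assms in auto)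
next
  fix h :: "real \<Rightarrow> real"
  assume "\<exists>S. (\<forall>(u, v) \<in> set S. smooth_real u \<and> smooth_real v) \<and> h = (\<lambda>x. \<Sum>(u, v)\<leftarrow>S. u x * v x)"
  then obtain S where S: "\<forall>(u, v) \<in> set S. smooth_real u \<and> smooth_real v"
    and h: "h = (\<lambda>x. \<Sum>(u, v)\<leftarrow>S. u x * v x)" by blast
  define S' where "S' = concat (map (\<lambda>(u, v). [(deriv u, v), (u, deriv v)]) S)"
  have D: "((\<lambda>x. \<Sum>(u, v)\<leftarrow>S. u x * v x) has_real_derivative
      (\<Sum>(u, v)\<leftarrow>concat (map (\<lambda>(u, v). [(deriv u, v), (u, deriv v)]) S). u x * v x)) (at x)" for x
    using S
  proof (induction S)
    case (Cons q S)
    obtain u v where q: "q = (u, v)" by (cases q)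
    have u: "smooth_real u" and v: "smooth_real v" using Cons.prems q by auto
    show ?case using Cons unfolding q
      by (auto intro!: derivative_eq_intros smooth_real_DERIV[OF u] smooth_real_DERIV[OF v])
  qed simp
  then have "deriv h = (\<lambda>x. \<Sum>(u, v)\<leftarrow>S'. u x * v x)"
    unfolding h S'_def by (auto intro!: DERIV_imp_deriv)
  moreover have "\<forall>(u, v) \<in> set S'. smooth_real u \<and> smooth_real v"
    using S unfolding S'_def by (auto intro: smooth_real_deriv)
  ultimately show "(\<forall>x. h differentiable at x) \<and>
      (\<exists>S. (\<forall>(u, v) \<in> set S. smooth_real u \<and> smooth_real v) \<and> deriv h = (\<lambda>x. \<Sum>(u, v)\<leftarrow>S. u x * v x))"
    using D unfolding h by (auto simp: real_differentiable_def)
qed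

text \<open>The derivatives of \<open>exp (- 1 / x)\<close>, extended by 0 to the left of 0, are again
this function times polynomials in \<open>1 / x\<close>; the polynomial is kept as a parameter so
that the family is closed under differentiation.\<close>

definition flat_exp :: "real poly \<Rightarrow> real \<Rightarrow> real" where
  "flat_exp P x = (if x > 0 then poly P (1 / x) * exp (- (1 / x)) else 0)"

lemma poly_times_exp_minus_tendsto_0:
  fixes P :: "real poly"
  shows "((\<lambda>t. poly P t * exp (- t)) \<longlongrightarrow> 0) at_top"
proof -
  have "((\<lambda>t. \<Sum>i\<le>degree P. coeff P i * (t ^ i / exp t)) \<longlongrightarrow> (\<Sum>i\<le>degree P. coeff P i * 0)) at_top"
    by (intro tendsto_intros tendsto_power_div_exp_0)
  then show ?thesis
    by (simp add: poly_altdef sum_distrib_right exp_minus divide_inverse mult.assoc)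
qed

lemma DERIV_flat_exp:
  "(flat_exp P has_real_derivative flat_exp ([:0, 0, 1:] * (P - pderiv P)) x) (at x)"
proof -
  consider "x > 0" | "x < 0" | "x = 0" by linarith
  then show ?thesis
  proof cases
    case 1
    have "((\<lambda>x. poly P (1 / x) * exp (- (1 / x))) has_real_derivative
        flat_exp ([:0, 0, 1:] * (P - pderiv P)) x) (at x)"
      using 1 by (auto intro!: derivative_eq_intros DERIV_chain'[OF _ poly_DERIV]
          simp: flat_exp_def field_simps power2_eq_square)
    then show ?thesis
      by (rule has_field_derivative_transform_within_open[where S = "{0<..}"])
        (use 1 in \<open>auto simp: flat_exp_def\<close>)
  next
    case 2
    have "((\<lambda>x. 0) has_real_derivative flat_exp ([:0, 0, 1:] * (P - pderiv P)) x) (at x)"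
      using 2 by (auto simp: flat_exp_def)
    then show ?thesis
      by (rule has_field_derivative_transform_within_open[where S = "{..<0}"])
        (use 2 in \<open>auto simp: flat_exp_def\<close>)
  next
    case 3
    have "((\<lambda>y. (flat_exp P y - flat_exp P 0) / (y - 0)) \<longlongrightarrow> 0) (at 0)"
    proof (rule filterlim_split_at_real)
      have "((\<lambda>y. poly (pCons 0 P) (inverse y) * exp (- inverse y)) \<longlongrightarrow> 0) (at_right 0)"
        by (rule filterlim_compose[OF poly_times_exp_minus_tendsto_0 filterlim_inverse_at_top_right])
      then show "((\<lambda>y. (flat_exp P y - flat_exp P 0) / (y - 0)) \<longlongrightarrow> 0) (at_right 0)"
        by (rule Lim_transform_eventually)
          (auto simp: flat_exp_def eventually_at_right_less field_simps intro!: eventually_at_rightI[of 0 1])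
      show "((\<lambda>y. (flat_exp P y - flat_exp P 0) / (y - 0)) \<longlongrightarrow> 0) (at_left 0)"
        by (rule tendsto_eventually) (auto simp: flat_exp_def intro!: eventually_at_leftI[of "-1"])
    qed
    then show ?thesis using 3
      by (simp add: has_field_derivative_iff flat_exp_def)
  qed
qed

lemma smooth_flat_exp: "smooth_real (flat_exp P)"
proof (rule smooth_coinduct[where P = "\<lambda>f. \<exists>P. f = flat_exp P"])
  fix f :: "real \<Rightarrow> real"
  assume "\<exists>P. f = flat_exp P"
  then obtain P where f: "f = flat_exp P" by blast
  have "deriv f = flat_exp ([:0, 0, 1:] * (P - pderiv P))"
    unfolding f by (rule ext, rule DERIV_imp_deriv, rule DERIV_flat_exp)
  then show "(\<forall>x. f differentiable at x) \<and> (\<exists>P. deriv f = flat_exp P)"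
    using DERIV_flat_exp[of P] f by (auto simp: real_differentiable_def)
qed auto

text \<open>A smooth function supported in \<open>[a, b]\<close>. The dilation by \<open>n + 1\<close> makes both
factors tend to 1 inside the interval, so that these functions increase to its indicator.\<close>

definition bump :: "real \<Rightarrow> real \<Rightarrow> nat \<Rightarrow> real \<Rightarrow> real" where
  "bump a b n x = flat_exp 1 (real (Suc n) * (x - a)) * flat_exp 1 (real (Suc n) * (b - x))"

lemma smooth_bump: "smooth_real (bump a b n)"
proof -
  let ?m = "real (Suc n)"
  have "smooth_real (\<lambda>x. (1 * flat_exp 1 (?m * x + (- ?m * a))) * (1 * flat_exp 1 ((- ?m) * x + ?m * b)))"
    by (intro smooth_real_mult smooth_real_affine smooth_flat_exp)
  moreover have "(\<lambda>x. (1 * flat_exp 1 (?m * x + (- ?m * a))) * (1 * flat_exp 1 ((- ?m) * x + ?m * b)))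
     = bump a b n"
    by (auto simp: bump_def fun_eq_iff algebra_simps)
  ultimately show ?thesis by simp
qed

lemma flat_exp_one_bounds: "0 \<le> flat_exp 1 x" "flat_exp 1 x \<le> 1"
  by (auto simp: flat_exp_def)

lemma bump_bounds: "0 \<le> bump a b n x" "bump a b n x \<le> 1"
  unfolding bump_def by (auto intro!: mult_nonneg_nonneg mult_le_one flat_exp_one_bounds)

lemma bump_eq_0: "x \<notin> {a<..<b} \<Longrightarrow> bump a b n x = 0"
  by (auto simp: bump_def flat_exp_def zero_less_mult_iff)

lemma bump_tendsto: "(\<lambda>n. bump a b n x) \<longlonglongrightarrow> indicat_real {a<..<b} x"
proof (cases "x \<in> {a<..<b}")
  case True
  have *: "(\<lambda>n. flat_exp 1 (real (Suc n) * y)) \<longlonglongrightarrow> 1" if "y > 0" for y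
  proof -
    have "(\<lambda>n. exp (- ((1 / y) * inverse (real (Suc n))))) \<longlonglongrightarrow> exp (- ((1 / y) * 0))"
      by (intro tendsto_intros LIMSEQ_inverse_real_of_nat)
    moreover have "(\<lambda>n. exp (- ((1 / y) * inverse (real (Suc n))))) = (\<lambda>n. flat_exp 1 (real (Suc n) * y))"
      using that by (simp add: flat_exp_def fun_eq_iff zero_less_mult_iff inverse_eq_divide del: of_nat_Suc)
    ultimately show ?thesis by simp
  qed
  have "(\<lambda>n. bump a b n x) \<longlonglongrightarrow> 1 * 1"
    unfolding bump_def using True by (intro tendsto_mult *) auto
  then show ?thesis using True by simp
qed (simp add: bump_eq_0)

lemma smooth_real_add:
  assumes "smooth_real f" "smooth_real g"
  shows "smooth_real (\<lambda>x. f x + g x)"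
proof (rule smooth_coinduct[where P = "\<lambda>h. \<exists>f g. smooth_real f \<and> smooth_real g \<and> h = (\<lambda>x. f x + g x)"])
  show "\<exists>u v. smooth_real u \<and> smooth_real v \<and> (\<lambda>x. f x + g x) = (\<lambda>x. u x + v x)"
    using assms by blast
next
  fix h :: "real \<Rightarrow> real"
  assume "\<exists>f g. smooth_real f \<and> smooth_real g \<and> h = (\<lambda>x. f x + g x)"
  then obtain f g where f: "smooth_real f" and g: "smooth_real g" and h: "h = (\<lambda>x. f x + g x)" by blast
  have D: "(h has_real_derivative deriv f x + deriv g x) (at x)" for x
    unfolding h by (intro DERIV_add smooth_real_DERIV f g)
  then have "deriv h = (\<lambda>x. deriv f x + deriv g x)"
    by (auto intro!: DERIV_imp_deriv)
  then show "(\<forall>x. h differentiable at x) \<and>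
      (\<exists>u v. smooth_real u \<and> smooth_real v \<and> deriv h = (\<lambda>x. u x + v x))"
    using D smooth_real_deriv[OF f] smooth_real_deriv[OF g] by (auto simp: real_differentiable_def)
qed

section \<open>Functions with vanishing weak derivative\<close>

text \<open>A test function is continuous and vanishes outside a compact interval; this makes all the integrals
in the weak formulations converge.\<close>

lemma locally_integrable_mult:
  assumes "locally_integrable u" "continuous_on {a..b} \<psi>" "\<And>x. x \<notin> {a..b} \<Longrightarrow> \<psi> x = 0"
  shows "integrable lebesgue (\<lambda>x. u x * \<psi> x)"
proof -
  have "(\<lambda>x. \<psi> x * u x) absolutely_integrable_on {a..b}"
  proof (rule absolutely_integrable_bounded_measurable_product_real)
    show "\<psi> \<in> borel_measurable (lebesgue_on {a..b})"
      by (intro continuous_imp_measurable_on_sets_lebesgue assms) auto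
    show "bounded (\<psi> ` {a..b})"
      by (intro compact_imp_bounded compact_continuous_image assms) auto
    show "u absolutely_integrable_on {a..b}"
      using assms(1) by (auto simp: locally_integrable_def)
  qed auto
  moreover have "(\<lambda>x. indicat_real {a..b} x *\<^sub>R (\<psi> x * u x)) = (\<lambda>x. u x * \<psi> x)"
    using assms(3) by (auto simp: fun_eq_iff indicator_def)
  ultimately show ?thesis by (simp add: set_integrable_def)
qed

lemma locally_integrable_continuous:
  assumes "continuous_on UNIV u"
  shows "locally_integrable u"
  unfolding locally_integrable_def
proof (intro allI impI)
  fix K :: "real set"
  assume "compact K"
  then have "set_integrable lborel K u"
    unfolding set_integrable_def using borel_integrable_compact[of K u] continuous_on_subset[OF assms]
    by (simp add: mult.commute)
  then show "u absolutely_integrable_on K"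
    using \<open>compact K\<close> by (simp add: set_integrable_def integrable_completion borel_compact
        borel_measurable_continuous_onI assms)
qed

lemma integral_vanishing_outside:
  fixes \<psi> :: "real \<Rightarrow> real"
  assumes "continuous_on {a..b} \<psi>" "\<And>x. x \<notin> {a..b} \<Longrightarrow> \<psi> x = 0"
  shows "(LINT x|lebesgue. \<psi> x) = integral {a..b} \<psi>"
proof -
  have "\<psi> absolutely_integrable_on {a..b}"
    by (rule absolutely_integrable_continuous_real[OF assms(1)])
  then have "(LINT x:{a..b}|lebesgue. \<psi> x) = integral {a..b} \<psi>"
    by (rule set_lebesgue_integral_eq_integral(2))
  moreover have "(\<lambda>x. indicat_real {a..b} x *\<^sub>R \<psi> x) = \<psi>"
    using assms(2) by (auto simp: fun_eq_iff indicator_def)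
  ultimately show ?thesis by (simp add: set_lebesgue_integral_def)
qed

lemma test_function_support:
  assumes "test_function \<phi>"
  obtains R where "R > 0" "\<And>x. x \<notin> {-R..R} \<Longrightarrow> \<phi> x = 0" "\<phi> R = 0" "\<phi> (-R) = 0"
    "\<And>x. x \<notin> {-R..R} \<Longrightarrow> deriv \<phi> x = 0"
proof -
  have "bounded (closure {x. \<phi> x \<noteq> 0})"
    using assms by (auto simp: test_function_def compact_imp_bounded)
  then have "bounded {x. \<phi> x \<noteq> 0}" by (rule bounded_subset) (rule closure_subset)
  then obtain B where B: "\<And>x. \<phi> x \<noteq> 0 \<Longrightarrow> \<bar>x\<bar> \<le> B"
    by (auto simp: bounded_iff)
  define R where "R = \<bar>B\<bar> + 1"
  have 0: "\<phi> x = 0" if "x \<notin> {-R<..<R}" for x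
    using that B[of x] unfolding R_def by (cases "\<phi> x = 0") (auto simp: abs_le_iff)
  have "deriv \<phi> x = 0" if "x \<notin> {-R..R}" for x
  proof (rule DERIV_imp_deriv)
    show "(\<phi> has_real_derivative 0) (at x)"
      by (rule has_field_derivative_transform_within_open[where S = "- {-R..R}" and f = "\<lambda>_. 0"])
        (use that 0 in auto)
  qed
  with 0 show thesis by (intro that[of R]) (auto simp: R_def)
qed

lemma primitive_on_reals:
  fixes f :: "real \<Rightarrow> real"
  assumes "continuous_on UNIV f"
  obtains F where "\<And>x. (F has_real_derivative f x) (at x)"
proof -
  have "isCont f x" for x using assms by (simp add: continuous_on_eq_continuous_at)
  then show ?thesis
    using einterval_antiderivative[of "-\<infinity>" "\<infinity>" f] that
    by (auto simp: has_real_derivative_iff_has_vector_derivative)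
qed

lemma has_integral_DERIV:
  fixes f :: "real \<Rightarrow> real"
  assumes "a \<le> b" "\<And>x. (f has_real_derivative f' x) (at x)"
  shows "(f' has_integral f b - f a) {a..b}"
  using assms(1)
proof (rule fundamental_theorem_of_calculus)
  fix x
  show "(f has_vector_derivative f' x) (at x within {a..b})"
    using assms(2)[of x]
    by (simp add: has_real_derivative_iff_has_vector_derivative has_vector_derivative_at_within)
qed

lemma integral_by_parts_test_function:
  assumes F: "\<And>x. (F has_real_derivative f x) (at x)" and f: "continuous_on UNIV f"
    and \<phi>: "test_function \<phi>"
  shows "integrable lebesgue (\<lambda>x. F x * deriv \<phi> x)" "integrable lebesgue (\<lambda>x. f x * \<phi> x)"
    "(LINT x|lebesgue. F x * deriv \<phi> x) = - (LINT x|lebesgue. f x * \<phi> x)"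
proof -
  obtain R where R: "R > 0" "\<And>x. x \<notin> {-R..R} \<Longrightarrow> \<phi> x = 0" "\<phi> R = 0" "\<phi> (-R) = 0"
    "\<And>x. x \<notin> {-R..R} \<Longrightarrow> deriv \<phi> x = 0"
    using test_function_support[OF \<phi>] by blast
  have sm: "smooth_real \<phi>" using \<phi> by (simp add: test_function_def)
  have Fc: "continuous_on S F" for S
    using F by (meson DERIV_isCont continuous_at_imp_continuous_on)
  note c = smooth_real_continuous[OF sm] smooth_real_continuous[OF smooth_real_deriv[OF sm]]
  show 1: "integrable lebesgue (\<lambda>x. F x * deriv \<phi> x)"
    by (rule locally_integrable_mult[OF locally_integrable_continuous[OF Fc] c(2) R(5)])
  show 2: "integrable lebesgue (\<lambda>x. f x * \<phi> x)"
    by (rule locally_integrable_mult[OF locally_integrable_continuous[OF f] c(1) R(2)])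
  have "((\<lambda>x. F x * deriv \<phi> x + f x * \<phi> x) has_integral F R * \<phi> R - F (-R) * \<phi> (-R)) {-R..R}"
  proof (rule has_integral_DERIV)
    fix x :: real
    show "((\<lambda>x. F x * \<phi> x) has_real_derivative (F x * deriv \<phi> x + f x * \<phi> x)) (at x)"
      by (auto intro!: derivative_eq_intros F smooth_real_DERIV[OF sm])
  qed (use R in auto)
  then have "integral {-R..R} (\<lambda>x. F x * deriv \<phi> x + f x * \<phi> x) = 0"
    using R by (simp add: has_integral_integrable_integral)
  then have "(LINT x|lebesgue. F x * deriv \<phi> x + f x * \<phi> x) = 0"
    by (subst integral_vanishing_outside[of "-R" R])
      (use R in \<open>auto intro!: continuous_intros Fc c continuous_on_subset[OF f]\<close>)
  then show "(LINT x|lebesgue. F x * deriv \<phi> x) = - (LINT x|lebesgue. f x * \<phi> x)"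
    using 1 2 by simp
qed

text \<open>The mean has to vanish for the primitive to return to 0 on the right of the support.\<close>

lemma test_function_primitive:
  assumes \<psi>: "smooth_real \<psi>" and out: "\<And>x. x \<notin> {a..b} \<Longrightarrow> \<psi> x = 0"
    and zero: "(LINT x|lebesgue. \<psi> x) = 0" and "a \<le> b"
  obtains \<phi> where "test_function \<phi>" "deriv \<phi> = \<psi>"
proof -
  obtain F where F: "\<And>x. (F has_real_derivative \<psi> x) (at x)"
    using primitive_on_reals[OF smooth_real_continuous[OF \<psi>]] by blast
  define \<phi> where "\<phi> x = F x - F a" for x
  have D: "(\<phi> has_real_derivative \<psi> x) (at x)" for x
    unfolding \<phi>_def by (auto intro!: derivative_eq_intros F)
  have int: "(\<psi> has_integral \<phi> y - \<phi> x) {x..y}" if "x \<le> y" for x y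
    using that D by (rule has_integral_DERIV)
  have "\<phi> a = 0" by (simp add: \<phi>_def)
  have "integral {a..b} \<psi> = 0"
    using zero integral_vanishing_outside[OF smooth_real_continuous[OF \<psi>] out] by simp
  then have "\<phi> b = 0" using int[OF \<open>a \<le> b\<close>] \<open>\<phi> a = 0\<close> by (simp add: has_integral_integrable_integral)
  have "\<phi> x = 0" if "x \<notin> {a..b}" for x
  proof (cases "x < a")
    case True
    have "(\<psi> has_integral 0) {x..a}"
      by (rule has_integral_spike_finite[where S = "{a}" and f = "\<lambda>_. 0"]) (use out in auto)
    then show ?thesis using has_integral_unique[OF int[of x a]] True \<open>\<phi> a = 0\<close> by force
  next
    case False
    have "(\<psi> has_integral 0) {b..x}"
      by (rule has_integral_spike_finite[where S = "{b}" and f = "\<lambda>_. 0"]) (use out in auto)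
    then show ?thesis using has_integral_unique[OF int[of b x]] False that \<open>\<phi> b = 0\<close> by force
  qed
  then have "{x. \<phi> x \<noteq> 0} \<subseteq> {a..b}" by blast
  then have "closure {x. \<phi> x \<noteq> 0} \<subseteq> {a..b}" by (rule closure_minimal) auto
  then have "compact (closure {x. \<phi> x \<noteq> 0})"
    using compact_Int_closed[of "{a..b}" "closure {x. \<phi> x \<noteq> 0}"] by (simp add: inf.absorb2)
  then have "test_function \<phi>"
    using smooth_realI[OF D \<psi>] by (simp add: test_function_def)
  moreover have "deriv \<phi> = \<psi>" using D by (auto intro!: DERIV_imp_deriv)
  ultimately show thesis by (rule that)
qed

lemma locally_integrable_mult_bump:
  assumes "locally_integrable u"
  shows "integrable lebesgue (\<lambda>x. u x * bump a b n x)"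
  using assms
  by (rule locally_integrable_mult[where a = a and b = b])
    (auto intro!: smooth_real_continuous[OF smooth_bump] bump_eq_0)

text \<open>Dominated convergence, with \<open>\<bar>u\<bar>\<close> on \<open>[a, b]\<close> as the majorant.\<close>

lemma bump_integral_tendsto:
  assumes u: "locally_integrable u"
  shows "(\<lambda>n. LINT x|lebesgue. u x * bump a b n x) \<longlonglongrightarrow> (LINT x|lebesgue. u x * indicat_real {a<..<b} x)"
proof (rule integral_dominated_convergence)
  have 1: "integrable lebesgue (\<lambda>x. indicat_real {a..b} x *\<^sub>R u x)"
    using u by (auto simp: locally_integrable_def set_integrable_def)
  show "integrable lebesgue (\<lambda>x. \<bar>indicat_real {a..b} x *\<^sub>R u x\<bar>)"
    using 1 by (rule integrable_abs)
  have "integrable lebesgue (\<lambda>x. indicat_real {a<..<b} x *\<^sub>R u x)"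
  proof -
    have "set_integrable lebesgue {a<..<b} u"
    proof (rule set_integrable_subset)
      show "set_integrable lebesgue {a..b} u" using 1 by (simp add: set_integrable_def)
    qed auto
    then show ?thesis by (simp add: set_integrable_def)
  qed
  then show "(\<lambda>x. u x * indicat_real {a<..<b} x) \<in> borel_measurable lebesgue"
    by (simp add: mult.commute borel_measurable_integrable)
  show "(\<lambda>x. u x * bump a b n x) \<in> borel_measurable lebesgue" for n
    using locally_integrable_mult_bump[OF u] by (rule borel_measurable_integrable)
  show "AE x in lebesgue. (\<lambda>n. u x * bump a b n x) \<longlonglongrightarrow> u x * indicat_real {a<..<b} x"
    by (intro AE_I2 tendsto_mult tendsto_const bump_tendsto)
  show "AE x in lebesgue. norm (u x * bump a b n x) \<le> \<bar>indicat_real {a..b} x *\<^sub>R u x\<bar>" for n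
  proof (rule AE_I2)
    fix x
    show "norm (u x * bump a b n x) \<le> \<bar>indicat_real {a..b} x *\<^sub>R u x\<bar>"
    proof (cases "x \<in> {a<..<b}")
      case True
      then show ?thesis using bump_bounds[of a b n x] by (auto simp: abs_mult intro!: mult_left_le)
    qed (simp add: bump_eq_0)
  qed
qed

text \<open>The positive and the negative part of \<open>f\<close> are densities of two finite measures that agree on all
half-lines. Half-lines generate the Borel sets, so the measures coincide, and so do their densities.\<close>

lemma AE_eq_0_if_integrals_vanish:
  fixes f :: "real \<Rightarrow> real"
  assumes f: "integrable lebesgue f"
    and 0: "\<And>x. (LINT y|lebesgue. f y * indicat_real {x<..} y) = 0"
  shows "AE x in lebesgue. f x = 0"
proof -
  obtain g where g: "g \<in> borel_measurable lborel" and fg: "AE x in lborel. f x = g x"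
    using completion_ex_borel_measurable_real[OF borel_measurable_integrable[OF f]] by blast
  have fg': "AE x in lebesgue. f x = g x"
    using fg by (rule AE_completion)
  have gi: "integrable lborel g"
    using f integrable_cong_AE[OF _ _ fg'] g integrable_completion[OF g]
    by (metis borel_measurable_integrable measurable_completion)
  let ?P = "density lborel (\<lambda>x. ennreal (g x))" and ?N = "density lborel (\<lambda>x. ennreal (- g x))"
  have eq: "emeasure ?P {x<..} = emeasure ?N {x<..}" "emeasure ?P {x<..} < \<infinity>" for x
  proof -
    let ?h = "\<lambda>y. g y * indicat_real {x<..} y"
    have hi: "integrable lborel ?h"
      using integrable_mult_indicator[of "{x<..}" lborel g] gi by (simp add: mult.commute)
    have "(LINT y|lborel. ?h y) = (LINT y|lebesgue. ?h y)"
      using g by (subst integral_completion) auto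
    also have "\<dots> = (LINT y|lebesgue. f y * indicat_real {x<..} y)"
    proof (rule integral_cong_AE)
      have "indicat_real {x<..} \<in> borel_measurable lebesgue"
        by (rule borel_measurable_indicator) auto
      then show "(\<lambda>y. g y * indicat_real {x<..} y) \<in> borel_measurable lebesgue"
        "(\<lambda>y. f y * indicat_real {x<..} y) \<in> borel_measurable lebesgue"
        using borel_measurable_integrable[OF f] measurable_completion[OF g]
        by (intro borel_measurable_times; simp)+
      show "AE y in lebesgue. g y * indicat_real {x<..} y = f y * indicat_real {x<..} y"
        using fg' by eventually_elim simp
    qed
    finally have z: "(LINT y|lborel. ?h y) = 0" using 0 by simp
    have P: "emeasure ?P {x<..} = (\<integral>\<^sup>+ y. ennreal (?h y) \<partial>lborel)"
      using g by (subst emeasure_density) (auto intro!: nn_integral_cong simp: indicator_def)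
    have N: "emeasure ?N {x<..} = (\<integral>\<^sup>+ y. ennreal (- ?h y) \<partial>lborel)"
      using g by (subst emeasure_density) (auto intro!: nn_integral_cong simp: indicator_def)
    have fin: "(\<integral>\<^sup>+ y. ennreal (?h y) \<partial>lborel) < \<infinity>" "(\<integral>\<^sup>+ y. ennreal (- ?h y) \<partial>lborel) < \<infinity>"
      using hi by (auto simp: real_integrable_def top.not_eq_extremum)
    have "enn2real (\<integral>\<^sup>+ y. ennreal (?h y) \<partial>lborel) = enn2real (\<integral>\<^sup>+ y. ennreal (- ?h y) \<partial>lborel)"
      using z real_lebesgue_integral_def[OF hi] by simp
    then show "emeasure ?P {x<..} = emeasure ?N {x<..}" "emeasure ?P {x<..} < \<infinity>"
      using fin unfolding P N by (auto simp: less_top) (metis ennreal_enn2real less_top)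
  qed
  have "?P = ?N"
    by (rule measure_eqI_lessThan) (use eq in auto)
  then have "AE x in lborel. ennreal (g x) = ennreal (- g x)"
    using g by (intro sigma_finite_measure.density_unique[OF lborel.sigma_finite_measure_axioms]) auto
  then have "AE x in lborel. g x = 0"
    by eventually_elim (metis ennreal_eq_0_iff ennreal_neg neg_le_0_iff_le nle_le order_antisym)
  then have "AE x in lborel. f x = 0" using fg by eventually_elim simp
  then show ?thesis by (rule AE_completion)
qed

text \<open>Testing with a primitive of the difference of two bumps, each normalised to integral 1, shows that the
averages of \<open>u\<close> against the two bumps agree. As the bumps approach indicators, \<open>u\<close> has the same
average \<open>C\<close> over all intervals, so the integrals of \<open>u - C\<close> over intervals vanish.\<close>

lemma du_Bois_Reymond:
  assumes u: "locally_integrable u"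
    and 0: "\<And>\<phi>. test_function \<phi> \<Longrightarrow> (LINT x|lebesgue. u x * deriv \<phi> x) = 0"
  obtains C where "AE x in lebesgue. u x = C"
proof -
  have one: "locally_integrable (\<lambda>_. 1)"
    by (rule locally_integrable_continuous) auto
  have bi: "integrable lebesgue (\<lambda>x. v x * bump a b n x)" if "locally_integrable v" for v a b n
    using that by (rule locally_integrable_mult_bump)
  have bi1: "integrable lebesgue (bump a b n)" for a b n
    using bi[OF one] by simp
  have cross: "(LINT x|lebesgue. u x * bump a b n x) * (LINT x|lebesgue. bump c d n x)
      = (LINT x|lebesgue. u x * bump c d n x) * (LINT x|lebesgue. bump a b n x)" if ab: "a < b" "c < d" for a b c d n
  proof -
    let ?A = "LINT x|lebesgue. bump a b n x" and ?B = "LINT x|lebesgue. bump c d n x"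
    \<comment> \<open>Cross-multiplying by the integrals normalises both bumps without a division.\<close>
    define \<psi> where "\<psi> x = ?B * bump a b n (1 * x + 0) + (- ?A) * bump c d n (1 * x + 0)" for x
    have "smooth_real \<psi>"
      unfolding \<psi>_def by (intro smooth_real_add smooth_real_affine smooth_bump)
    moreover have "\<psi> x = 0" if "x \<notin> {min a c..max b d}" for x
    proof -
      have "x \<notin> {a<..<b}" "x \<notin> {c<..<d}" using that by auto
      then show ?thesis by (simp add: \<psi>_def bump_eq_0)
    qed
    moreover have "(LINT x|lebesgue. \<psi> x) = 0"
      unfolding \<psi>_def using bi1 by simp
    ultimately obtain \<phi> where "test_function \<phi>" "deriv \<phi> = \<psi>"
      by (rule test_function_primitive) (use ab in auto)
    then have "(LINT x|lebesgue. u x * \<psi> x) = 0" using 0 by metis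
    also have "(\<lambda>x. u x * \<psi> x) = (\<lambda>x. ?B * (u x * bump a b n x) - ?A * (u x * bump c d n x))"
      by (auto simp: \<psi>_def fun_eq_iff algebra_simps)
    also have "(LINT x|lebesgue. ?B * (u x * bump a b n x) - ?A * (u x * bump c d n x))
        = ?B * (LINT x|lebesgue. u x * bump a b n x) - ?A * (LINT x|lebesgue. u x * bump c d n x)"
      using bi[OF u] by simp
    finally show ?thesis by (simp add: mult.commute)
  qed
  define I where "I a b = (LINT x|lebesgue. u x * indicat_real {a<..<b} x)" for a b
  have len: "(LINT x|lebesgue. 1 * indicat_real {a<..<b} x) = b - a" if "a < b" for a b
    using that by simp
  have Iprop: "I a b * (d - c) = I c d * (b - a)" if "a < b" "c < d" for a b c d
  proof -
    have 1: "(\<lambda>n. LINT x|lebesgue. bump c d n x) \<longlonglongrightarrow> d - c"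
      "(\<lambda>n. LINT x|lebesgue. bump a b n x) \<longlonglongrightarrow> b - a"
      using bump_integral_tendsto[OF one, of c d] bump_integral_tendsto[OF one, of a b] len that by auto
    have "(\<lambda>n. (LINT x|lebesgue. u x * bump a b n x) * (LINT x|lebesgue. bump c d n x)) \<longlonglongrightarrow> I a b * (d - c)"
      unfolding I_def by (intro tendsto_mult bump_integral_tendsto u 1)
    moreover have "(\<lambda>n. (LINT x|lebesgue. u x * bump a b n x) * (LINT x|lebesgue. bump c d n x)) \<longlonglongrightarrow> I c d * (b - a)"
      unfolding cross[OF that] I_def by (intro tendsto_mult bump_integral_tendsto u 1)
    ultimately show ?thesis by (rule LIMSEQ_unique)
  qed
  define C where "C = I 0 1"
  have "AE x in lebesgue. x \<in> {- real N<..<real N} \<longrightarrow> u x = C" for N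
  proof -
    let ?J = "{- real N<..<real N}"
    let ?f = "\<lambda>x. indicat_real ?J x * (u x - C)"
    have si: "integrable lebesgue (\<lambda>x. v x * indicat_real {a<..<b} x)" if "locally_integrable v" for v a b
    proof -
      have "set_integrable lebesgue {a..b} v"
        using that by (auto simp: locally_integrable_def)
      then have "set_integrable lebesgue {a<..<b} v"
        by (rule set_integrable_subset) auto
      then show ?thesis by (simp add: set_integrable_def mult.commute)
    qed
    have fi: "integrable lebesgue ?f"
      using Bochner_Integration.integrable_diff[OF si[OF u] integrable_mult_right[OF si[OF one], of C], of "- real N" "real N" "- real N" "real N"]
      by (simp add: algebra_simps)
    have "(LINT y|lebesgue. ?f y * indicat_real {x<..} y) = 0" for x
    proof -
      let ?a = "max x (- real N)"
      have eq: "(\<lambda>y. ?f y * indicat_real {x<..} y) = (\<lambda>y. u y * indicat_real {?a<..<real N} y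
          - C * (1 * indicat_real {?a<..<real N} y))"
        by (auto simp: fun_eq_iff indicator_def)
      show ?thesis
      proof (cases "?a < real N")
        case True
        have "(LINT y|lebesgue. ?f y * indicat_real {x<..} y) = I ?a (real N) - C * (real N - ?a)"
          unfolding eq I_def using si[OF u] integrable_mult_right[OF si[OF one], of C] len[OF True]
          by (subst Bochner_Integration.integral_diff) auto
        then show ?thesis using Iprop[OF True, of 0 1] by (simp add: C_def)
      next
        case False
        then have "{?a<..<real N} = {}" by auto
        then show ?thesis unfolding eq by simp
      qed
    qed
    from AE_eq_0_if_integrals_vanish[OF fi this] show ?thesis
      by eventually_elim (auto simp: indicator_def)
  qed
  then have "AE x in lebesgue. \<forall>N. x \<in> {- real N<..<real N} \<longrightarrow> u x = C"
    by (subst AE_all_countable) blast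
  then have "AE x in lebesgue. u x = C"
  proof eventually_elim
    case (elim x)
    obtain N where "\<bar>x\<bar> < real N" using reals_Archimedean2 by blast
    then show ?case using elim by (auto simp: abs_less_iff)
  qed
  then show thesis by (rule that)
qed

section \<open>Wavefront profiles as classical solutions\<close>

text \<open>The equation of a profile as a first-order system for \<open>V\<close> and its flux
\<open>w = - |(a(V))'| powr (p - 2) * (a(V))'\<close>, which is nonnegative because \<open>V\<close> decreases. Only \<open>a \<circ> V\<close>
and \<open>w - \<sigma> V\<close> are differentiated: \<open>V\<close> and \<open>w\<close> by themselves can fail to be
differentiable where \<open>V\<close> reaches 0 or \<open>l\<close>.\<close>

definition front :: "real \<Rightarrow> (real \<Rightarrow> real) \<Rightarrow> (real \<Rightarrow> real) \<Rightarrow> real \<Rightarrow> real \<Rightarrow>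
    (real \<Rightarrow> real) \<Rightarrow> (real \<Rightarrow> real) \<Rightarrow> bool" where
  "front \<alpha> a c l \<sigma> V w \<longleftrightarrow>
     continuous_on UNIV V \<and> antimono V \<and> (\<forall>x. V x \<in> {0..l}) \<and>
     (V \<longlongrightarrow> l) at_bot \<and> (V \<longlongrightarrow> 0) at_top \<and>
     continuous_on UNIV w \<and> (\<forall>x. 0 \<le> w x) \<and>
     (\<forall>x. ((\<lambda>x. a (V x)) has_real_derivative - (w x powr \<alpha>)) (at x)) \<and>
     (\<forall>x. ((\<lambda>x. w x - \<sigma> * V x) has_real_derivative c (V x)) (at x))"

lemma p_flux_minus_powr:
  assumes "p > 1" "\<alpha> = 1 / (p - 1)" "0 \<le> w"
  shows "p_flux p (- (w powr \<alpha>)) = - w"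
proof (cases "w = 0")
  case False
  then have "(w powr \<alpha>) powr (p - 2) * w powr \<alpha> = w powr (\<alpha> * (p - 2) + \<alpha>)"
    using assms by (simp add: powr_powr powr_add)
  also have "\<alpha> * (p - 2) + \<alpha> = 1" using assms by (simp add: field_simps)
  finally show ?thesis using False assms by (simp add: p_flux_def)
qed (simp add: p_flux_def)

lemma p_flux_inverse:
  assumes "p > 1" "\<alpha> = 1 / (p - 1)"
  shows "sgn (p_flux p y) * \<bar>p_flux p y\<bar> powr \<alpha> = y"
proof (cases "y = 0")
  case False
  have "\<bar>p_flux p y\<bar> = \<bar>y\<bar> powr (p - 2) * \<bar>y\<bar> powr 1"
    using False by (simp add: p_flux_def abs_mult)
  also have "\<dots> = \<bar>y\<bar> powr (p - 1)"
    using False powr_add[of "\<bar>y\<bar>" "p - 2" 1] by simp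
  finally have "\<bar>p_flux p y\<bar> powr \<alpha> = \<bar>y\<bar>"
    using assms False by (simp add: powr_powr)
  moreover have "sgn (p_flux p y) = sgn y"
    using False by (simp add: p_flux_def sgn_mult)
  ultimately show ?thesis by (simp add: sgn_mult_abs)
qed (simp add: p_flux_def)

lemma continuous_AE_eq_0:
  fixes f :: "real \<Rightarrow> real"
  assumes "continuous_on UNIV f" "AE x in lebesgue. f x = 0"
  shows "f x = 0"
proof -
  have "open {x. f x \<noteq> 0}"
    using assms(1) by (intro open_Collect_neq) auto
  then have "{x. f x \<noteq> 0} \<in> sets lebesgue" by auto
  then have "negligible {x. f x \<noteq> 0}"
    using assms(2) AE_iff_null_sets[of "{x. f x \<noteq> 0}" lebesgue] by (simp add: negligible_iff_null_sets)
  moreover note \<open>open {x. f x \<noteq> 0}\<close>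
  ultimately have "{x. f x \<noteq> 0} = {}"
    using open_not_negligible by blast
  then show ?thesis by auto
qed

lemma antimono_DERIV_nonpos:
  fixes f :: "real \<Rightarrow> real"
  assumes "antimono f" "(f has_real_derivative D) (at x)"
  shows "D \<le> 0"
proof (rule ccontr)
  assume "\<not> D \<le> 0"
  then obtain d where "d > 0" "\<And>h. 0 < h \<Longrightarrow> h < d \<Longrightarrow> f x < f (x + h)"
    using DERIV_pos_inc_right[OF assms(2)] by auto
  then have "f x < f (x + d / 2)" by simp
  then show False using antimonoD[OF assms(1), of x "x + d / 2"] \<open>d > 0\<close> by simp
qed

text \<open>Both weak identities are integrations by parts: one for \<open>a \<circ> V\<close> and one for
\<open>w - \<sigma> V\<close>.\<close>

lemma front_imp_wavefront_profile:
  assumes p: "p > 1" "\<alpha> = 1 / (p - 1)" and "0 < l" and c: "continuous_on {0..l} c"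
    and V: "front \<alpha> a c l \<sigma> V w"
  shows "wavefront_profile p a c l \<sigma> V"
proof -
  note V = V[unfolded front_def]
  let ?g = "\<lambda>x. - (w x powr \<alpha>)"
  have "\<alpha> > 0" using p by simp
  have Vc: "continuous_on UNIV V" and wc: "continuous_on UNIV w" using V by auto
  have gc: "continuous_on UNIV ?g"
    using V \<open>\<alpha> > 0\<close> by (intro continuous_intros continuous_on_powr') auto
  have cV: "continuous_on UNIV (\<lambda>x. c (V x))"
    by (rule continuous_on_compose2[OF c Vc]) (use V in auto)
  have AD: "((\<lambda>x. a (V x)) has_real_derivative ?g x) (at x)" for x using V by auto
  have Ac: "continuous_on UNIV (\<lambda>x. a (V x))"
    using AD by (meson DERIV_isCont continuous_at_imp_continuous_on)
  have flux: "p_flux p (?g x) = - w x" for x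
    using p_flux_minus_powr[OF p] V by auto
  have "weak_derivative (\<lambda>x. a (V x)) ?g"
    unfolding weak_derivative_def
    using integral_by_parts_test_function(3)[OF AD gc]
      locally_integrable_continuous[OF Ac] locally_integrable_continuous[OF gc] by blast
  moreover have "locally_integrable (\<lambda>x. p_flux p (?g x))"
    unfolding flux by (intro locally_integrable_continuous continuous_intros wc)
  moreover have "locally_integrable (\<lambda>x. c (V x))"
    by (rule locally_integrable_continuous[OF cV])
  moreover have "(LINT x|lebesgue. p_flux p (?g x) * deriv \<phi> x + \<sigma> * V x * deriv \<phi> x - c (V x) * \<phi> x) = 0"
    if \<phi>: "test_function \<phi>" for \<phi>
  proof -
    have D: "((\<lambda>x. w x - \<sigma> * V x) has_real_derivative c (V x)) (at x)" for x using V by auto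
    note parts = integral_by_parts_test_function[OF D cV \<phi>]
    have "(LINT x|lebesgue. p_flux p (?g x) * deriv \<phi> x + \<sigma> * V x * deriv \<phi> x - c (V x) * \<phi> x)
       = (LINT x|lebesgue. - ((w x - \<sigma> * V x) * deriv \<phi> x) - c (V x) * \<phi> x)"
      unfolding flux by (simp add: algebra_simps)
    also have "\<dots> = 0" using parts by simp
    finally show ?thesis .
  qed
  ultimately have "travelling_wave_profile p a c l \<sigma> V"
    unfolding travelling_wave_profile_def using V by blast
  moreover have "\<not> V constant_on UNIV"
  proof
    assume "V constant_on UNIV"
    then obtain k where k: "\<And>x. V x = k" by (auto simp: constant_on_def)
    have "V = (\<lambda>_. k)" using k by auto
    then have "k = l" "k = 0"
      using V tendsto_unique[of "at_bot :: real filter" V k l] tendsto_unique[of "at_top :: real filter" V k 0]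
      by auto
    then show False using \<open>0 < l\<close> by simp
  qed
  ultimately show ?thesis unfolding wavefront_profile_def using V by auto
qed

text \<open>Subtracting a primitive of the reaction term turns the weak equation into the statement that a
function has zero weak derivative. So the flux agrees almost everywhere with a continuous function.
Inverting the flux function, the weak derivative of \<open>a \<circ> V\<close> has a continuous representative
too, and a second use of the same principle makes \<open>a \<circ> V\<close> continuously differentiable. A profile that
joins \<open>l\<close> to 0 can be monotone only by being decreasing, which gives the sign of the flux.\<close>

lemma wavefront_profile_imp_front:
  assumes p: "p > 1" "\<alpha> = 1 / (p - 1)" and "0 < l"
    and a: "continuous_on {0..l} a" "mono_on {0..l} a" and c: "continuous_on {0..l} c"
    and V: "wavefront_profile p a c l \<sigma> V"
  obtains w where "front \<alpha> a c l \<sigma> V w"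
proof -
  have "\<alpha> > 0" using p by simp
  have Vc: "continuous_on UNIV V" and Vr: "\<And>x. V x \<in> {0..l}"
    and lim: "(V \<longlongrightarrow> l) at_bot" "(V \<longlongrightarrow> 0) at_top"
    using V by (auto simp: wavefront_profile_def travelling_wave_profile_def)
  have anti: "antimono V"
  proof (rule ccontr)
    assume "\<not> antimono V"
    then have "mono V" using V by (auto simp: wavefront_profile_def)
    have "V x \<ge> l" for x
      by (rule tendsto_upperbound[OF lim(1)])
        (auto intro!: eventually_at_bot_linorderI[of x] monoD[OF \<open>mono V\<close>])
    moreover have "V x \<le> 0" for x
      by (rule tendsto_lowerbound[OF lim(2)])
        (auto intro!: eventually_at_top_linorderI[of x] monoD[OF \<open>mono V\<close>])
    ultimately show False using \<open>0 < l\<close> by (meson not_le order_trans)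
  qed
  obtain g where wd: "weak_derivative (\<lambda>x. a (V x)) g"
    and fl: "locally_integrable (\<lambda>x. p_flux p (g x))"
    and eq: "\<And>\<phi>. test_function \<phi> \<Longrightarrow>
      (LINT x|lebesgue. p_flux p (g x) * deriv \<phi> x + \<sigma> * V x * deriv \<phi> x - c (V x) * \<phi> x) = 0"
    using V by (auto simp: wavefront_profile_def travelling_wave_profile_def)
  have cV: "continuous_on UNIV (\<lambda>x. c (V x))"
    by (rule continuous_on_compose2[OF c Vc]) (use Vr in auto)
  have aV: "continuous_on UNIV (\<lambda>x. a (V x))"
    by (rule continuous_on_compose2[OF a(1) Vc]) (use Vr in auto)
  have mult_deriv: "integrable lebesgue (\<lambda>x. u x * deriv \<phi> x)"
    and mult_test: "integrable lebesgue (\<lambda>x. u x * \<phi> x)"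
    if u: "locally_integrable u" and \<phi>: "test_function \<phi>" for u \<phi>
  proof -
    obtain R where R: "\<And>x. x \<notin> {-R..R} \<Longrightarrow> \<phi> x = 0" "\<And>x. x \<notin> {-R..R} \<Longrightarrow> deriv \<phi> x = 0"
      using test_function_support[OF \<phi>] by metis
    have sm: "smooth_real \<phi>" using \<phi> by (simp add: test_function_def)
    show "integrable lebesgue (\<lambda>x. u x * deriv \<phi> x)"
      by (rule locally_integrable_mult[OF u smooth_real_continuous[OF smooth_real_deriv[OF sm]] R(2)])
    show "integrable lebesgue (\<lambda>x. u x * \<phi> x)"
      by (rule locally_integrable_mult[OF u smooth_real_continuous[OF sm] R(1)])
  qed
  have add: "locally_integrable (\<lambda>x. u x + v x)" if "locally_integrable u" "locally_integrable v" for u v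
    using that unfolding locally_integrable_def by (auto intro: set_integral_add)
  obtain Q where Q: "\<And>x. (Q has_real_derivative c (V x)) (at x)"
    using primitive_on_reals[OF cV] by blast
  have Qc: "continuous_on UNIV Q"
    using Q by (meson DERIV_isCont continuous_at_imp_continuous_on)
  have sVQ: "continuous_on UNIV (\<lambda>x. \<sigma> * V x + Q x)" by (intro continuous_intros Vc Qc)
  obtain C where C: "AE x in lebesgue. p_flux p (g x) + (\<sigma> * V x + Q x) = C"
  proof (rule du_Bois_Reymond)
    show "locally_integrable (\<lambda>x. p_flux p (g x) + (\<sigma> * V x + Q x))"
      by (intro add fl locally_integrable_continuous sVQ)
    fix \<phi> assume \<phi>: "test_function \<phi>"
    note i = mult_deriv[OF fl \<phi>] mult_deriv[OF locally_integrable_continuous[OF Vc] \<phi>]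
      mult_test[OF locally_integrable_continuous[OF cV] \<phi>]
    note parts = integral_by_parts_test_function[OF Q cV \<phi>]
    have i2: "integrable lebesgue (\<lambda>x. \<sigma> * V x * deriv \<phi> x)"
      using integrable_mult_right[OF i(2), of \<sigma>] by (simp add: mult.assoc)
    have "(\<lambda>x. (p_flux p (g x) + (\<sigma> * V x + Q x)) * deriv \<phi> x)
      = (\<lambda>x. (p_flux p (g x) * deriv \<phi> x + \<sigma> * V x * deriv \<phi> x - c (V x) * \<phi> x)
          + (Q x * deriv \<phi> x + c (V x) * \<phi> x))"
      by (auto simp: fun_eq_iff algebra_simps)
    then show "(LINT x|lebesgue. (p_flux p (g x) + (\<sigma> * V x + Q x)) * deriv \<phi> x) = 0"
      using parts eq[OF \<phi>] i i2 by simp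
  qed
  define P where "P x = C - (\<sigma> * V x + Q x)" for x
  have Pc: "continuous_on UNIV P" unfolding P_def by (intro continuous_intros Vc Qc)
  define h where "h x = sgn (P x) * \<bar>P x\<bar> powr \<alpha>" for x
  have gh: "AE x in lebesgue. g x = h x"
    using C
  proof eventually_elim
    case (elim x)
    then have "P x = p_flux p (g x)" by (simp add: P_def)
    then show ?case using p_flux_inverse[OF p] by (simp add: h_def)
  qed
  have hc: "continuous_on UNIV h"
  proof -
    have "h x = max (P x) 0 powr \<alpha> - max (- P x) 0 powr \<alpha>" for x
      by (cases "P x" "0::real" rule: linorder_cases) (auto simp: h_def)
    then have "h = (\<lambda>x. max (P x) 0 powr \<alpha> - max (- P x) 0 powr \<alpha>)" by auto
    then show ?thesis using \<open>\<alpha> > 0\<close>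
      by (auto intro!: continuous_intros continuous_on_powr' Pc)
  qed
  obtain B where B: "\<And>x. (B has_real_derivative h x) (at x)"
    using primitive_on_reals[OF hc] by blast
  have Bc: "continuous_on UNIV B"
    using B by (meson DERIV_isCont continuous_at_imp_continuous_on)
  obtain C' where C': "AE x in lebesgue. a (V x) - B x = C'"
  proof (rule du_Bois_Reymond)
    show "locally_integrable (\<lambda>x. a (V x) - B x)"
      by (intro locally_integrable_continuous continuous_intros aV Bc)
    fix \<phi> assume \<phi>: "test_function \<phi>"
    note parts = integral_by_parts_test_function[OF B hc \<phi>]
    have lg: "locally_integrable g" using wd by (simp add: weak_derivative_def)
    have "(LINT x|lebesgue. g x * \<phi> x) = (LINT x|lebesgue. h x * \<phi> x)"
    proof (rule integral_cong_AE)
      show "AE x in lebesgue. g x * \<phi> x = h x * \<phi> x" using gh by eventually_elim simp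
    qed (use parts mult_test[OF lg \<phi>] in \<open>auto intro: borel_measurable_integrable\<close>)
    moreover have "(LINT x|lebesgue. a (V x) * deriv \<phi> x) = - (LINT x|lebesgue. g x * \<phi> x)"
      using wd \<phi> by (auto simp: weak_derivative_def)
    ultimately show "(LINT x|lebesgue. (a (V x) - B x) * deriv \<phi> x) = 0"
      using parts mult_deriv[OF locally_integrable_continuous[OF aV] \<phi>]
      by (simp add: left_diff_distrib)
  qed
  have "a (V x) - B x - C' = 0" for x
    by (rule continuous_AE_eq_0) (use C' in \<open>auto intro!: continuous_intros aV Bc\<close>)
  then have "(\<lambda>x. a (V x)) = (\<lambda>x. B x + C')" by (auto simp: fun_eq_iff algebra_simps)
  then have AD: "((\<lambda>x. a (V x)) has_real_derivative h x) (at x)" for x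
    by (auto intro!: derivative_eq_intros B)
  have "antimono (\<lambda>x. a (V x))"
    by (intro antimonoI mono_onD[OF a(2)]) (use anti Vr in \<open>auto dest: antimonoD\<close>)
  then have "h x \<le> 0" for x using antimono_DERIV_nonpos[OF _ AD] by blast
  then have P: "P x \<le> 0" for x
    by (metis h_def abs_sgn_eq less_eq_real_def linorder_not_le mult_pos_pos powr_gt_zero sgn_pos zero_less_one zero_less_abs_iff)
  have hP: "h x = - ((- P x) powr \<alpha>)" for x
    using P[of x] by (cases "P x = 0") (auto simp: h_def)
  have "((\<lambda>x. - P x - \<sigma> * V x) has_real_derivative c (V x)) (at x)" for x
    unfolding P_def by (auto intro!: derivative_eq_intros Q)
  then have "front \<alpha> a c l \<sigma> V (\<lambda>x. - P x)"
    unfolding front_def using AD P Vc Vr anti lim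
    by (auto simp: hP intro!: continuous_intros Pc)
  then show thesis by (rule that)
qed

section \<open>Bistable data and their reflection\<close>

text \<open>\<open>K\<close> is the primitive of \<open>c a'\<close> that vanishes at 0. It is a parameter, described by
its derivative, and not an integral, so that the reflected data below form an instance as well.\<close>

locale bistable =
  fixes \<alpha> l u0 :: real and a da c K :: "real \<Rightarrow> real"
  assumes \<alpha>: "0 < \<alpha>" and u0: "0 < u0" "u0 < l"
    and a_cont: "continuous_on {0..l} a"
    and a_DERIV: "\<And>u. u \<in> {0<..<l} \<Longrightarrow> (a has_real_derivative da u) (at u)"
    and da_pos: "\<And>u. u \<in> {0<..<l} \<Longrightarrow> 0 < da u"
    and da_cont: "continuous_on {0<..<l} da"
    and c_cont: "continuous_on {0..l} c"
    and c_ends: "c 0 = 0" "c l = 0"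
    and c_nonpos: "\<And>u. u \<in> {0..u0} \<Longrightarrow> c u \<le> 0"
    and c_nonneg: "\<And>u. u \<in> {u0..l} \<Longrightarrow> 0 \<le> c u"
    and K_cont: "continuous_on {0..l} K"
    and K_0: "K 0 = 0"
    and K_DERIV: "\<And>u. u \<in> {0<..<l} \<Longrightarrow> (K has_real_derivative c u * da u) (at u)"
begin

text \<open>Under \<open>V(x) \<mapsto> l - V(-x)\<close> a front with speed \<open>\<sigma>\<close> becomes a front with speed
\<open>- \<sigma>\<close> for these data, whose total reaction potential is \<open>- K l\<close>. This exchanges the two ends of
the front, and the cases \<open>K l > 0\<close> and \<open>K l < 0\<close>, so that only one of each needs an argument.\<close>

lemma reflected:
  "bistable \<alpha> l (l - u0) (\<lambda>u. - a (l - u)) (\<lambda>u. da (l - u)) (\<lambda>u. - c (l - u)) (\<lambda>u. K (l - u) - K l)"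
proof
  have m: "continuous_on {0..l} (\<lambda>u. l - u)" "(\<lambda>u. l - u) ` {0..l} \<subseteq> {0..l}"
    "continuous_on {0<..<l} (\<lambda>u. l - u)" "(\<lambda>u. l - u) ` {0<..<l} \<subseteq> {0<..<l}"
    by (auto intro!: continuous_intros)
  show "continuous_on {0..l} (\<lambda>u. - a (l - u))" "continuous_on {0..l} (\<lambda>u. - c (l - u))"
    "continuous_on {0..l} (\<lambda>u. K (l - u) - K l)"
    by (intro continuous_intros continuous_on_compose2[OF a_cont m(1,2)]
        continuous_on_compose2[OF c_cont m(1,2)] continuous_on_compose2[OF K_cont m(1,2)])+
  show "continuous_on {0<..<l} (\<lambda>u. da (l - u))"
    by (rule continuous_on_compose2[OF da_cont m(3,4)])
  fix u assume u: "u \<in> {0<..<l}"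
  then have lu: "l - u \<in> {0<..<l}" by auto
  have r: "((\<lambda>u. l - u) has_real_derivative -1) (at u)"
    by (auto intro!: derivative_eq_intros)
  show "((\<lambda>u. - a (l - u)) has_real_derivative da (l - u)) (at u)"
    using DERIV_minus[OF DERIV_chain2[OF a_DERIV[OF lu] r]] by simp
  show "((\<lambda>u. K (l - u) - K l) has_real_derivative - c (l - u) * da (l - u)) (at u)"
    using DERIV_diff[OF DERIV_chain2[OF K_DERIV[OF lu] r] DERIV_const[of "K l"]] by simp
qed (use \<alpha> u0 c_ends K_0 in \<open>simp_all add: c_nonneg c_nonpos da_pos\<close>)

lemma front_reflected:
  assumes "front \<alpha> a c l \<sigma> V w"
  shows "front \<alpha> (\<lambda>u. - a (l - u)) (\<lambda>u. - c (l - u)) l (- \<sigma>) (\<lambda>x. l - V (- x)) (\<lambda>x. w (- x))"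
proof -
  note V = assms[unfolded front_def]
  have m: "continuous_on UNIV (\<lambda>x::real. - x)" by (intro continuous_intros)
  have Vc: "continuous_on UNIV (\<lambda>x. V (- x))" "continuous_on UNIV (\<lambda>x. w (- x))"
    using V by (auto simp: front_def intro!: continuous_on_compose2[OF _ m])
  have lim: "((\<lambda>x. V (- x)) \<longlongrightarrow> 0) at_bot" "((\<lambda>x. V (- x)) \<longlongrightarrow> l) at_top"
    using V filterlim_at_bot_mirror[of V "nhds l"] filterlim_at_top_mirror[of V "nhds 0"] by auto
  have r: "(uminus has_real_derivative -1) (at x)" for x :: real
    by (auto intro!: derivative_eq_intros)
  have A: "((\<lambda>x. - a (V (- x))) has_real_derivative - (w (- x) powr \<alpha>)) (at x)" for x
  proof -
    have "((\<lambda>x. a (V x)) has_real_derivative - (w (- x) powr \<alpha>)) (at (- x))" using V by blast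
    from DERIV_minus[OF DERIV_chain2[OF this r]] show ?thesis by simp
  qed
  have W: "((\<lambda>x. w (- x) - - \<sigma> * (l - V (- x))) has_real_derivative - c (V (- x))) (at x)" for x
  proof -
    have "((\<lambda>x. w x - \<sigma> * V x) has_real_derivative c (V (- x))) (at (- x))" using V by blast
    from DERIV_add[OF DERIV_chain2[OF this r] DERIV_const[of "\<sigma> * l"]]
    show ?thesis by (simp add: algebra_simps)
  qed
  have anti: "antimono V" using V by auto
  have "antimono (\<lambda>x. l - V (- x))"
    by (intro antimonoI diff_left_mono antimonoD[OF anti]) simp
  moreover have "((\<lambda>x. l - V (- x)) \<longlongrightarrow> l) at_bot" "((\<lambda>x. l - V (- x)) \<longlongrightarrow> 0) at_top"
    using tendsto_diff[OF tendsto_const lim(1), of l] tendsto_diff[OF tendsto_const lim(2), of l] by auto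
  ultimately show ?thesis
    unfolding front_def using V A W by (auto intro!: continuous_intros Vc)
qed

section \<open>Flux and energy of a front\<close>

lemma a_less:
  assumes "0 \<le> u" "u < v" "v \<le> l"
  shows "a u < a v"
proof (rule DERIV_pos_imp_increasing_open[OF assms(2)])
  show "continuous_on {u..v} a"
    using assms by (intro continuous_on_subset[OF a_cont]) auto
  fix x assume "u < x" "x < v"
  then have "x \<in> {0<..<l}" using assms by auto
  then show "\<exists>y. (a has_real_derivative y) (at x) \<and> 0 < y"
    using a_DERIV da_pos by blast
qed

lemma a_mono: "mono_on {0..l} a"
  by (rule mono_onI) (metis a_less atLeastAtMost_iff order_le_less)

text \<open>Far to the right \<open>V\<close> lies below \<open>u0\<close>, so \<open>w - \<sigma> V\<close> is
decreasing there, and it is bounded below; hence \<open>w\<close> has a limit. A positive limit would make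
\<open>a(V)\<close> decrease at least linearly, although it is bounded.\<close>

lemma front_flux_tendsto_at_top:
  assumes V: "front \<alpha> a c l \<sigma> V w"
  shows "(w \<longlongrightarrow> 0) at_top"
proof -
  note V = V[unfolded front_def]
  have Vr: "0 \<le> V x" "V x \<le> l" for x using V by auto
  have "eventually (\<lambda>x. V x < u0) at_top"
    using V u0(1) by (auto intro: order_tendstoD)
  then obtain R where R: "\<And>x. R \<le> x \<Longrightarrow> V x < u0"
    by (auto simp: eventually_at_top_linorder)
  define q where "q x = w x - \<sigma> * V x" for x
  have qD: "(q has_real_derivative c (V x)) (at x)" for x
    using V unfolding q_def by auto
  have qdec: "q y \<le> q x" if "R \<le> x" "x \<le> y" for x y
  proof (rule DERIV_nonpos_imp_nonincreasing[OF that(2)])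
    fix z assume "x \<le> z"
    then have "c (V z) \<le> 0" using R[of z] Vr[of z] that by (intro c_nonpos) auto
    then show "\<exists>D. (q has_real_derivative D) (at z) \<and> D \<le> 0" using qD by blast
  qed
  define m where "m = Inf (q ` {R..})"
  have bdd: "bdd_below (q ` {R..})"
  proof (rule bdd_belowI2)
    fix x
    have "\<sigma> * V x \<le> \<bar>\<sigma>\<bar> * l"
      by (rule mult_mono) (use Vr[of x] in auto)
    then show "- (\<bar>\<sigma>\<bar> * l) \<le> q x" using V unfolding q_def by (smt (verit))
  qed
  have "(q \<longlongrightarrow> m) at_top"
  proof (rule decreasing_tendsto)
    show "eventually (\<lambda>x. m \<le> q x) at_top"
      unfolding m_def using bdd by (auto intro!: eventually_at_top_linorderI[of R] cInf_lower)
    fix y assume "m < y"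
    then obtain x where "R \<le> x" "q x < y"
      using cInf_less_iff[of "q ` {R..}" y] bdd unfolding m_def by auto
    then show "eventually (\<lambda>x. q x < y) at_top"
      using qdec by (auto intro!: eventually_at_top_linorderI[of x] elim: order.strict_trans1[rotated])
  qed
  then have "((\<lambda>x. q x + \<sigma> * V x) \<longlongrightarrow> m + \<sigma> * 0) at_top"
    using V by (intro tendsto_intros) auto
  then have wm: "(w \<longlongrightarrow> m) at_top" by (simp add: q_def)
  have "m \<ge> 0" by (rule tendsto_lowerbound[OF wm]) (use V in auto)
  moreover have "\<not> m > 0"
  proof
    assume "m > 0"
    then have "eventually (\<lambda>x. m / 2 < w x) at_top"
      using wm by (intro order_tendstoD) auto
    then obtain S where S: "\<And>x. S \<le> x \<Longrightarrow> m / 2 < w x"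
      by (auto simp: eventually_at_top_linorder)
    define k where "k = (m / 2) powr \<alpha>"
    have "k > 0" using \<open>m > 0\<close> by (simp add: k_def)
    \<comment> \<open>Decreasing at rate \<open>k\<close> for time \<open>t\<close> takes \<open>a \<circ> V\<close> from its value at \<open>S\<close> to below its minimum.\<close>
    define t where "t = (a (V S) - a 0) / k + 1"
    have a0: "a 0 \<le> a (V x)" for x
      using mono_onD[OF a_mono, of 0 "V x"] Vr[of x] by auto
    have "t > 0" using a0[of S] \<open>k > 0\<close> by (simp add: t_def add_nonneg_pos)
    have "a (V (S + t)) + k * (S + t) \<le> a (V S) + k * S"
    proof (rule DERIV_nonpos_imp_nonincreasing[of S "S + t" "\<lambda>x. a (V x) + k * x"])
      fix x assume "S \<le> x"
      have "((\<lambda>x. a (V x) + k * x) has_real_derivative - (w x powr \<alpha>) + k) (at x)"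
        using V by (auto intro!: derivative_eq_intros)
      moreover have "k \<le> w x powr \<alpha>"
        unfolding k_def using S[OF \<open>S \<le> x\<close>] \<open>m > 0\<close> \<alpha> by (intro powr_mono2) auto
      ultimately show "\<exists>y. ((\<lambda>x. a (V x) + k * x) has_real_derivative y) (at x) \<and> y \<le> 0"
        by (intro exI[of _ "- (w x powr \<alpha>) + k"]) auto
    qed (use \<open>t > 0\<close> in auto)
    then have "a 0 + k * t \<le> a (V S)" using a0[of "S + t"] by (simp add: algebra_simps)
    moreover have "k * t = a (V S) - a 0 + k"
      using \<open>k > 0\<close> by (simp add: t_def field_simps)
    ultimately show False using \<open>k > 0\<close> by simp
  qed
  ultimately show ?thesis using wm by simp
qed

lemma front_flux_tendsto_at_bot:
  assumes V: "front \<alpha> a c l \<sigma> V w"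
  shows "(w \<longlongrightarrow> 0) at_bot"
  using bistable.front_flux_tendsto_at_top[OF reflected front_reflected[OF V]]
  by (simp add: filterlim_at_bot_mirror)

text \<open>At such a point \<open>a \<circ> V\<close> has an extremum.\<close>

lemma front_flux_eq_0:
  assumes V: "front \<alpha> a c l \<sigma> V w" and x: "V x \<notin> {0<..<l}"
  shows "w x = 0"
proof -
  note V = V[unfolded front_def]
  have Vr: "V y \<in> {0..l}" for y using V by auto
  have D: "((\<lambda>x. a (V x)) has_real_derivative - (w x powr \<alpha>)) (at x)" using V by auto
  have "V x = 0 \<or> V x = l" using x Vr[of x] by auto
  then have "- (w x powr \<alpha>) = 0"
  proof
    assume "V x = 0"
    then have "\<forall>y. \<bar>x - y\<bar> < 1 \<longrightarrow> a (V x) \<le> a (V y)"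
      using Vr u0 by (auto intro!: mono_onD[OF a_mono])
    with D show ?thesis by (rule DERIV_local_min[OF _ zero_less_one])
  next
    assume "V x = l"
    then have "\<forall>y. \<bar>x - y\<bar> < 1 \<longrightarrow> a (V y) \<le> a (V x)"
      using Vr u0 by (auto intro!: mono_onD[OF a_mono])
    with D show ?thesis by (rule DERIV_local_max[OF _ zero_less_one])
  qed
  then show ?thesis by simp
qed

text \<open>The set where \<open>w \<ge> \<epsilon>\<close> is compact, since \<open>w\<close> vanishes at infinity, and on it
\<open>V\<close> stays away from 0 and \<open>l\<close>. This covers at once the fronts that reach an end value at a finite
point and those that do not.\<close>

lemma front_flux_small:
  assumes V: "front \<alpha> a c l \<sigma> V w" and "\<epsilon> > 0"
  obtains \<delta> where "\<delta> > 0" "\<And>x. V x < \<delta> \<Longrightarrow> w x < \<epsilon>" "\<And>x. V x > l - \<delta> \<Longrightarrow> w x < \<epsilon>"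
proof -
  have Vc: "continuous_on UNIV V" and wc: "continuous_on UNIV w" and Vr: "\<And>x. V x \<in> {0..l}"
    using V by (auto simp: front_def)
  define S where "S = {x. \<epsilon> \<le> w x}"
  show thesis
  proof (cases "S = {}")
    case True
    then show thesis by (intro that[of 1]) (auto simp: S_def not_le)
  next
    case False
    have "closed S" unfolding S_def by (intro closed_Collect_le continuous_intros wc)
    moreover have "bounded S"
    proof -
      have "eventually (\<lambda>x. w x < \<epsilon>) at_top" "eventually (\<lambda>x. w x < \<epsilon>) at_bot"
        using front_flux_tendsto_at_top[OF V] front_flux_tendsto_at_bot[OF V] \<open>\<epsilon> > 0\<close>
        by (auto intro: order_tendstoD)
      then obtain b b' where "\<And>x. b \<le> x \<Longrightarrow> w x < \<epsilon>" "\<And>x. x \<le> b' \<Longrightarrow> w x < \<epsilon>"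
        by (auto simp: eventually_at_top_linorder eventually_at_bot_linorder)
      then have "S \<subseteq> {b'..b}" unfolding S_def
        by (metis atLeastAtMost_iff linorder_not_less mem_Collect_eq nle_le subsetI)
      then show ?thesis by (rule bounded_subset[rotated]) simp
    qed
    ultimately have "compact S" by (simp add: compact_eq_bounded_closed)
    have VS: "continuous_on S V" using Vc by (rule continuous_on_subset) simp
    obtain x1 where x1: "x1 \<in> S" "\<And>x. x \<in> S \<Longrightarrow> V x1 \<le> V x"
      using continuous_attains_inf[OF \<open>compact S\<close> False VS] by blast
    obtain x2 where x2: "x2 \<in> S" "\<And>x. x \<in> S \<Longrightarrow> V x \<le> V x2"
      using continuous_attains_sup[OF \<open>compact S\<close> False VS] by blast
    have "V x \<in> {0<..<l}" if "x \<in> S" for x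
      using front_flux_eq_0[OF V, of x] that \<open>\<epsilon> > 0\<close> by (cases "V x \<in> {0<..<l}") (auto simp: S_def)
    with x1(1) x2(1) have "V x1 \<in> {0<..<l}" "V x2 \<in> {0<..<l}" by auto
    then show thesis using x1(2) x2(2)
      by (intro that[of "min (V x1) (l - V x2)"]) (force simp: S_def not_le[symmetric])+
  qed
qed

text \<open>The inverse of \<open>a\<close> is differentiable on the open range; the difference quotient of \<open>V\<close> is
that of \<open>a \<circ> V\<close> divided by Caratheodory's slope function of \<open>a\<close>.\<close>

lemma front_DERIV:
  assumes V: "front \<alpha> a c l \<sigma> V w" and x: "V x \<in> {0<..<l}"
  shows "(V has_real_derivative - (w x powr \<alpha>) / da (V x)) (at x)"
    and "(w has_real_derivative \<sigma> * (- (w x powr \<alpha>) / da (V x)) + c (V x)) (at x)"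
proof -
  note V = V[unfolded front_def]
  have A: "((\<lambda>x. a (V x)) has_real_derivative - (w x powr \<alpha>)) (at x)" using V by auto
  obtain g where g: "\<And>v. a v - a (V x) = g v * (v - V x)" "isCont g (V x)" "g (V x) = da (V x)"
    using a_DERIV[OF x] unfolding CARAT_DERIV by auto
  have Vx: "isCont V x" using V by (auto simp: continuous_on_eq_continuous_at)
  have "isCont (\<lambda>y. g (V y)) x"
    by (rule isCont_o2[OF Vx]) (rule g(2))
  then have gV: "((\<lambda>y. g (V y)) \<longlongrightarrow> da (V x)) (at x)"
    using g(3) by (simp add: isCont_def)
  have "((\<lambda>y. (a (V y) - a (V x)) / (y - x) / g (V y)) \<longlongrightarrow> - (w x powr \<alpha>) / da (V x)) (at x)"
    using A gV da_pos[OF x] by (intro tendsto_intros) (auto simp: has_field_derivative_iff)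
  moreover have "eventually (\<lambda>y. g (V y) \<noteq> 0) (at x)"
    using tendsto_imp_eventually_ne[OF gV, of 0] da_pos[OF x] by auto
  then have "eventually (\<lambda>y. (a (V y) - a (V x)) / (y - x) / g (V y) = (V y - V x) / (y - x)) (at x)"
    by eventually_elim (simp add: g(1))
  ultimately show V': "(V has_real_derivative - (w x powr \<alpha>) / da (V x)) (at x)"
    unfolding has_field_derivative_iff by (rule Lim_transform_eventually)
  have "((\<lambda>x. w x - \<sigma> * V x) has_real_derivative c (V x)) (at x)" using V by auto
  from DERIV_add[OF this DERIV_cmult[OF V', of \<sigma>]]
  show "(w has_real_derivative \<sigma> * (- (w x powr \<alpha>) / da (V x)) + c (V x)) (at x)"
    by (simp add: add.commute)
qed

lemma front_surj:
  assumes V: "front \<alpha> a c l \<sigma> V w" and u: "u \<in> {0<..<l}"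
  obtains x where "V x = u"
proof -
  note V = V[unfolded front_def]
  have "eventually (\<lambda>x. V x < u) at_top" "eventually (\<lambda>x. V x > u) at_bot"
    using V u by (auto intro: order_tendstoD)
  then obtain b b' where b: "\<And>x. b \<le> x \<Longrightarrow> V x < u" "\<And>x. x \<le> b' \<Longrightarrow> u < V x"
    by (auto simp: eventually_at_top_linorder eventually_at_bot_linorder)
  have "\<exists>x\<ge>min b b'. x \<le> b \<and> V x = u"
    by (rule IVT2') (use b V in \<open>auto intro: less_imp_le continuous_on_subset\<close>)
  then show thesis using that by blast
qed

end

text \<open>The chain rule for real powers covers \<open>w x > 0\<close>. At a zero of \<open>w\<close>,
\<open>w powr (\<alpha> + 1) = w \<cdot> w powr \<alpha>\<close> is the product of a differentiable function that vanishes with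
a continuous function.\<close>

lemma DERIV_powr_Suc_nonneg:
  fixes w :: "real \<Rightarrow> real"
  assumes w: "(w has_real_derivative D) (at x)" "\<And>y. 0 \<le> w y" and "0 < \<alpha>"
  shows "((\<lambda>y. w y powr (\<alpha> + 1) / (\<alpha> + 1)) has_real_derivative w x powr \<alpha> * D) (at x)"
proof (cases "w x = 0")
  case False
  then have "w x > 0" using w(2)[of x] by simp
  have "((\<lambda>y. w y powr (\<alpha> + 1)) has_real_derivative (\<alpha> + 1) * w x powr (\<alpha> + 1 - 1) * D) (at x)"
    by (rule DERIV_chain2[OF has_real_derivative_powr[OF \<open>w x > 0\<close>] w(1)])
  from DERIV_cdivide[OF this, of "\<alpha> + 1"] show ?thesis using \<open>0 < \<alpha>\<close> by simp
next
  case True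
  have "isCont (\<lambda>y. w y powr \<alpha>) x"
    using DERIV_isCont[OF w(1)] w(2) \<open>0 < \<alpha>\<close> unfolding isCont_def
    by (intro tendsto_powr' tendsto_const) auto
  then have "((\<lambda>y. w y powr \<alpha> / (\<alpha> + 1) * ((w y - w x) / (y - x))) \<longlongrightarrow> 0 / (\<alpha> + 1) * D) (at x)"
    using w(1) True \<open>0 < \<alpha>\<close> by (intro tendsto_intros) (auto simp: isCont_def has_field_derivative_iff)
  then show ?thesis
    using w(2) True unfolding has_field_derivative_iff by (simp add: powr_add mult_ac)
qed

context bistable
begin

text \<open>The first integral of the system in the case \<open>\<sigma> = 0\<close>; in general the speed acts as friction.\<close>

definition energy :: "(real \<Rightarrow> real) \<Rightarrow> (real \<Rightarrow> real) \<Rightarrow> real \<Rightarrow> real" where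
  "energy V w x = w x powr (\<alpha> + 1) / (\<alpha> + 1) + K (V x)"

lemma energy_DERIV:
  assumes V: "front \<alpha> a c l \<sigma> V w" and x: "V x \<in> {0<..<l}"
  shows "(energy V w has_real_derivative - \<sigma> * ((w x powr \<alpha>)\<^sup>2 / da (V x))) (at x)"
proof -
  have w0: "\<And>y. 0 \<le> w y" using V by (auto simp: front_def)
  have "(energy V w has_real_derivative
      w x powr \<alpha> * (\<sigma> * (- (w x powr \<alpha>) / da (V x)) + c (V x))
      + c (V x) * da (V x) * (- (w x powr \<alpha>) / da (V x))) (at x)"
    unfolding energy_def[abs_def]
    by (intro DERIV_add DERIV_powr_Suc_nonneg front_DERIV(2)[OF V x] w0 \<alpha>
        DERIV_chain2[OF K_DERIV[OF x] front_DERIV(1)[OF V x]])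
  then show ?thesis
    using da_pos[OF x] by (simp add: algebra_simps power2_eq_square)
qed

lemma energy_mono:
  assumes V: "front \<alpha> a c l \<sigma> V w" and "V x < l" "0 < V y" "x \<le> y"
  shows "0 \<le> \<sigma> \<Longrightarrow> energy V w y \<le> energy V w x" "\<sigma> \<le> 0 \<Longrightarrow> energy V w x \<le> energy V w y"
proof -
  have J: "V t \<in> {0<..<l}" if "x \<le> t" "t \<le> y" for t
  proof -
    have "antimono V" using V by (simp add: front_def)
    then show ?thesis using antimonoD[of V x t] antimonoD[of V t y] that assms(2,3) by simp
  qed
  have pos: "0 \<le> (w t powr \<alpha>)\<^sup>2 / da (V t)" if "x \<le> t" "t \<le> y" for t
    using da_pos[OF J[OF that]] by simp
  have D: "(energy V w has_real_derivative - \<sigma> * ((w t powr \<alpha>)\<^sup>2 / da (V t))) (at t)"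
    if "x \<le> t" "t \<le> y" for t
    by (rule energy_DERIV[OF V J[OF that]])
  show "energy V w y \<le> energy V w x" if \<sigma>: "0 \<le> \<sigma>"
  proof (rule DERIV_nonpos_imp_nonincreasing[OF \<open>x \<le> y\<close>])
    fix t assume t: "x \<le> t" "t \<le> y"
    have "- \<sigma> * ((w t powr \<alpha>)\<^sup>2 / da (V t)) \<le> 0"
      by (rule mult_nonpos_nonneg) (use \<sigma> pos[OF t] in auto)
    with D[OF t] show "\<exists>D. (energy V w has_real_derivative D) (at t) \<and> D \<le> 0" by blast
  qed
  show "energy V w x \<le> energy V w y" if \<sigma>: "\<sigma> \<le> 0"
  proof (rule DERIV_nonneg_imp_nondecreasing[OF \<open>x \<le> y\<close>])
    fix t assume t: "x \<le> t" "t \<le> y"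
    have "0 \<le> - \<sigma> * ((w t powr \<alpha>)\<^sup>2 / da (V t))"
      by (rule mult_nonneg_nonneg) (use \<sigma> pos[OF t] in auto)
    with D[OF t] show "\<exists>D. (energy V w has_real_derivative D) (at t) \<and> 0 \<le> D" by blast
  qed
qed

text \<open>The energy of a front drops or rises from \<open>K l\<close> to 0, so the sign of \<open>K l\<close> decides the
sign of the speed.\<close>

lemma energy_near_ends:
  assumes V: "front \<alpha> a c l \<sigma> V w" and "\<epsilon> > 0"
  obtains \<delta> where "\<delta> > 0" "\<And>x. V x < \<delta> \<Longrightarrow> \<bar>energy V w x\<bar> < \<epsilon>"
    "\<And>x. V x > l - \<delta> \<Longrightarrow> \<bar>energy V w x - K l\<bar> < \<epsilon>"
proof -
  have Vr: "V x \<in> {0..l}" and w0: "0 \<le> w x" for x using V by (auto simp: front_def)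
  \<comment> \<open>For \<open>w \<le> 1\<close> the kinetic part of the energy is at most \<open>w\<close>.\<close>
  have "min 1 (\<epsilon> / 2) > 0" using \<open>\<epsilon> > 0\<close> by simp
  from front_flux_small[OF V this] obtain \<delta> where \<delta>: "\<delta> > 0"
    "\<And>x. V x < \<delta> \<Longrightarrow> w x < min 1 (\<epsilon> / 2)" "\<And>x. V x > l - \<delta> \<Longrightarrow> w x < min 1 (\<epsilon> / 2)" by blast
  have small: "\<bar>w x powr (\<alpha> + 1) / (\<alpha> + 1)\<bar> < \<epsilon> / 2" if "w x < min 1 (\<epsilon> / 2)" for x
  proof -
    have "w x powr (\<alpha> + 1) / (\<alpha> + 1) \<le> w x powr (\<alpha> + 1)"
      using \<alpha> by (simp add: divide_le_eq mult_left_le algebra_simps)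
    also have "\<dots> \<le> w x powr 1"
      using that w0[of x] \<alpha> by (intro powr_mono') auto
    also have "\<dots> < \<epsilon> / 2" using that w0[of x] by simp
    finally show ?thesis using \<alpha> by simp
  qed
  have l: "0 \<in> {0..l}" "l \<in> {0..l}" using u0 by auto
  obtain d1 where d1: "d1 > 0" "\<And>u. u \<in> {0..l} \<Longrightarrow> dist u 0 < d1 \<Longrightarrow> dist (K u) (K 0) < \<epsilon> / 2"
    using K_cont l \<open>\<epsilon> > 0\<close> unfolding continuous_on_iff by (metis half_gt_zero)
  obtain d2 where d2: "d2 > 0" "\<And>u. u \<in> {0..l} \<Longrightarrow> dist u l < d2 \<Longrightarrow> dist (K u) (K l) < \<epsilon> / 2"
    using K_cont l \<open>\<epsilon> > 0\<close> unfolding continuous_on_iff by (metis half_gt_zero)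
  show thesis
  proof (rule that[of "min \<delta> (min d1 d2)"])
    show "\<bar>energy V w x\<bar> < \<epsilon>" if "V x < min \<delta> (min d1 d2)" for x
    proof -
      have "\<bar>K (V x)\<bar> < \<epsilon> / 2" using d1(2)[OF Vr[of x]] that Vr[of x] K_0 by (simp add: dist_real_def)
      moreover have "\<bar>w x powr (\<alpha> + 1) / (\<alpha> + 1)\<bar> < \<epsilon> / 2" using small \<delta>(2)[of x] that by simp
      ultimately show ?thesis
        unfolding energy_def by (smt (verit) field_sum_of_halves)
    qed
    show "\<bar>energy V w x - K l\<bar> < \<epsilon>" if "V x > l - min \<delta> (min d1 d2)" for x
    proof -
      have "\<bar>K (V x) - K l\<bar> < \<epsilon> / 2" using d2(2)[OF Vr[of x]] that Vr[of x] by (simp add: dist_real_def)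
      moreover have "\<bar>w x powr (\<alpha> + 1) / (\<alpha> + 1)\<bar> < \<epsilon> / 2" using small \<delta>(3)[of x] that by simp
      ultimately show ?thesis
        unfolding energy_def by (smt (verit) field_sum_of_halves)
    qed
  qed (use \<delta> d1 d2 in auto)
qed

lemma energy_points_near_ends:
  assumes V: "front \<alpha> a c l \<sigma> V w" and x: "V x \<in> {0<..<l}" and "\<epsilon> > 0"
  obtains y z where "y \<le> x" "x \<le> z" "V y < l" "0 < V z"
    "\<bar>energy V w y - K l\<bar> < \<epsilon>" "\<bar>energy V w z\<bar> < \<epsilon>"
proof -
  obtain \<delta> where \<delta>: "\<delta> > 0" "\<And>x. V x < \<delta> \<Longrightarrow> \<bar>energy V w x\<bar> < \<epsilon>"
    "\<And>x. V x > l - \<delta> \<Longrightarrow> \<bar>energy V w x - K l\<bar> < \<epsilon>"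
    using energy_near_ends[OF V \<open>\<epsilon> > 0\<close>] by blast
  have anti: "antimono V" using V by (auto simp: front_def)
  obtain y where y: "V y = (max (V x) (l - \<delta>) + l) / 2"
    by (rule front_surj[OF V, of "(max (V x) (l - \<delta>) + l) / 2"])
      (use x \<delta>(1) in auto)
  obtain z where z: "V z = min (V x) \<delta> / 2"
    by (rule front_surj[OF V, of "min (V x) \<delta> / 2"]) (use x \<delta>(1) in auto)
  have "V x < V y" "V y < l" "V z < V x" "0 < V z" "V y > l - \<delta>" "V z < \<delta>"
    unfolding y z using x \<delta>(1) by (auto simp: max_def min_def field_simps)
  moreover have "y \<le> x" "x \<le> z"
    using antimonoD[OF anti] \<open>V x < V y\<close> \<open>V z < V x\<close> by (meson linorder_not_le less_imp_le)+
  ultimately show thesis using that \<delta> by blast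
qed

text \<open>The three alternatives for the sign of the total reaction potential. They keep the flux from vanishing
in the interior of a front, where the profile could otherwise rest at a zero of \<open>c\<close> for an arbitrary
time, and translation would not be the only freedom left.\<close>

definition nondegenerate :: bool where
  "nondegenerate \<longleftrightarrow> (K l > 0 \<and> (\<forall>u\<in>{u0<..<l}. c u > 0)) \<or> (K l = 0 \<and> (\<forall>u\<in>{0<..<l}. K u < 0)) \<or>
     (K l < 0 \<and> (\<forall>u\<in>{0<..<u0}. c u < 0))"

text \<open>Otherwise the energy would not decrease along the front, from near \<open>K l > 0\<close> to near 0.\<close>

lemma front_speed_pos:
  assumes V: "front \<alpha> a c l \<sigma> V w" and "K l > 0"
  shows "\<sigma> > 0"
proof (rule ccontr)
  assume \<sigma>: "\<not> \<sigma> > 0"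
  obtain x where x: "V x = u0" by (rule front_surj[OF V, of u0]) (use u0 in auto)
  obtain y z where yz: "y \<le> x" "x \<le> z" "V y < l" "0 < V z"
    "\<bar>energy V w y - K l\<bar> < K l / 2" "\<bar>energy V w z\<bar> < K l / 2"
    by (rule energy_points_near_ends[OF V, of x "K l / 2"]) (use x u0 \<open>K l > 0\<close> in auto)
  have "energy V w y \<le> energy V w z"
    by (rule energy_mono(2)[OF V]) (use yz \<sigma> in auto)
  then show False using yz by (auto simp: abs_less_iff)
qed

text \<open>Below \<open>u0\<close> the decreasing function \<open>w - \<sigma> V\<close> tends to 0, so
\<open>w \<ge> \<sigma> V > 0\<close>. Above \<open>u0\<close>, a zero of \<open>w\<close> would be a minimum, but at a zero
the derivative of \<open>w\<close> is \<open>c(V) > 0\<close>.\<close>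

lemma front_flux_pos_of_K_pos:
  assumes V: "front \<alpha> a c l \<sigma> V w" and "K l > 0" "\<And>u. u \<in> {u0<..<l} \<Longrightarrow> c u > 0"
    and x: "V x \<in> {0<..<l}"
  shows "w x > 0"
proof (cases "V x \<le> u0")
  case True
  have "\<sigma> > 0" by (rule front_speed_pos[OF V \<open>K l > 0\<close>])
  have Vr: "V y \<in> {0..l}" and anti: "antimono V" for y using V by (auto simp: front_def)
  define q where "q x = w x - \<sigma> * V x" for x
  have "((\<lambda>x. w x - \<sigma> * V x) \<longlongrightarrow> 0 - \<sigma> * 0) at_top"
    using V front_flux_tendsto_at_top[OF V] by (intro tendsto_intros) (auto simp: front_def)
  then have "(q \<longlongrightarrow> 0) at_top" by (simp add: q_def[abs_def])
  moreover have "q y \<le> q x" if "x \<le> y" for y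
  proof (rule DERIV_nonpos_imp_nonincreasing[OF that])
    fix z assume "x \<le> z"
    then have "c (V z) \<le> 0"
      using antimonoD[OF anti, of x z] True Vr[of z] by (intro c_nonpos) auto
    moreover have "(q has_real_derivative c (V z)) (at z)"
      using V unfolding q_def by (auto simp: front_def)
    ultimately show "\<exists>D. (q has_real_derivative D) (at z) \<and> D \<le> 0" by blast
  qed
  ultimately have "0 \<le> q x"
    by (intro tendsto_upperbound[of q 0 at_top "q x"]) (auto intro!: eventually_at_top_linorderI[of x])
  then have "\<sigma> * V x \<le> w x" by (simp add: q_def)
  moreover have "0 < \<sigma> * V x" using \<open>\<sigma> > 0\<close> x by simp
  ultimately show ?thesis by linarith
next
  case False
  have w0: "0 \<le> w y" for y using V by (auto simp: front_def)
  show ?thesis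
  proof (rule ccontr)
    assume "\<not> w x > 0"
    then have "w x = 0" using w0[of x] by simp
    then have D: "(w has_real_derivative c (V x)) (at x)"
      using front_DERIV(2)[OF V x] by simp
    have "c (V x) = 0"
      by (rule DERIV_local_min[OF D zero_less_one]) (use w0 \<open>w x = 0\<close> in auto)
    then show False using assms(3)[of "V x"] False x by auto
  qed
qed

text \<open>The energy is monotone, whatever the sign of the speed, and tends to 0 at both ends; so it is 0
throughout, and the flux is determined by \<open>K\<close>.\<close>

lemma front_flux_pos_of_K_0:
  assumes V: "front \<alpha> a c l \<sigma> V w" and "K l = 0" "\<And>u. u \<in> {0<..<l} \<Longrightarrow> K u < 0"
    and x: "V x \<in> {0<..<l}"
  shows "w x > 0"
proof -
  have "\<bar>energy V w x\<bar> < \<epsilon>" if "\<epsilon> > 0" for \<epsilon>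
  proof -
    obtain y z where yz: "y \<le> x" "x \<le> z" "V y < l" "0 < V z"
      "\<bar>energy V w y - K l\<bar> < \<epsilon>" "\<bar>energy V w z\<bar> < \<epsilon>"
      by (rule energy_points_near_ends[OF V x \<open>\<epsilon> > 0\<close>])
    have "V x < l" "0 < V x" using x by auto
    then show ?thesis
      using energy_mono[OF V yz(3) _ yz(1)] energy_mono[OF V _ yz(4) yz(2)] yz(5,6) \<open>K l = 0\<close>
      by (cases "0 \<le> \<sigma>") (fastforce simp: abs_less_iff)+
  qed
  then have "energy V w x = 0"
    by (metis less_irrefl zero_less_abs_iff)
  then have "w x powr (\<alpha> + 1) / (\<alpha> + 1) > 0"
    using assms(3)[OF x] by (simp add: energy_def)
  then have "w x \<noteq> 0" by auto
  then show ?thesis using V by (auto simp: front_def less_le)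
qed

lemma front_flux_pos:
  assumes V: "front \<alpha> a c l \<sigma> V w" and nondegenerate and x: "V x \<in> {0<..<l}"
  shows "w x > 0"
  using \<open>nondegenerate\<close> unfolding nondegenerate_def
proof (elim disjE conjE)
  assume "K l > 0" "\<forall>u\<in>{u0<..<l}. c u > 0"
  then show ?thesis using front_flux_pos_of_K_pos[OF V _ _ x] by blast
next
  assume "K l = 0" "\<forall>u\<in>{0<..<l}. K u < 0"
  then show ?thesis using front_flux_pos_of_K_0[OF V _ _ x] by blast
next
  assume "K l < 0" "\<forall>u\<in>{0<..<u0}. c u < 0"
  then have "w (- (- x)) > 0"
    using x K_0
    by (intro bistable.front_flux_pos_of_K_pos[OF reflected front_reflected[OF V]]) auto
  then show ?thesis by simp
qed

section \<open>The phase-plane equation\<close>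

text \<open>The orbit of a front in the phase plane: its flux \<open>\<omega>\<close> as a function of the value \<open>u\<close> of
the profile.\<close>

definition phase_profile :: "real \<Rightarrow> (real \<Rightarrow> real) \<Rightarrow> bool" where
  "phase_profile \<sigma> \<omega> \<longleftrightarrow> continuous_on {0..l} \<omega> \<and> \<omega> 0 = 0 \<and> \<omega> l = 0 \<and>
     (\<forall>u\<in>{0<..<l}. 0 < \<omega> u \<and> (\<omega> has_real_derivative \<sigma> - c u * da u / \<omega> u powr \<alpha>) (at u))"

text \<open>As the flux is positive, \<open>V\<close> is strictly decreasing where it lies strictly between 0 and
\<open>l\<close>, and has a differentiable inverse \<open>X\<close>. Dividing the equation of \<open>w\<close> by that of \<open>V\<close>
gives the phase-plane equation.\<close>

lemma front_phase_profile:
  assumes V: "front \<alpha> a c l \<sigma> V w" and nondegenerate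
  obtains \<omega> X where "phase_profile \<sigma> \<omega>"
    "\<And>u. u \<in> {0<..<l} \<Longrightarrow> V (X u) = u"
    "\<And>x. V x \<in> {0<..<l} \<Longrightarrow> X (V x) = x"
    "\<And>u. u \<in> {0<..<l} \<Longrightarrow> (X has_real_derivative - da u / \<omega> u powr \<alpha>) (at u)"
proof -
  have Vc: "continuous_on UNIV V" and anti: "antimono V" using V by (auto simp: front_def)
  have pos: "w x > 0" if "V x \<in> {0<..<l}" for x
    by (rule front_flux_pos[OF V \<open>nondegenerate\<close> that])
  have D_neg: "- (w x powr \<alpha>) / da (V x) < 0" if "V x \<in> {0<..<l}" for x
    using pos[OF that] da_pos[OF that] by (simp add: divide_neg_pos)
  have less: "V y < V x" if x: "V x \<in> {0<..<l}" and xy: "x < y" for x y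
  proof -
    obtain d where d: "d > 0" "\<And>h. 0 < h \<Longrightarrow> h < d \<Longrightarrow> V (x + h) < V x"
      using DERIV_neg_dec_right[OF front_DERIV(1)[OF V x] D_neg[OF x]] by blast
    have "V y \<le> V (x + min (d / 2) (y - x))"
      by (rule antimonoD[OF anti]) (use xy in auto)
    also have "\<dots> < V x" by (rule d(2)) (use d(1) xy in auto)
    finally show ?thesis .
  qed
  define X where "X u = (SOME x. V x = u)" for u
  have VX: "V (X u) = u" if "u \<in> {0<..<l}" for u
    unfolding X_def by (rule someI_ex) (use front_surj[OF V that] in blast)
  have XV: "X (V x) = x" if "V x \<in> {0<..<l}" for x
    using less[OF that, of "X (V x)"] less[of "X (V x)" x] VX[OF that] that
    by (cases x "X (V x)" rule: linorder_cases) auto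
  have X_cont: "isCont X u" if u: "u \<in> {0<..<l}" for u
  proof -
    have "open (V -` {0<..<l})"
      using Vc by (simp add: open_vimage)
    moreover have "X u \<in> V -` {0<..<l}" using VX[OF u] u by simp
    ultimately obtain d where d: "d > 0" "cball (X u) d \<subseteq> V -` {0<..<l}"
      by (meson open_contains_cball)
    have "isCont X (V (X u))"
    proof (rule isCont_inverse_function[where f = V and g = X and x = "X u", OF d(1)])
      fix z assume "\<bar>z - X u\<bar> \<le> d"
      then have "z \<in> cball (X u) d" by (simp add: dist_real_def abs_minus_commute)
      then show "X (V z) = z" using d(2) XV by auto
      show "isCont V z" using Vc by (simp add: continuous_on_eq_continuous_at)
    qed
    then show ?thesis using VX[OF u] by simp
  qed
  have XD: "(X has_real_derivative - da u / w (X u) powr \<alpha>) (at u)" if u: "u \<in> {0<..<l}" for u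
  proof -
    have J: "V (X u) \<in> {0<..<l}" using VX[OF u] u by simp
    have "(X has_real_derivative inverse (- (w (X u) powr \<alpha>) / da (V (X u)))) (at u)"
      by (rule DERIV_inverse_function[where f = V and g = X and x = u and a = 0 and b = l,
            OF front_DERIV(1)[OF V J]])
        (use D_neg[OF J] u VX X_cont[OF u] in auto)
    then show ?thesis using VX[OF u] by simp
  qed
  define \<omega> where "\<omega> u = (if u \<in> {0<..<l} then w (X u) else 0)" for u
  have \<omega>D: "(\<omega> has_real_derivative \<sigma> - c u * da u / \<omega> u powr \<alpha>) (at u)" if u: "u \<in> {0<..<l}" for u
  proof -
    have J: "V (X u) \<in> {0<..<l}" using VX[OF u] u by simp
    have p: "w (X u) powr \<alpha> > 0" using pos[OF J] by simp
    have "((\<lambda>u. w (X u)) has_real_derivative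
        (\<sigma> * (- (w (X u) powr \<alpha>) / da (V (X u))) + c (V (X u))) * (- da u / w (X u) powr \<alpha>)) (at u)"
      by (rule DERIV_chain2[OF front_DERIV(2)[OF V J] XD[OF u]])
    also have "(\<sigma> * (- (w (X u) powr \<alpha>) / da (V (X u))) + c (V (X u))) * (- da u / w (X u) powr \<alpha>)
        = \<sigma> - c u * da u / \<omega> u powr \<alpha>"
      using da_pos[OF u] p u unfolding VX[OF u] \<omega>_def by (simp add: field_simps)
    finally show ?thesis
      by (rule has_field_derivative_transform_within_open[where S = "{0<..<l}"])
        (use u in \<open>auto simp: \<omega>_def\<close>)
  qed
  have "continuous_on {0..l} \<omega>"
  proof (clarsimp simp: continuous_on_eq_continuous_within)
    fix u assume u: "0 \<le> u" "u \<le> l"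
    show "continuous (at u within {0..l}) \<omega>"
    proof (cases "u \<in> {0<..<l}")
      case True
      then show ?thesis using DERIV_isCont[OF \<omega>D] by (blast intro: continuous_at_imp_continuous_at_within)
    next
      case False
      show ?thesis
        unfolding continuous_within_eps_delta
      proof (intro allI impI)
        fix \<epsilon> :: real assume "\<epsilon> > 0"
        from front_flux_small[OF V this] obtain \<delta> where \<delta>: "\<delta> > 0"
          "\<And>x. V x < \<delta> \<Longrightarrow> w x < \<epsilon>" "\<And>x. V x > l - \<delta> \<Longrightarrow> w x < \<epsilon>" by blast
        have "dist (\<omega> v) (\<omega> u) < \<epsilon>" if v: "v \<in> {0..l}" "dist v u < \<delta>" for v
        proof (cases "v \<in> {0<..<l}")
          case True
          have "w (X v) < \<epsilon>"
            using False u v True VX[OF True] \<delta>(2)[of "X v"] \<delta>(3)[of "X v"]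
            by (auto simp: dist_real_def)
          moreover have "w (X v) > 0" using pos[of "X v"] VX[OF True] True by simp
          moreover have "\<omega> v = w (X v)" "\<omega> u = 0"
            using True False unfolding \<omega>_def by (simp_all only: if_True if_False)
          ultimately show ?thesis by (simp add: dist_real_def)
        qed (use False \<open>\<epsilon> > 0\<close> in \<open>auto simp: \<omega>_def\<close>)
        then show "\<exists>d>0. \<forall>v\<in>{0..l}. dist v u < d \<longrightarrow> dist (\<omega> v) (\<omega> u) < \<epsilon>"
          using \<delta>(1) by blast
      qed
    qed
  qed
  then have "phase_profile \<sigma> \<omega>"
    unfolding phase_profile_def using \<omega>D pos VX by (auto simp: \<omega>_def)
  then show thesis
    by (rule that[OF _ VX XV]) (use XD in \<open>auto simp: \<omega>_def\<close>)
qed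

end

section \<open>Uniqueness of the speed and of the front\<close>

text \<open>Let \<open>z\<close> be the last point where \<open>f \<ge> 0\<close>. Behind it \<open>f\<close> is negative, hence
nondecreasing, hence at least \<open>f z\<close>.\<close>

lemma nonneg_if_nondecreasing_below_0:
  fixes f :: "real \<Rightarrow> real"
  assumes "a \<le> b" and f: "continuous_on {a..b} f" and "0 \<le> f a"
    and D: "\<And>x. a < x \<Longrightarrow> x < b \<Longrightarrow> f x < 0 \<Longrightarrow> \<exists>D. (f has_real_derivative D) (at x) \<and> 0 \<le> D"
  shows "0 \<le> f b"
proof (rule ccontr)
  assume neg: "\<not> 0 \<le> f b"
  have "closed ({a..b} \<inter> f -` {0..})"
    by (rule continuous_closed_preimage[OF f]) auto
  then have "compact ({a..b} \<inter> f -` {0..})"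
    using compact_Int_closed[of "{a..b}" "{a..b} \<inter> f -` {0..}"] by (simp add: Int_absorb1)
  moreover have "{a..b} \<inter> f -` {0..} \<noteq> {}" using assms by auto
  ultimately obtain z where "z \<in> {a..b} \<inter> f -` {0..}" and max': "\<forall>x\<in>{a..b} \<inter> f -` {0..}. x \<le> z"
    using compact_attains_sup by blast
  then have z: "z \<in> {a..b}" "0 \<le> f z" by auto
  have max: "x \<le> z" if "x \<in> {a..b}" "0 \<le> f x" for x
    using max' that by auto
  have "f z \<le> f b"
  proof (rule DERIV_nonneg_imp_increasing_open[where f = f and a = z and b = b])
    fix x assume x: "z < x" "x < b"
    then have "f x < 0" using max[of x] z by (auto simp: not_le[symmetric])
    then show "\<exists>D. (f has_real_derivative D) (at x) \<and> 0 \<le> D"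
      by (intro D) (use x z in auto)
  qed (use z in \<open>auto intro: continuous_on_subset[OF f]\<close>)
  then show False using z neg by simp
qed

context bistable
begin

text \<open>Where \<open>c \<le> 0\<close>, the term \<open>- c a' / \<omega> powr \<alpha>\<close> decreases in \<open>\<omega>\<close>. So
wherever \<open>\<omega>2 < \<omega>1\<close>, the difference \<open>\<omega>2 - \<omega>1\<close> is nondecreasing, and it starts from
0. The singularity of the equation at 0 thus works in favour of uniqueness.\<close>

lemma flux_mono_speed_left:
  assumes "0 < b" "b \<le> u0" "\<sigma>1 \<le> \<sigma>2"
    and 1: "continuous_on {0..b} \<omega>1" "\<omega>1 0 = 0"
      "\<And>u. u \<in> {0<..<b} \<Longrightarrow> 0 < \<omega>1 u"
      "\<And>u. u \<in> {0<..<b} \<Longrightarrow> (\<omega>1 has_real_derivative \<sigma>1 - c u * da u / \<omega>1 u powr \<alpha>) (at u)"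
    and 2: "continuous_on {0..b} \<omega>2" "\<omega>2 0 = 0"
      "\<And>u. u \<in> {0<..<b} \<Longrightarrow> 0 < \<omega>2 u"
      "\<And>u. u \<in> {0<..<b} \<Longrightarrow> (\<omega>2 has_real_derivative \<sigma>2 - c u * da u / \<omega>2 u powr \<alpha>) (at u)"
  shows "\<omega>1 b \<le> \<omega>2 b"
proof -
  have "0 \<le> \<omega>2 b - \<omega>1 b"
  proof (rule nonneg_if_nondecreasing_below_0[of 0 b "\<lambda>u. \<omega>2 u - \<omega>1 u"])
    fix u assume u: "0 < u" "u < b" "\<omega>2 u - \<omega>1 u < 0"
    then have ub: "u \<in> {0<..<b}" by simp
    have "\<omega>2 u powr \<alpha> \<le> \<omega>1 u powr \<alpha>"
      using u 2(3)[OF ub] \<alpha> by (intro powr_mono2) auto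
    moreover have "c u * da u \<le> 0"
      using u assms(2) u0 c_nonpos[of u] da_pos[of u] by (intro mult_nonpos_nonneg) auto
    ultimately have "- (c u * da u) / \<omega>1 u powr \<alpha> \<le> - (c u * da u) / \<omega>2 u powr \<alpha>"
      using 1(3)[OF ub] 2(3)[OF ub] by (intro divide_left_mono) auto
    then have "0 \<le> (\<sigma>2 - c u * da u / \<omega>2 u powr \<alpha>) - (\<sigma>1 - c u * da u / \<omega>1 u powr \<alpha>)"
      using assms(3) by simp
    then show "\<exists>D. ((\<lambda>u. \<omega>2 u - \<omega>1 u) has_real_derivative D) (at u) \<and> 0 \<le> D"
      using DERIV_diff[OF 2(4)[OF ub] 1(4)[OF ub]] by blast
  qed (use assms in \<open>auto intro!: continuous_intros\<close>)
  then show ?thesis by simp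
qed

lemma phase_profile_reflected:
  assumes "phase_profile \<sigma> \<omega>"
  shows "bistable.phase_profile \<alpha> l (\<lambda>u. da (l - u)) (\<lambda>u. - c (l - u)) (- \<sigma>) (\<lambda>u. \<omega> (l - u))"
proof -
  interpret R: bistable \<alpha> l "l - u0" "\<lambda>u. - a (l - u)" "\<lambda>u. da (l - u)" "\<lambda>u. - c (l - u)" "\<lambda>u. K (l - u) - K l"
    by (rule reflected)
  note \<omega> = assms[unfolded phase_profile_def]
  have "continuous_on {0..l} (\<lambda>u. \<omega> (l - u))"
    by (rule continuous_on_compose2[of "{0..l}" \<omega>]) (use \<omega> in \<open>auto intro!: continuous_intros\<close>)
  moreover have "0 < \<omega> (l - u) \<and>
      ((\<lambda>u. \<omega> (l - u)) has_real_derivative - \<sigma> - - c (l - u) * da (l - u) / \<omega> (l - u) powr \<alpha>) (at u)"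
    if u: "u \<in> {0<..<l}" for u
  proof -
    have lu: "l - u \<in> {0<..<l}" using u by auto
    have r: "((\<lambda>u. l - u) has_real_derivative -1) (at u)"
      by (auto intro!: derivative_eq_intros)
    have "(\<omega> has_real_derivative \<sigma> - c (l - u) * da (l - u) / \<omega> (l - u) powr \<alpha>) (at (l - u))"
      using \<omega> lu by blast
    from DERIV_chain2[OF this r] show ?thesis using \<omega> lu by simp
  qed
  ultimately show ?thesis
    unfolding R.phase_profile_def using \<omega> by simp
qed

lemma phase_profile_mono_speed_left:
  assumes "phase_profile \<sigma>1 \<omega>1" "phase_profile \<sigma>2 \<omega>2" "\<sigma>1 \<le> \<sigma>2" "0 < u" "u \<le> u0"
  shows "\<omega>1 u \<le> \<omega>2 u"
proof -
  have "continuous_on {0..u} \<omega>1" "continuous_on {0..u} \<omega>2"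
    using assms u0 by (auto simp: phase_profile_def intro: continuous_on_subset)
  then show ?thesis
    by (intro flux_mono_speed_left[OF assms(4,5,3)])
      (use assms u0 in \<open>auto simp: phase_profile_def\<close>)
qed

lemma phase_profile_antimono_speed_right:
  assumes "phase_profile \<sigma>1 \<omega>1" "phase_profile \<sigma>2 \<omega>2" "\<sigma>1 \<le> \<sigma>2" "u0 \<le> u" "u < l"
  shows "\<omega>2 u \<le> \<omega>1 u"
  using bistable.phase_profile_mono_speed_left[OF reflected phase_profile_reflected[OF assms(2)]
      phase_profile_reflected[OF assms(1)], of "l - u"] assms(3-) by simp

text \<open>Comparison from the left end gives \<open>\<omega>1 \<le> \<omega>2\<close> up to \<open>u0\<close>, comparison from the
right end gives \<open>\<omega>2 \<le> \<omega>1\<close> from \<open>u0\<close> on. So the two agree at \<open>u0\<close>. There the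
reaction terms cancel and \<open>\<omega>2 - \<omega>1\<close> has slope \<open>\<sigma>2 - \<sigma>1\<close>; were this positive, the
difference would be negative just to the left of \<open>u0\<close>.\<close>

lemma phase_profile_unique:
  assumes 1: "phase_profile \<sigma>1 \<omega>1" and 2: "phase_profile \<sigma>2 \<omega>2" and "\<sigma>1 \<le> \<sigma>2"
  shows "\<sigma>1 = \<sigma>2" and "\<And>u. u \<in> {0<..<l} \<Longrightarrow> \<omega>1 u = \<omega>2 u"
proof -
  have eq: "\<omega>1 u0 = \<omega>2 u0"
    using phase_profile_mono_speed_left[OF assms, of u0]
      phase_profile_antimono_speed_right[OF assms, of u0] u0 by simp
  define D where "D = (\<lambda>u. \<omega>2 u - \<omega>1 u)"
  have u0l: "u0 \<in> {0<..<l}" using u0 by simp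
  have "(\<omega>1 has_real_derivative \<sigma>1 - c u0 * da u0 / \<omega>1 u0 powr \<alpha>) (at u0)"
    "(\<omega>2 has_real_derivative \<sigma>2 - c u0 * da u0 / \<omega>2 u0 powr \<alpha>) (at u0)"
    using 1 2 u0l by (auto simp: phase_profile_def)
  from DERIV_diff[OF this(2,1)] have D': "(D has_real_derivative \<sigma>2 - \<sigma>1) (at u0)"
    by (simp add: eq D_def)
  show \<sigma>: "\<sigma>1 = \<sigma>2"
  proof (rule ccontr)
    assume "\<sigma>1 \<noteq> \<sigma>2"
    then have "0 < \<sigma>2 - \<sigma>1" using assms(3) by simp
    from DERIV_pos_inc_left[OF D' this] obtain d where
      d: "d > 0" "\<And>h. 0 < h \<Longrightarrow> h < d \<Longrightarrow> D (u0 - h) < D u0" by blast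
    have "D (u0 - min (d / 2) (u0 / 2)) < D u0"
      by (rule d(2)) (use d(1) u0 in auto)
    moreover have "0 \<le> D (u0 - min (d / 2) (u0 / 2))"
      unfolding D_def using phase_profile_mono_speed_left[OF assms, of "u0 - min (d / 2) (u0 / 2)"] d(1) u0
      by (simp add: min_def)
    ultimately show False using eq by (simp add: D_def)
  qed
  fix u assume u: "u \<in> {0<..<l}"
  show "\<omega>1 u = \<omega>2 u"
    using phase_profile_mono_speed_left[OF 1 2, of u] phase_profile_mono_speed_left[OF 2 1, of u]
      phase_profile_antimono_speed_right[OF 1 2, of u] phase_profile_antimono_speed_right[OF 2 1, of u] \<sigma> u
    by (cases "u \<le> u0") auto
qed

lemma front_speed_unique:
  assumes "front \<alpha> a c l \<sigma>1 V1 w1" "front \<alpha> a c l \<sigma>2 V2 w2" nondegenerate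
  shows "\<sigma>1 = \<sigma>2"
proof -
  have ex: "\<exists>\<omega>. phase_profile \<sigma> \<omega>" if V: "front \<alpha> a c l \<sigma> V w" for \<sigma> V w
  proof (rule front_phase_profile[OF V \<open>nondegenerate\<close>])
    fix \<omega> X assume "phase_profile \<sigma> \<omega>"
    then show ?thesis by blast
  qed
  obtain \<omega>1 \<omega>2 where 1: "phase_profile \<sigma>1 \<omega>1" and 2: "phase_profile \<sigma>2 \<omega>2"
    using ex assms(1,2) by blast
  show ?thesis
    using phase_profile_unique(1)[OF 1 2] phase_profile_unique(1)[OF 2 1] by linarith
qed

text \<open>The inverses \<open>X\<close> and \<open>Y\<close> of the two fronts have the same derivative, so they differ by a
constant.\<close>

lemma front_unique:
  assumes V: "front \<alpha> a c l \<sigma> V v" and W: "front \<alpha> a c l \<sigma> W w" and nondegenerate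
  shows "indistinct V W"
proof -
  obtain \<omega> X where 1: "phase_profile \<sigma> \<omega>"
    and VX: "\<And>u. u \<in> {0<..<l} \<Longrightarrow> V (X u) = u"
    and XV: "\<And>x. V x \<in> {0<..<l} \<Longrightarrow> X (V x) = x"
    and X: "\<And>u. u \<in> {0<..<l} \<Longrightarrow> (X has_real_derivative - da u / \<omega> u powr \<alpha>) (at u)"
    using front_phase_profile[OF V \<open>nondegenerate\<close>] by blast
  obtain \<eta> Y where 2: "phase_profile \<sigma> \<eta>"
    and WY: "\<And>u. u \<in> {0<..<l} \<Longrightarrow> W (Y u) = u"
    and YW: "\<And>x. W x \<in> {0<..<l} \<Longrightarrow> Y (W x) = x"
    and Y: "\<And>u. u \<in> {0<..<l} \<Longrightarrow> (Y has_real_derivative - da u / \<eta> u powr \<alpha>) (at u)"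
    using front_phase_profile[OF W \<open>nondegenerate\<close>] by blast
  have Vr: "V x \<in> {0..l}" and Wr: "W x \<in> {0..l}" and Va: "antimono V" and Wa: "antimono W" for x
    using V W by (auto simp: front_def)
  have "\<exists>\<tau>. \<forall>u\<in>{0<..<l}. X u - Y u = \<tau>"
  proof (rule has_field_derivative_zero_constant)
    fix u assume u: "u \<in> {0<..<l}"
    show "((\<lambda>u. X u - Y u) has_real_derivative 0) (at u within {0<..<l})"
      using DERIV_diff[OF X[OF u] Y[OF u]] phase_profile_unique(2)[OF 1 2 order_refl u]
      by (auto intro: has_field_derivative_at_within)
  qed simp
  then obtain \<tau> where "\<forall>u\<in>{0<..<l}. X u - Y u = \<tau>" by blast
  then have \<tau>: "X u = Y u + \<tau>" if "u \<in> {0<..<l}" for u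
    using bspec[OF _ that, of "\<lambda>u. X u - Y u = \<tau>"] by (simp add: algebra_simps)
  have "W x = V (x + \<tau>)" for x
  proof (cases "W x \<in> {0<..<l}")
    case True
    have "x + \<tau> = X (W x)" using \<tau>[OF True] YW[OF True] by simp
    then show ?thesis using VX[OF True] by simp
  next
    case False
    have F: "V (x + \<tau>) \<notin> {0<..<l}"
    proof
      assume J: "V (x + \<tau>) \<in> {0<..<l}"
      have "x = Y (V (x + \<tau>))" using \<tau>[OF J] XV[OF J] by simp
      then have "W x = V (x + \<tau>)" using WY[OF J] by simp
      then show False using J False by simp
    qed
    have u0l: "u0 \<in> {0<..<l}" using u0 by simp
    have "W x = 0 \<or> W x = l" "V (x + \<tau>) = 0 \<or> V (x + \<tau>) = l"
      using False F Wr[of x] Vr[of "x + \<tau>"] by auto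
    \<comment> \<open>Two end values agree as soon as they lie on the same side of \<open>u0\<close>.\<close>
    moreover have "u0 \<le> V (x + \<tau>) \<longleftrightarrow> u0 \<le> W x"
    proof -
      have "u0 \<le> V (x + \<tau>) \<longleftrightarrow> x + \<tau> \<le> X u0"
        using VX[OF u0l] antimonoD[OF Va, of "x + \<tau>" "X u0"] antimonoD[OF Va, of "X u0" "x + \<tau>"] F u0l
        by (metis linorder_le_cases order_antisym)
      also have "\<dots> \<longleftrightarrow> x \<le> Y u0" using \<tau>[OF u0l] by simp
      also have "\<dots> \<longleftrightarrow> u0 \<le> W x"
        using WY[OF u0l] antimonoD[OF Wa, of x "Y u0"] antimonoD[OF Wa, of "Y u0" x] False u0l
        by (metis linorder_le_cases order_antisym)
      finally show ?thesis .
    qed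
    ultimately show ?thesis using u0 by auto
  qed
  then show ?thesis unfolding indistinct_def by blast
qed

end

section \<open>Maximal solutions of the regularised phase-plane equation\<close>

lemma continuous_on_Icc_bound:
  fixes f :: "real \<Rightarrow> real"
  assumes "continuous_on {a..b} f"
  obtains B where "\<And>x. x \<in> {a..b} \<Longrightarrow> \<bar>f x\<bar> \<le> B"
proof -
  have "bounded (f ` {a..b})"
    by (intro compact_imp_bounded compact_continuous_image assms) auto
  then obtain B where "\<And>y. y \<in> f ` {a..b} \<Longrightarrow> norm y \<le> B"
    unfolding bounded_iff by blast
  then show thesis by (intro that[of B]) auto
qed

text \<open>In terms of \<open>W = \<omega> powr (\<alpha> + 1) / (\<alpha> + 1)\<close> this is \<open>\<omega> powr \<alpha>\<close>, extended by 0
to negative \<open>W\<close>. The phase-plane equation becomes \<open>W' = \<sigma> h(W) - c a'\<close>, without a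
singularity, and \<open>h\<close> is monotone, concave and sublinear on the positive axis.\<close>

definition flux_growth :: "real \<Rightarrow> real \<Rightarrow> real" where
  "flux_growth \<alpha> W = ((\<alpha> + 1) * max W 0) powr (\<alpha> / (\<alpha> + 1))"

lemma flux_growth_nonneg: "0 \<le> flux_growth \<alpha> W"
  by (simp add: flux_growth_def)

lemma flux_growth_mono: "0 < \<alpha> \<Longrightarrow> V \<le> W \<Longrightarrow> flux_growth \<alpha> V \<le> flux_growth \<alpha> W"
  unfolding flux_growth_def by (intro powr_mono2 mult_left_mono) auto

lemma flux_growth_nonpos: "W \<le> 0 \<Longrightarrow> flux_growth \<alpha> W = 0"
  by (simp add: flux_growth_def max_def)

lemma continuous_on_flux_growth:
  assumes "0 < \<alpha>" "continuous_on A f"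
  shows "continuous_on A (\<lambda>x. flux_growth \<alpha> (f x))"
  unfolding flux_growth_def using assms
  by (intro continuous_on_powr' continuous_intros) auto

lemma flux_growth_of_flux:
  assumes "0 < \<alpha>" "0 \<le> \<omega>"
  shows "flux_growth \<alpha> (\<omega> powr (\<alpha> + 1) / (\<alpha> + 1)) = \<omega> powr \<alpha>"
proof -
  have "flux_growth \<alpha> (\<omega> powr (\<alpha> + 1) / (\<alpha> + 1)) = (\<omega> powr (\<alpha> + 1)) powr (\<alpha> / (\<alpha> + 1))"
    using assms by (simp add: flux_growth_def max_absorb1)
  then show ?thesis using assms by (simp add: powr_powr)
qed

lemma flux_growth_sublinear:
  assumes "0 < \<alpha>"
  obtains M where "M > 0" "\<And>x. M \<le> x \<Longrightarrow> B + C * flux_growth \<alpha> x < x"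
proof -
  have \<theta>: "\<alpha> / (\<alpha> + 1) < 1" using assms by simp
  have "eventually (\<lambda>x. B + C * ((\<alpha> + 1) * x) powr (\<alpha> / (\<alpha> + 1)) < x) at_top"
    using \<theta> assms by real_asymp
  then obtain N where N: "\<And>x. N \<le> x \<Longrightarrow> B + C * ((\<alpha> + 1) * x) powr (\<alpha> / (\<alpha> + 1)) < x"
    by (auto simp: eventually_at_top_linorder)
  show thesis
  proof (rule that[of "max N 1"])
    fix x assume "max N 1 \<le> x"
    then show "B + C * flux_growth \<alpha> x < x"
      using N[of x] by (simp add: flux_growth_def max_absorb1)
  qed simp
qed

text \<open>The chord of a concave function through the origin lies below its graph. This replaces a Lipschitz
condition, which fails at 0.\<close>

lemma flux_growth_diff_le:
  assumes "0 < \<alpha>" "0 < x" "y \<le> x"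
  shows "flux_growth \<alpha> x - flux_growth \<alpha> y \<le> flux_growth \<alpha> x / x * (x - y)"
proof -
  have "flux_growth \<alpha> x * (y / x) \<le> flux_growth \<alpha> y"
  proof (cases "y \<le> 0")
    case True
    then have "flux_growth \<alpha> x * (y / x) \<le> 0"
      using assms flux_growth_nonneg[of \<alpha> x] by (intro mult_nonneg_nonpos) (auto simp: divide_le_0_iff)
    then show ?thesis using flux_growth_nonneg[of \<alpha> y] by linarith
  next
    case False
    have "(y / x) powr 1 \<le> (y / x) powr (\<alpha> / (\<alpha> + 1))"
      using assms False by (intro powr_mono') auto
    then have "((\<alpha> + 1) * x) powr (\<alpha> / (\<alpha> + 1)) * (y / x) \<le> ((\<alpha> + 1) * x) powr (\<alpha> / (\<alpha> + 1)) * (y / x) powr (\<alpha> / (\<alpha> + 1))"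
      using assms False by (intro mult_left_mono) auto
    also have "\<dots> = ((\<alpha> + 1) * x * (y / x)) powr (\<alpha> / (\<alpha> + 1))"
      using assms False by (subst powr_mult) auto
    finally show ?thesis
      using assms False by (simp add: flux_growth_def max_def)
  qed
  then show ?thesis using assms by (simp add: field_simps)
qed

context bistable
begin

abbreviation h :: "real \<Rightarrow> real" where "h \<equiv> flux_growth \<alpha>"

text \<open>For \<open>\<sigma> \<ge> 0\<close> this operator is monotone in \<open>W\<close>. Its fixed points solve
\<open>W' = \<sigma> h(W) - c a'\<close> with \<open>W 0 = 0\<close>, and the integrated form needs no bound
for \<open>a'\<close> near 0 and \<open>l\<close>.\<close>

definition picard :: "real \<Rightarrow> (real \<Rightarrow> real) \<Rightarrow> real \<Rightarrow> real" where
  "picard \<sigma> W u = - K u + \<sigma> * integral {0..u} (\<lambda>s. h (W s))"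

definition subsolution :: "real \<Rightarrow> (real \<Rightarrow> real) \<Rightarrow> bool" where
  "subsolution \<sigma> W \<longleftrightarrow> continuous_on {0..l} W \<and> (\<forall>u\<in>{0..l}. W u \<le> picard \<sigma> W u)"

definition solution :: "real \<Rightarrow> (real \<Rightarrow> real) \<Rightarrow> bool" where
  "solution \<sigma> W \<longleftrightarrow> continuous_on {0..l} W \<and> (\<forall>u\<in>{0..l}. W u = picard \<sigma> W u)"

lemma h_integrable:
  assumes "continuous_on {0..l} W" "0 \<le> u" "v \<le> l"
  shows "(\<lambda>s. h (W s)) integrable_on {u..v}"
  using assms by (intro integrable_continuous_real continuous_on_flux_growth[OF \<alpha>])
    (auto intro: continuous_on_subset)

lemma continuous_picard:
  assumes "(\<lambda>s. h (W s)) integrable_on {0..l}"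
  shows "continuous_on {0..l} (picard \<sigma> W)"
  unfolding picard_def[abs_def]
  by (intro continuous_intros K_cont indefinite_integral_continuous_1 assms)

lemma picard_mono:
  assumes "0 \<le> \<sigma>" "\<sigma> \<le> \<tau>" "continuous_on {0..l} V" "continuous_on {0..l} W"
    "\<And>s. s \<in> {0..l} \<Longrightarrow> V s \<le> W s" and u: "u \<in> {0..l}"
  shows "picard \<sigma> V u \<le> picard \<tau> W u"
proof -
  have "integral {0..u} (\<lambda>s. h (V s)) \<le> integral {0..u} (\<lambda>s. h (W s))"
    using assms by (intro integral_le h_integrable flux_growth_mono[OF \<alpha>]) auto
  moreover have "0 \<le> integral {0..u} (\<lambda>s. h (V s))"
    using assms by (intro integral_nonneg h_integrable flux_growth_nonneg) auto
  ultimately show ?thesis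
    using assms by (auto simp: picard_def intro!: mult_mono)
qed

lemma solution_imp_subsolution:
  assumes "solution \<sigma> W" "0 \<le> \<sigma>" "\<sigma> \<le> \<tau>"
  shows "subsolution \<tau> W"
  using assms picard_mono[of \<sigma> \<tau> W W] by (auto simp: solution_def subsolution_def)

text \<open>The two sequences may differ, so that the lemma applies both to the successive approximations for a
fixed speed and to solutions for converging speeds.\<close>

lemma solution_limit:
  assumes Z: "\<And>n. continuous_on {0..l} (Z n)"
    and bound: "\<And>n u. u \<in> {0..l} \<Longrightarrow> Z n u \<le> M"
    and lim: "\<And>u. u \<in> {0..l} \<Longrightarrow> (\<lambda>n. Z n u) \<longlonglongrightarrow> W u"
    and lim': "\<And>u. u \<in> {0..l} \<Longrightarrow> (\<lambda>n. picard (\<sigma> n) (Z n) u) \<longlonglongrightarrow> W u"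
    and \<sigma>: "\<sigma> \<longlonglongrightarrow> \<tau>"
  shows "solution \<tau> W"
proof -
  have hlim: "(\<lambda>n. h (Z n u)) \<longlonglongrightarrow> h (W u)" if "u \<in> {0..l}" for u
  proof -
    have "continuous_on UNIV h" using continuous_on_flux_growth[OF \<alpha>, of UNIV "\<lambda>x. x"] by simp
    then show ?thesis
      using lim[OF that] by (metis UNIV_I continuous_on_eq_continuous_at isCont_tendsto_compose open_UNIV)
  qed
  have conv: "(\<lambda>s. h (W s)) integrable_on {0..u}"
      "(\<lambda>n. integral {0..u} (\<lambda>s. h (Z n s))) \<longlonglongrightarrow> integral {0..u} (\<lambda>s. h (W s))"
    if u: "u \<in> {0..l}" for u
  proof -
    have i: "(\<lambda>s. h (Z n s)) integrable_on {0..u}" for n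
      using u by (intro h_integrable Z) auto
    have b: "norm (h (Z n s)) \<le> h M" if "s \<in> {0..u}" for n s
      using flux_growth_mono[OF \<alpha> bound[of s n]] flux_growth_nonneg[of \<alpha> "Z n s"] u that by simp
    have p: "(\<lambda>n. h (Z n s)) \<longlonglongrightarrow> h (W s)" if "s \<in> {0..u}" for s
      using u that by (intro hlim) auto
    have k: "(\<lambda>_. h M) integrable_on {0..u}" by (rule integrable_const_ivl)
    note dc = dominated_convergence[where f = "\<lambda>n s. h (Z n s)" and h = "\<lambda>_. h M" and g = "\<lambda>s. h (W s)", OF i k b p]
    show "(\<lambda>s. h (W s)) integrable_on {0..u}" by (rule dc(1))
    show "(\<lambda>n. integral {0..u} (\<lambda>s. h (Z n s))) \<longlonglongrightarrow> integral {0..u} (\<lambda>s. h (W s))"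
      by (rule dc(2))
  qed
  have eq: "W u = picard \<tau> W u" if u: "u \<in> {0..l}" for u
  proof (rule LIMSEQ_unique[OF lim'[OF u]])
    show "(\<lambda>n. picard (\<sigma> n) (Z n) u) \<longlonglongrightarrow> picard \<tau> W u"
      unfolding picard_def by (intro tendsto_intros \<sigma> conv u)
  qed
  have "continuous_on {0..l} (picard \<tau> W)"
    by (rule continuous_picard[OF conv(1)]) (use u0 in auto)
  then have "continuous_on {0..l} W"
    by (rule continuous_on_eq) (simp add: eq)
  then show ?thesis unfolding solution_def using eq by blast
qed

text \<open>Sublinearity of \<open>h\<close> provides a constant \<open>M\<close> that lies above its image under the operator and
above every subsolution. The iterates of \<open>M\<close> decrease to a solution, and stay above every subsolution.
Solutions with \<open>W 0 = 0\<close> need not be unique, because \<open>h\<close> is not Lipschitz at 0; for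
\<open>\<sigma> > 0\<close> the maximal one is the one whose flux leaves 0 immediately.\<close>

lemma maximal_solution_exists:
  assumes "0 \<le> \<sigma>"
  shows "\<exists>W. solution \<sigma> W \<and> (\<forall>Z. subsolution \<sigma> Z \<longrightarrow> (\<forall>u\<in>{0..l}. Z u \<le> W u))"
proof -
  obtain B where B: "\<And>u. u \<in> {0..l} \<Longrightarrow> \<bar>K u\<bar> \<le> B"
    using continuous_on_Icc_bound[OF K_cont] by blast
  obtain M where M: "M > 0" "\<And>x. M \<le> x \<Longrightarrow> B + \<sigma> * l * h x < x"
    using flux_growth_sublinear[OF \<alpha>] by blast
  have above: "picard \<sigma> Z u \<le> B + \<sigma> * l * h x"
    if Z: "continuous_on {0..l} Z" "\<And>s. s \<in> {0..l} \<Longrightarrow> Z s \<le> x" and u: "u \<in> {0..l}" for Z x u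
  proof -
    have "integral {0..u} (\<lambda>s. h (Z s)) \<le> integral {0..u} (\<lambda>s. h x)"
      using Z u by (intro integral_le h_integrable flux_growth_mono[OF \<alpha>]) auto
    also have "\<dots> = u * h x" using u by simp
    also have "\<dots> \<le> l * h x"
      using u flux_growth_nonneg[of \<alpha> x] by (intro mult_right_mono) auto
    finally have "\<sigma> * integral {0..u} (\<lambda>s. h (Z s)) \<le> \<sigma> * (l * h x)"
      using assms by (rule mult_left_mono)
    then show ?thesis using B[OF u] by (simp add: picard_def mult.assoc)
  qed
  have below: "- B \<le> picard \<sigma> Z u" if "continuous_on {0..l} Z" "u \<in> {0..l}" for Z u
  proof -
    have "0 \<le> \<sigma> * integral {0..u} (\<lambda>s. h (Z s))"
      using that assms by (intro mult_nonneg_nonneg integral_nonneg h_integrable flux_growth_nonneg) auto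
    then show ?thesis using B[OF that(2)] by (simp add: picard_def)
  qed
  have sub_le: "Z u \<le> M" if Z: "subsolution \<sigma> Z" and u: "u \<in> {0..l}" for Z u
  proof -
    have Zc: "continuous_on {0..l} Z" using Z by (simp add: subsolution_def)
    obtain v where v: "v \<in> {0..l}" "\<And>s. s \<in> {0..l} \<Longrightarrow> Z s \<le> Z v"
      using continuous_attains_sup[OF _ _ Zc] u by auto
    have "Z v \<le> B + \<sigma> * l * h (Z v)"
      using Z above[OF Zc v(2) v(1)] v(1) by (force simp: subsolution_def)
    then have "Z v < M" using M(2)[of "Z v"] by (meson not_le)
    then show ?thesis using v(2)[OF u] by simp
  qed
  define Z where "Z n = (picard \<sigma> ^^ n) (\<lambda>_. M)" for n
  have Z0: "Z 0 = (\<lambda>_. M)" and ZS: "Z (Suc n) = picard \<sigma> (Z n)" for n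
    by (auto simp: Z_def)
  have Zc: "continuous_on {0..l} (Z n)" for n
  proof (induction n)
    case (Suc n)
    then show ?case unfolding ZS by (intro continuous_picard h_integrable) auto
  qed (simp add: Z0)
  have dec: "Z (Suc n) u \<le> Z n u" if "u \<in> {0..l}" for n u
    using that
  proof (induction n arbitrary: u)
    case 0
    then show ?case using above[of "\<lambda>_. M" M u] M(2)[of M] by (simp add: ZS Z0)
  next
    case (Suc n)
    show ?case unfolding ZS[of "Suc n"] ZS[of n, symmetric]
      using picard_mono[OF assms order_refl Zc[of "Suc n"] Zc[of n] Suc.IH Suc.prems]
      by (simp add: ZS)
  qed
  have ZM: "Z n u \<le> M" if "u \<in> {0..l}" for n u
    using decseqD[OF decseq_SucI, of "\<lambda>n. Z n u" 0 n] dec that by (simp add: Z0)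
  have Zlow: "- B \<le> Z (Suc n) u" if "u \<in> {0..l}" for n u
    unfolding ZS by (rule below[OF Zc that])
  have "\<exists>L. (\<lambda>n. Z n u) \<longlonglongrightarrow> L" if u: "u \<in> {0..l}" for u
  proof -
    have "decseq (\<lambda>n. Z (Suc n) u)" using dec[OF u] by (intro decseq_SucI) auto
    then obtain L where "(\<lambda>n. Z (Suc n) u) \<longlonglongrightarrow> L"
      by (rule decseq_convergent[where B = "- B"]) (use Zlow[OF u] in auto)
    then show ?thesis using LIMSEQ_imp_Suc[of "\<lambda>n. Z n u"] by blast
  qed
  then obtain W where W: "\<And>u. u \<in> {0..l} \<Longrightarrow> (\<lambda>n. Z n u) \<longlonglongrightarrow> W u" by metis
  have "solution \<sigma> W"
  proof (rule solution_limit[where Z = Z and M = M and \<sigma> = "\<lambda>_. \<sigma>"])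
    show "(\<lambda>n. picard \<sigma> (Z n) u) \<longlonglongrightarrow> W u" if "u \<in> {0..l}" for u
      using LIMSEQ_Suc[OF W[OF that]] by (simp add: ZS)
  qed (use Zc ZM W in auto)
  moreover have "Y u \<le> W u" if Y: "subsolution \<sigma> Y" and u: "u \<in> {0..l}" for Y u
  proof -
    have Yc: "continuous_on {0..l} Y" using Y by (simp add: subsolution_def)
    have "Y v \<le> Z n v" if "v \<in> {0..l}" for n v
      using that
    proof (induction n arbitrary: v)
      case 0
      then show ?case using sub_le[OF Y] by (simp add: Z0)
    next
      case (Suc n)
      have "Y v \<le> picard \<sigma> Y v" using Y Suc.prems by (simp add: subsolution_def)
      also have "\<dots> \<le> picard \<sigma> (Z n) v"
        by (rule picard_mono[OF assms order_refl Yc Zc Suc.IH Suc.prems])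
      finally show ?case by (simp add: ZS)
    qed
    then show ?thesis using u by (intro LIMSEQ_le_const[OF W[OF u]]) auto
  qed
  ultimately show ?thesis by blast
qed

definition maximal_solution :: "real \<Rightarrow> real \<Rightarrow> real" where
  "maximal_solution \<sigma> = (SOME W. solution \<sigma> W \<and>
     (\<forall>Z. subsolution \<sigma> Z \<longrightarrow> (\<forall>u\<in>{0..l}. Z u \<le> W u)))"

lemma maximal_solution:
  assumes "0 \<le> \<sigma>"
  shows "solution \<sigma> (maximal_solution \<sigma>)"
    and "\<And>Z u. subsolution \<sigma> Z \<Longrightarrow> u \<in> {0..l} \<Longrightarrow> Z u \<le> maximal_solution \<sigma> u"
  using someI_ex[OF maximal_solution_exists[OF assms]] unfolding maximal_solution_def by blast+

lemma maximal_solution_mono: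
  assumes "0 \<le> \<sigma>" "\<sigma> \<le> \<tau>" "u \<in> {0..l}"
  shows "maximal_solution \<sigma> u \<le> maximal_solution \<tau> u"
  using assms by (intro maximal_solution(2) solution_imp_subsolution[of \<sigma>] maximal_solution(1)) auto

lemma solution_0: "solution \<sigma> W \<Longrightarrow> W 0 = 0"
  using u0 K_0 by (simp add: solution_def picard_def)

lemma solution_DERIV:
  assumes W: "solution \<sigma> W" and u: "u \<in> {0<..<l}"
  shows "(W has_real_derivative \<sigma> * h (W u) - c u * da u) (at u)"
proof -
  have hc: "continuous_on {0..l} (\<lambda>s. h (W s))"
    using W by (auto simp: solution_def intro!: continuous_on_flux_growth[OF \<alpha>])
  have "((\<lambda>v. integral {0..v} (\<lambda>s. h (W s))) has_real_derivative h (W u)) (at u within {0..l})"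
    by (rule integral_has_real_derivative[OF hc]) (use u in auto)
  then have I: "((\<lambda>v. integral {0..v} (\<lambda>s. h (W s))) has_real_derivative h (W u)) (at u)"
    using u by (simp add: at_within_Icc_at)
  have "(picard \<sigma> W has_real_derivative \<sigma> * h (W u) - c u * da u) (at u)"
    unfolding picard_def[abs_def]
    using DERIV_add[OF DERIV_minus[OF K_DERIV[OF u]] DERIV_cmult[OF I, of \<sigma>]] by simp
  then show ?thesis
    by (rule has_field_derivative_transform_within_open[where S = "{0<..<l}"])
      (use u W in \<open>auto simp: solution_def\<close>)
qed

text \<open>The flux \<open>\<omega>\<close> with \<open>W = \<omega> powr (\<alpha> + 1) / (\<alpha> + 1)\<close>.\<close>

definition flux_of :: "(real \<Rightarrow> real) \<Rightarrow> real \<Rightarrow> real" where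
  "flux_of W u = ((\<alpha> + 1) * W u) powr (1 / (\<alpha> + 1))"

lemma flux_of_DERIV:
  assumes W: "solution \<sigma> W" and u: "u \<in> {0<..<l}" and pos: "0 < W u"
  shows "(flux_of W has_real_derivative \<sigma> - c u * da u / flux_of W u powr \<alpha>) (at u)"
proof -
  let ?b = "1 / (\<alpha> + 1)"
  have p: "0 < (\<alpha> + 1) * W u" using pos \<alpha> by simp
  have hW: "h (W u) = ((\<alpha> + 1) * W u) powr (\<alpha> / (\<alpha> + 1))"
    using pos by (simp add: flux_growth_def max_def)
  have fl: "flux_of W u powr \<alpha> = h (W u)"
    by (simp add: flux_of_def powr_powr hW)
  have e: "?b - 1 = - (\<alpha> / (\<alpha> + 1))" using \<alpha> by (simp add: field_simps)
  have "(flux_of W has_real_derivative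
      ?b * ((\<alpha> + 1) * W u) powr (?b - 1) * ((\<alpha> + 1) * (\<sigma> * h (W u) - c u * da u))) (at u)"
    unfolding flux_of_def[abs_def]
    by (rule DERIV_chain2[OF has_real_derivative_powr[OF p] DERIV_cmult[OF solution_DERIV[OF W u]]])
  moreover have "?b * ((\<alpha> + 1) * W u) powr (?b - 1) * ((\<alpha> + 1) * (\<sigma> * h (W u) - c u * da u))
      = (\<sigma> * h (W u) - c u * da u) / h (W u)"
  proof -
    have "?b * (\<alpha> + 1) = 1" using \<alpha> by simp
    then have "?b * q * ((\<alpha> + 1) * X) = X * q" for q X :: real
      by (metis mult.assoc mult.commute mult_1)
    then show ?thesis unfolding e powr_minus hW[symmetric] by (simp only: divide_inverse)
  qed
  moreover have "0 < h (W u)"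
    unfolding hW powr_gt_zero using p by (rule less_imp_neq[THEN not_sym])
  ultimately show ?thesis unfolding fl by (simp add: diff_divide_distrib)
qed

lemma continuous_on_flux_of:
  assumes "continuous_on A W" "\<And>u. u \<in> A \<Longrightarrow> 0 \<le> W u"
  shows "continuous_on A (flux_of W)"
  unfolding flux_of_def[abs_def] using assms \<alpha>
  by (intro continuous_on_powr' continuous_intros) auto

lemma phase_profile_of_solution:
  assumes W: "solution \<sigma> W" and "W l = 0" and pos: "\<And>u. u \<in> {0<..<l} \<Longrightarrow> 0 < W u"
  shows "phase_profile \<sigma> (flux_of W)"
proof -
  have "0 \<le> W u" if "u \<in> {0..l}" for u
    using pos[of u] solution_0[OF W] \<open>W l = 0\<close> that by (cases "u \<in> {0<..<l}") auto
  then have "continuous_on {0..l} (flux_of W)"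
    using W by (intro continuous_on_flux_of) (auto simp: solution_def)
  moreover have "0 < flux_of W u" if "u \<in> {0<..<l}" for u
    using pos[OF that] \<alpha> by (simp add: flux_of_def)
  moreover have "flux_of W 0 = 0" "flux_of W l = 0"
    using solution_0[OF W] \<open>W l = 0\<close> by (auto simp: flux_of_def)
  ultimately show ?thesis
    unfolding phase_profile_def using flux_of_DERIV[OF W _ pos] by blast
qed

lemma K_antimono_left:
  assumes "0 \<le> u" "u \<le> v" "v \<le> u0"
  shows "K v \<le> K u"
proof (rule DERIV_nonpos_imp_decreasing_open[where f = K and a = u and b = v])
  fix x assume x: "u < x" "x < v"
  then have "c x * da x \<le> 0"
    using assms u0 c_nonpos[of x] da_pos[of x] by (intro mult_nonpos_nonneg) auto
  then show "\<exists>y. (K has_real_derivative y) (at x) \<and> y \<le> 0"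
    using K_DERIV[of x] x assms u0 by auto
qed (use assms u0 in \<open>auto intro: continuous_on_subset[OF K_cont]\<close>)

lemma K_nonpos: "u \<in> {0..u0} \<Longrightarrow> K u \<le> 0"
  using K_antimono_left[of 0 u] K_0 by simp

text \<open>Without the reaction the maximal solution is the one with \<open>\<omega> u = \<sigma> u\<close>. On the left the reaction
only helps; on the right it costs at most \<open>K u - K u0\<close>. This yields a subsolution, which shows both that
the maximal solution is positive up to \<open>u0\<close> and that it is nonnegative at \<open>l\<close> for large speeds.\<close>

lemma maximal_solution_lower_bound:
  assumes "0 \<le> \<sigma>" and u: "u \<in> {0..l}"
  shows "(\<sigma> * min u u0) powr (\<alpha> + 1) / (\<alpha> + 1) - (K (max u u0) - K u0) \<le> maximal_solution \<sigma> u"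
proof -
  define P where "P u = (\<sigma> * u) powr (\<alpha> + 1) / (\<alpha> + 1)" for u
  define Z where "Z u = P (min u u0) - (K (max u u0) - K u0)" for u
  have hP: "h (P u) = (\<sigma> * u) powr \<alpha>" if "0 \<le> u" for u
    unfolding P_def using that assms by (intro flux_growth_of_flux \<alpha>) auto
  have Pc: "continuous_on {0..} P"
    unfolding P_def[abs_def] using assms \<alpha> by (intro continuous_intros continuous_on_powr') auto
  have P': "(P has_real_derivative \<sigma> * h (P u)) (at u)" if "0 < u" for u
  proof (cases "\<sigma> = 0")
    case True
    then show ?thesis by (simp add: P_def[abs_def])
  next
    case False
    then have p: "0 < \<sigma> * u" using assms that by simp
    have "((\<lambda>u. (\<sigma> * u) powr (\<alpha> + 1)) has_real_derivative (\<alpha> + 1) * (\<sigma> * u) powr (\<alpha> + 1 - 1) * \<sigma>) (at u)"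
      by (rule DERIV_chain2[where g = "\<lambda>u. \<sigma> * u" and x = u, OF has_real_derivative_powr[OF p]])
        (auto intro!: derivative_eq_intros)
    from DERIV_cdivide[OF this, of "\<alpha> + 1"] show ?thesis
      unfolding P_def[abs_def] using \<alpha> hP[of u] that by (simp add: P_def mult.commute)
  qed
  have intP: "((\<lambda>s. \<sigma> * h (P s)) has_integral P u) {0..u}" if "0 \<le> u" for u
  proof -
    have "((\<lambda>s. \<sigma> * h (P s)) has_integral P u - P 0) {0..u}"
      using that P' by (intro fundamental_theorem_of_calculus_interior)
        (auto intro: continuous_on_subset[OF Pc] simp: has_real_derivative_iff_has_vector_derivative[symmetric])
    then show ?thesis by (simp add: P_def)
  qed
  have Zc: "continuous_on {0..l} Z"
    unfolding Z_def[abs_def]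
    by (intro continuous_intros continuous_on_compose2[OF Pc] continuous_on_compose2[OF K_cont])
      (use u0 in auto)
  have "Z u \<le> picard \<sigma> Z u" if u: "u \<in> {0..l}" for u
  proof -
    let ?m = "min u u0"
    have i: "(\<lambda>s. h (Z s)) integrable_on {0..v}" if "v \<le> l" for v
      by (rule h_integrable[OF Zc order_refl that])
    have "P ?m = integral {0..?m} (\<lambda>s. \<sigma> * h (P s))"
      by (rule integral_unique[symmetric], rule intP) (use u u0 in auto)
    also have "\<dots> = integral {0..?m} (\<lambda>s. \<sigma> * h (Z s))"
    proof (rule integral_cong)
      fix s assume "s \<in> {0..?m}"
      then have "min s u0 = s" "max s u0 = u0" by auto
      then show "\<sigma> * h (P s) = \<sigma> * h (Z s)" by (simp add: Z_def)
    qed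
    also have "\<dots> = \<sigma> * integral {0..?m} (\<lambda>s. h (Z s))" by simp
    also have "\<dots> \<le> \<sigma> * integral {0..u} (\<lambda>s. h (Z s))"
      using u assms by (intro mult_left_mono integral_subset_le i) (auto intro: flux_growth_nonneg)
    finally have "P ?m - K u \<le> picard \<sigma> Z u" by (simp add: picard_def)
    moreover have "- (K (max u u0) - K u0) \<le> - K u"
      using K_nonpos[of u] K_nonpos[of u0] u u0 by (auto simp: max_def)
    ultimately show ?thesis by (simp add: Z_def)
  qed
  then have "subsolution \<sigma> Z" using Zc by (simp add: subsolution_def)
  from maximal_solution(2)[OF assms(1) this u] show ?thesis by (simp add: Z_def P_def)
qed

lemma maximal_solution_pos_left:
  assumes "0 < \<sigma>" "u \<in> {0<..u0}"
  shows "0 < maximal_solution \<sigma> u"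
proof -
  have "0 < (\<sigma> * u) powr (\<alpha> + 1) / (\<alpha> + 1)" using assms \<alpha> by simp
  then show ?thesis
    using maximal_solution_lower_bound[of \<sigma> u] assms u0 by (simp add: min_def max_def)
qed

text \<open>At an interior minimum with \<open>W m \<le> 0\<close> the equation reduces to \<open>0 = - c a'\<close>.\<close>

lemma solution_nonpos_not_min:
  assumes W: "solution \<sigma> W" and c: "\<And>u. u \<in> {u0<..<l} \<Longrightarrow> 0 < c u"
    and m: "m \<in> {u0<..<l}" "W m \<le> 0"
  obtains u where "u \<in> {u0..l}" "W u < W m"
proof (rule ccontr)
  assume neg: "\<not> thesis"
  have ml: "m \<in> {0<..<l}" using m u0 by auto
  have "W m \<le> W y" if "\<bar>m - y\<bar> < min (m - u0) (l - m)" for y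
  proof -
    have "y \<in> {u0..l}" using that by (auto simp: abs_less_iff)
    then show ?thesis using neg \<open>\<And>u. u \<in> {u0..l} \<Longrightarrow> W u < W m \<Longrightarrow> thesis\<close> by (meson not_le)
  qed
  then have "\<sigma> * h (W m) - c m * da m = 0"
    using m by (intro DERIV_local_min[OF solution_DERIV[OF W ml], of "min (m - u0) (l - m)"]) auto
  then have "c m * da m = 0" using flux_growth_nonpos[OF m(2)] by simp
  then show False using c[OF m(1)] da_pos[OF ml] by simp
qed

lemma solution_pos_right:
  assumes W: "solution \<sigma> W" and c: "\<And>u. u \<in> {u0<..<l} \<Longrightarrow> 0 < c u"
    and "0 < W u0" "0 \<le> W l" and u: "u \<in> {u0..<l}"
  shows "0 < W u"
proof -
  have Wc: "continuous_on {u0..l} W"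
    using W u0 by (auto simp: solution_def intro: continuous_on_subset)
  obtain m where m: "m \<in> {u0..l}" "\<And>v. v \<in> {u0..l} \<Longrightarrow> W m \<le> W v"
    using continuous_attains_inf[OF _ _ Wc] u0 by auto
  show ?thesis
  proof (rule ccontr)
    assume "\<not> 0 < W u"
    then have Wu: "W u \<le> 0" by simp
    then have "u \<in> {u0<..<l}" using u assms(3) by (cases "u = u0") auto
    then obtain v where v: "v \<in> {u0..l}" "W v < W u"
      using solution_nonpos_not_min[OF W c _ Wu] by blast
    then have Wm: "W m < 0" using m(2)[OF v(1)] Wu by linarith
    then have "m \<in> {u0<..<l}" using m(1) assms(3,4) by (cases "m = u0"; cases "m = l") auto
    then obtain v' where "v' \<in> {u0..l}" "W v' < W m"
      using solution_nonpos_not_min[OF W c, of m] Wm by (metis less_imp_le)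
    then show False using m(2) by (meson not_le)
  qed
qed

lemma solution_unique_left:
  assumes "0 \<le> \<sigma>" and V: "solution \<sigma> V" and W: "solution \<sigma> W"
    and Vpos: "\<And>u. u \<in> {0<..u0} \<Longrightarrow> 0 < V u" and Wpos: "\<And>u. u \<in> {0<..u0} \<Longrightarrow> 0 < W u"
  shows "V u0 \<le> W u0"
proof -
  have nn: "0 \<le> V u" "0 \<le> W u" if "u \<in> {0..u0}" for u
    using that Vpos[of u] Wpos[of u] solution_0[OF V] solution_0[OF W] by (cases "u = 0"; force)+
  have "flux_of V u0 \<le> flux_of W u0"
  proof (rule flux_mono_speed_left[OF u0(1) order_refl order_refl])
    show "continuous_on {0..u0} (flux_of V)" "continuous_on {0..u0} (flux_of W)"
      using V W nn u0 by (auto simp: solution_def intro!: continuous_on_flux_of intro: continuous_on_subset)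
    show "flux_of V 0 = 0" "flux_of W 0 = 0"
      using solution_0[OF V] solution_0[OF W] by (auto simp: flux_of_def)
    fix u assume u: "u \<in> {0<..<u0}"
    then have ul: "u \<in> {0<..<l}" using u0 by auto
    have p: "0 < V u" "0 < W u" using u Vpos Wpos by auto
    then show "0 < flux_of V u" "0 < flux_of W u" using \<alpha> by (auto simp: flux_of_def)
    show "(flux_of V has_real_derivative \<sigma> - c u * da u / flux_of V u powr \<alpha>) (at u)"
      by (rule flux_of_DERIV[OF V ul p(1)])
    show "(flux_of W has_real_derivative \<sigma> - c u * da u / flux_of W u powr \<alpha>) (at u)"
      by (rule flux_of_DERIV[OF W ul p(2)])
  qed
  then have "(flux_of V u0) powr (\<alpha> + 1) \<le> (flux_of W u0) powr (\<alpha> + 1)"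
    using \<alpha> by (intro powr_mono2) (auto simp: flux_of_def)
  then show ?thesis
    using \<alpha> Vpos[of u0] Wpos[of u0] u0 by (simp add: flux_of_def powr_powr)
qed

text \<open>Gronwall's inequality for \<open>W - V\<close>: since \<open>W\<close> is bounded away from 0, concavity bounds
\<open>h(W) - h(V)\<close> linearly by \<open>W - V\<close>, even where the lower function \<open>V\<close> is negative.\<close>

lemma solution_unique_right:
  assumes "0 \<le> \<sigma>" and V: "solution \<sigma> V" and W: "solution \<sigma> W"
    and le: "\<And>u. u \<in> {u0..l} \<Longrightarrow> V u \<le> W u" and "W u0 \<le> V u0"
    and pos: "\<And>u. u \<in> {u0..l} \<Longrightarrow> 0 < W u"
  shows "W l \<le> V l"
proof -
  have Wc: "continuous_on {u0..l} W" and Vc: "continuous_on {u0..l} V"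
    using V W u0 by (auto simp: solution_def intro: continuous_on_subset)
  have "continuous_on {u0..l} (\<lambda>u. \<sigma> * (h (W u) / W u))"
    using pos by (intro continuous_intros continuous_on_flux_growth[OF \<alpha>] Wc) force
  from continuous_on_Icc_bound[OF this]
  obtain C where C: "\<And>u. u \<in> {u0..l} \<Longrightarrow> \<bar>\<sigma> * (h (W u) / W u)\<bar> \<le> C" by blast
  define f where "f u = (W u - V u) * exp (- C * u)" for u
  have "f l \<le> f u0"
  proof (rule DERIV_nonpos_imp_decreasing_open[where f = f and a = u0 and b = l])
    show "continuous_on {u0..l} f"
      unfolding f_def[abs_def] by (intro continuous_intros Wc Vc)
    fix u assume u: "u0 < u" "u < l"
    then have ul: "u \<in> {0<..<l}" and ur: "u \<in> {u0..l}" using u0 by auto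
    have "(f has_real_derivative (\<sigma> * h (W u) - c u * da u - (\<sigma> * h (V u) - c u * da u)) * exp (- C * u)
        + (exp (- C * u) * - C) * (W u - V u)) (at u)"
      unfolding f_def[abs_def]
      by (rule DERIV_mult[OF DERIV_diff[OF solution_DERIV[OF W ul] solution_DERIV[OF V ul]]])
        (auto intro!: derivative_eq_intros)
    also have "(\<sigma> * h (W u) - c u * da u - (\<sigma> * h (V u) - c u * da u)) * exp (- C * u)
        + (exp (- C * u) * - C) * (W u - V u)
      = (\<sigma> * (h (W u) - h (V u)) - C * (W u - V u)) * exp (- C * u)"
      by (simp add: algebra_simps)
    finally have D: "(f has_real_derivative \<dots>) (at u)" .
    have "\<sigma> * (h (W u) - h (V u)) \<le> \<sigma> * (h (W u) / W u * (W u - V u))"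
      using assms(1) by (intro mult_left_mono flux_growth_diff_le[OF \<alpha>] pos le ur)
    also have "\<dots> = \<sigma> * (h (W u) / W u) * (W u - V u)" by simp
    also have "\<dots> \<le> C * (W u - V u)"
      using abs_le_D1[OF C[OF ur]] le[OF ur] by (intro mult_right_mono) auto
    finally have "(\<sigma> * (h (W u) - h (V u)) - C * (W u - V u)) * exp (- C * u) \<le> 0"
      by (intro mult_nonpos_nonneg) auto
    with D show "\<exists>y. (f has_real_derivative y) (at u) \<and> y \<le> 0" by blast
  qed (use u0 in auto)
  also have "f u0 \<le> 0" unfolding f_def using assms(5) by (intro mult_nonpos_nonneg) auto
  finally show ?thesis by (simp add: f_def mult_le_0_iff)
qed

section \<open>Shooting in the speed\<close>

text \<open>For speeds decreasing to \<open>\<sigma>\<close> the maximal solutions decrease to a solution for \<open>\<sigma>\<close>, which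
lies below the maximal one.\<close>

lemma maximal_solution_right_limit:
  assumes "0 \<le> \<sigma>" and pos: "\<And>\<tau>. \<sigma> < \<tau> \<Longrightarrow> 0 \<le> maximal_solution \<tau> l"
  shows "0 \<le> maximal_solution \<sigma> l"
proof -
  define \<tau> where "\<tau> n = \<sigma> + inverse (real (Suc n))" for n
  have \<tau>: "\<sigma> < \<tau> n" "0 \<le> \<tau> n" for n using assms(1) by (auto simp: \<tau>_def add_nonneg_nonneg)
  have \<tau>_dec: "\<tau> (Suc n) \<le> \<tau> n" for n by (auto simp: \<tau>_def field_simps)
  have "\<tau> \<longlonglongrightarrow> \<sigma> + 0"
    unfolding \<tau>_def[abs_def] by (intro tendsto_intros LIMSEQ_inverse_real_of_nat)
  then have \<tau>_lim: "\<tau> \<longlonglongrightarrow> \<sigma>" by simp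
  let ?Z = "\<lambda>n. maximal_solution (\<tau> n)"
  have sol: "solution (\<tau> n) (?Z n)" for n by (rule maximal_solution(1)[OF \<tau>(2)])
  have dec: "decseq (\<lambda>n. ?Z n u)" if "u \<in> {0..l}" for u
    by (intro decseq_SucI maximal_solution_mono \<tau> \<tau>_dec that)
  have "\<exists>L. (\<lambda>n. ?Z n u) \<longlonglongrightarrow> L" if u: "u \<in> {0..l}" for u
  proof -
    have "maximal_solution \<sigma> u \<le> ?Z n u" for n
      using \<tau>(1)[of n] by (intro maximal_solution_mono assms u) simp
    then have "\<forall>n. maximal_solution \<sigma> u \<le> ?Z n u" by blast
    from decseq_convergent[OF dec[OF u] this] show ?thesis by blast
  qed
  then obtain W where W: "\<And>u. u \<in> {0..l} \<Longrightarrow> (\<lambda>n. ?Z n u) \<longlonglongrightarrow> W u" by metis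
  have "continuous_on {0..l} (?Z 0)" using sol[of 0] by (simp add: solution_def)
  from continuous_on_Icc_bound[OF this]
  obtain M where M: "\<And>u. u \<in> {0..l} \<Longrightarrow> \<bar>?Z 0 u\<bar> \<le> M" by blast
  have "solution \<sigma> W"
  proof (rule solution_limit[where Z = ?Z and \<sigma> = \<tau> and M = M])
    show "?Z n u \<le> M" if "u \<in> {0..l}" for n u
      using decseqD[OF dec[OF that], of 0 n] M[OF that] by simp
    show "(\<lambda>n. picard (\<tau> n) (?Z n) u) \<longlonglongrightarrow> W u" if "u \<in> {0..l}" for u
      using W[OF that] sol that by (simp add: solution_def)
  qed (use sol W \<tau>_lim in \<open>auto simp: solution_def\<close>)
  then have "W l \<le> maximal_solution \<sigma> l"
    using u0 assms(1) by (intro maximal_solution(2) solution_imp_subsolution[of \<sigma>]) auto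
  moreover have "0 \<le> W l"
    by (rule LIMSEQ_le_const[OF W]) (use u0 pos \<tau> in auto)
  ultimately show ?thesis by linarith
qed

text \<open>For speeds increasing to \<open>\<sigma>\<close> the maximal solutions increase to a solution \<open>V\<close> with
\<open>V l \<le> 0\<close> that is positive up to \<open>u0\<close>. If the maximal solution were positive at \<open>l\<close>, it would be
positive on all of \<open>[u0, l]\<close>, and uniqueness on both sides of \<open>u0\<close> would identify the two at
\<open>l\<close>.\<close>

lemma maximal_solution_left_limit:
  assumes "0 < \<sigma>" and neg: "\<And>\<tau>. 0 \<le> \<tau> \<Longrightarrow> \<tau> < \<sigma> \<Longrightarrow> maximal_solution \<tau> l \<le> 0"
    and c: "\<And>u. u \<in> {u0<..<l} \<Longrightarrow> 0 < c u"
  shows "maximal_solution \<sigma> l \<le> 0"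
proof (rule ccontr)
  assume "\<not> maximal_solution \<sigma> l \<le> 0"
  then have Wl: "0 < maximal_solution \<sigma> l" by simp
  define W where "W = maximal_solution \<sigma>"
  have \<sigma>0: "0 \<le> \<sigma>" using assms(1) by simp
  have W: "solution \<sigma> W" unfolding W_def by (rule maximal_solution(1)[OF \<sigma>0])
  define \<tau> where "\<tau> n = \<sigma> - \<sigma> / 2 * inverse (real (Suc n))" for n
  have half: "\<sigma> / 2 * inverse (real (Suc n)) \<le> \<sigma> / 2" "0 < \<sigma> / 2 * inverse (real (Suc n))" for n
    using assms(1) by (auto intro!: mult_left_le simp: inverse_le_1_iff simp del: of_nat_Suc) 
  have \<tau>: "\<tau> n < \<sigma>" "\<sigma> / 2 \<le> \<tau> n" "0 \<le> \<tau> n" for n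
    using half[of n] assms(1) by (auto simp: \<tau>_def)
  have \<tau>_inc: "\<tau> n \<le> \<tau> (Suc n)" for n
    unfolding \<tau>_def using assms(1) by (intro diff_left_mono mult_left_mono) (auto simp: field_simps)
  have "\<tau> \<longlonglongrightarrow> \<sigma> - \<sigma> / 2 * 0"
    unfolding \<tau>_def[abs_def] by (intro tendsto_intros LIMSEQ_inverse_real_of_nat)
  then have \<tau>_lim: "\<tau> \<longlonglongrightarrow> \<sigma>" by simp
  let ?Z = "\<lambda>n. maximal_solution (\<tau> n)"
  have sol: "solution (\<tau> n) (?Z n)" for n by (rule maximal_solution(1)[OF \<tau>(3)])
  have inc: "incseq (\<lambda>n. ?Z n u)" if "u \<in> {0..l}" for u
    by (intro incseq_SucI maximal_solution_mono \<tau> \<tau>_inc that)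
  have ZW: "?Z n u \<le> W u" if "u \<in> {0..l}" for n u
    unfolding W_def using \<tau>[of n] by (intro maximal_solution_mono that) auto
  have "\<exists>L. (\<lambda>n. ?Z n u) \<longlonglongrightarrow> L" if u: "u \<in> {0..l}" for u
  proof -
    have "\<forall>n. ?Z n u \<le> W u" using ZW[OF u] by blast
    from incseq_convergent[OF inc[OF u] this] show ?thesis by blast
  qed
  then obtain V where V: "\<And>u. u \<in> {0..l} \<Longrightarrow> (\<lambda>n. ?Z n u) \<longlonglongrightarrow> V u" by metis
  have "continuous_on {0..l} W" using W by (simp add: solution_def)
  from continuous_on_Icc_bound[OF this]
  obtain M where M: "\<And>u. u \<in> {0..l} \<Longrightarrow> \<bar>W u\<bar> \<le> M" by blast
  have Vsol: "solution \<sigma> V"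
  proof (rule solution_limit[where Z = ?Z and \<sigma> = \<tau> and M = M])
    show "?Z n u \<le> M" if "u \<in> {0..l}" for n u
      using ZW[OF that, of n] M[OF that] by simp
    show "(\<lambda>n. picard (\<tau> n) (?Z n) u) \<longlonglongrightarrow> V u" if "u \<in> {0..l}" for u
      using V[OF that] sol that by (simp add: solution_def)
  qed (use sol V \<tau>_lim in \<open>auto simp: solution_def\<close>)
  have VW: "V u \<le> W u" if "u \<in> {0..l}" for u
    by (rule LIMSEQ_le_const2[OF V[OF that]]) (use ZW[OF that] in auto)
  have Wpos: "0 < W u" if "u \<in> {0<..u0}" for u
    unfolding W_def by (rule maximal_solution_pos_left[OF assms(1) that])
  have Vpos: "0 < V u" if u: "u \<in> {0<..u0}" for u
  proof -
    have ul: "u \<in> {0..l}" using u u0 by auto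
    have "0 < ?Z 0 u"
      by (rule maximal_solution_pos_left[OF _ u]) (use \<tau>(2)[of 0] assms(1) in simp)
    also have "?Z 0 u \<le> V u" by (rule incseq_le[OF inc[OF ul] V[OF ul]])
    finally show ?thesis .
  qed
  have W_right: "0 < W u" if "u \<in> {u0..l}" for u
    using solution_pos_right[OF W c, of u] Wpos[of u0] Wl that u0 by (cases "u = l") (auto simp: W_def)
  have "W u0 \<le> V u0"
    by (rule solution_unique_left[OF \<sigma>0 W Vsol Wpos Vpos])
  then have "W l \<le> V l"
    using VW W_right u0 by (intro solution_unique_right[OF \<sigma>0 Vsol W]) auto
  moreover have "V l \<le> 0"
    by (rule LIMSEQ_le_const2[OF V]) (use u0 neg \<tau> in auto)
  ultimately show False using Wl by (simp add: W_def)
qed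

text \<open>The speed is the least one for which the maximal solution is nonnegative at \<open>l\<close>. By continuity from
both sides its value at \<open>l\<close> is 0. This speed is not 0, as for speed 0 the solution is
\<open>- K\<close>, with the value \<open>- K l < 0\<close>.\<close>

lemma phase_profile_exists_of_K_pos:
  assumes "K l > 0" and c: "\<And>u. u \<in> {u0<..<l} \<Longrightarrow> 0 < c u"
  shows "\<exists>\<sigma> \<omega>. phase_profile \<sigma> \<omega>"
proof -
  have l: "l \<in> {0..l}" using u0 by simp
  define S where "S = {\<sigma>. 0 \<le> \<sigma> \<and> 0 \<le> maximal_solution \<sigma> l}"
  define \<sigma> where "\<sigma> = Inf S"
  have "S \<noteq> {}"
  proof -
    \<comment> \<open>For this speed the lower bound for the maximal solution is exactly 0 at \<open>l\<close>.\<close>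
    let ?D = "(\<alpha> + 1) * (K l - K u0)"
    define s where "s = ?D powr (1 / (\<alpha> + 1)) / u0"
    have "0 \<le> s" using u0 by (simp add: s_def)
    have D: "0 \<le> ?D" using K_nonpos[of u0] assms(1) u0 \<alpha> by simp
    have "(s * u0) powr (\<alpha> + 1) / (\<alpha> + 1) = K l - K u0"
      using u0 D \<alpha> by (simp add: s_def powr_powr)
    then have "0 \<le> maximal_solution s l"
      using maximal_solution_lower_bound[OF \<open>0 \<le> s\<close> l] u0 by (simp add: min_def max_def)
    then show ?thesis using \<open>0 \<le> s\<close> by (auto simp: S_def)
  qed
  have bdd: "bdd_below S" by (rule bdd_belowI[of _ 0]) (simp add: S_def)
  have \<sigma>0: "0 \<le> \<sigma>" unfolding \<sigma>_def using \<open>S \<noteq> {}\<close> by (intro cInf_greatest) (auto simp: S_def)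
  have right: "0 \<le> maximal_solution \<sigma> l"
  proof (rule maximal_solution_right_limit[OF \<sigma>0])
    fix \<tau> assume "\<sigma> < \<tau>"
    then obtain s where s: "s \<in> S" "s < \<tau>"
      using cInf_lessD[OF \<open>S \<noteq> {}\<close>] unfolding \<sigma>_def by blast
    then show "0 \<le> maximal_solution \<tau> l"
      using maximal_solution_mono[of s \<tau> l] l by (simp add: S_def)
  qed
  have "\<sigma> \<noteq> 0"
  proof
    assume "\<sigma> = 0"
    then have "maximal_solution \<sigma> l = - K l"
      using maximal_solution(1)[OF \<sigma>0] l by (simp add: solution_def picard_def)
    then show False using right assms(1) by simp
  qed
  then have "0 < \<sigma>" using \<sigma>0 by simp
  moreover have "maximal_solution \<tau> l \<le> 0" if "0 \<le> \<tau>" "\<tau> < \<sigma>" for \<tau>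
  proof (rule ccontr)
    assume "\<not> maximal_solution \<tau> l \<le> 0"
    then have "\<tau> \<in> S" using that by (simp add: S_def)
    then show False using cInf_lower[OF _ bdd] that by (fastforce simp: \<sigma>_def)
  qed
  ultimately have "maximal_solution \<sigma> l \<le> 0"
    using maximal_solution_left_limit c by blast
  then have Wl: "maximal_solution \<sigma> l = 0" using right by simp
  have sol: "solution \<sigma> (maximal_solution \<sigma>)" by (rule maximal_solution(1)[OF \<sigma>0])
  have left: "0 < maximal_solution \<sigma> u" if "u \<in> {0<..u0}" for u
    by (rule maximal_solution_pos_left[OF \<open>0 < \<sigma>\<close> that])
  have "0 < maximal_solution \<sigma> u" if "u \<in> {0<..<l}" for u
    using left[of u] solution_pos_right[OF sol c left[of u0], of u] Wl that u0 by (cases "u \<le> u0") auto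
  then show ?thesis using phase_profile_of_solution[OF sol Wl] by blast
qed

lemma phase_profile_exists:
  assumes nondegenerate
  shows "\<exists>\<sigma> \<omega>. phase_profile \<sigma> \<omega>"
  using assms unfolding nondegenerate_def
proof (elim disjE conjE)
  assume "K l > 0" "\<forall>u\<in>{u0<..<l}. c u > 0"
  then show ?thesis using phase_profile_exists_of_K_pos by blast
next
  assume "K l = 0" "\<forall>u\<in>{0<..<l}. K u < 0"
  moreover have "solution 0 (\<lambda>u. - K u)"
    unfolding solution_def picard_def by (auto intro!: continuous_intros K_cont)
  ultimately have "phase_profile 0 (flux_of (\<lambda>u. - K u))"
    by (intro phase_profile_of_solution) auto
  then show ?thesis by blast
next
  assume K: "K l < 0" "\<forall>u\<in>{0<..<u0}. c u < 0"
  interpret R: bistable \<alpha> l "l - u0" "\<lambda>u. - a (l - u)" "\<lambda>u. da (l - u)" "\<lambda>u. - c (l - u)" "\<lambda>u. K (l - u) - K l"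
    by (rule reflected)
  obtain \<sigma> \<omega> where "R.phase_profile \<sigma> \<omega>"
    using R.phase_profile_exists_of_K_pos K K_0 by force
  then have "phase_profile (- \<sigma>) (\<lambda>u. \<omega> (l - u))"
    using R.phase_profile_reflected by simp
  then show ?thesis by blast
qed

end

section \<open>From the phase plane back to a front\<close>

text \<open>By the fundamental theorem of calculus, \<open>f\<close> is an integral of the continuous function \<open>g\<close>.\<close>

lemma DERIV_except_finite:
  fixes f g :: "real \<Rightarrow> real"
  assumes f: "continuous_on UNIV f" and g: "continuous_on UNIV g" and S: "finite S"
    and D: "\<And>x. x \<notin> S \<Longrightarrow> (f has_real_derivative g x) (at x)"
  shows "(f has_real_derivative g x) (at x)"
proof -
  let ?a = "x - 1" and ?b = "x + 1"
  have "((\<lambda>y. integral {?a..y} g) has_real_derivative g x) (at x within {?a..?b})"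
    by (rule integral_has_real_derivative) (auto intro: continuous_on_subset[OF g])
  then have "((\<lambda>y. integral {?a..y} g) has_real_derivative g x) (at x)"
    by (simp add: at_within_Icc_at)
  then have D': "((\<lambda>y. f ?a + integral {?a..y} g) has_real_derivative g x) (at x)"
    using DERIV_add[OF DERIV_const] by fastforce
  have eq: "f ?a + integral {?a..y} g = f y" if "y \<in> {?a<..<?b}" for y
  proof -
    have "(g has_integral f y - f ?a) {?a..y}"
      using that by (intro fundamental_theorem_of_calculus_interior_strong[OF S])
        (auto simp: has_real_derivative_iff_has_vector_derivative[symmetric] intro: D continuous_on_subset[OF f])
    then show ?thesis by (simp add: integral_unique)
  qed
  show ?thesis
    by (rule has_field_derivative_transform_within_open[OF D', of "{?a<..<?b}"]) (use eq in auto)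
qed

context bistable
begin

text \<open>\<open>T u\<close> is the point at which the front takes the value \<open>u\<close>.\<close>

lemma phase_profile_time:
  assumes "phase_profile \<sigma> \<omega>"
  obtains T where "\<And>u. u \<in> {0<..<l} \<Longrightarrow> (T has_real_derivative - da u / \<omega> u powr \<alpha>) (at u)"
    "\<And>u v. u \<in> {0<..<l} \<Longrightarrow> v \<in> {0<..<l} \<Longrightarrow> T u \<le> T v \<longleftrightarrow> v \<le> u"
proof -
  note \<omega> = assms[unfolded phase_profile_def]
  have pos: "0 < \<omega> u" if "u \<in> {0<..<l}" for u using \<omega> that by auto
  have "isCont (\<lambda>u. - da u / \<omega> u powr \<alpha>) u" if u: "u \<in> {0<..<l}" for u
  proof (intro isCont_divide isCont_minus)
    show "isCont da u" using da_cont u by (simp add: continuous_on_eq_continuous_at)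
    have "isCont \<omega> u" using \<omega> u DERIV_isCont by blast
    then show "isCont (\<lambda>u. \<omega> u powr \<alpha>) u"
      using pos[OF u] unfolding isCont_def by (intro tendsto_powr tendsto_const) auto
    show "\<omega> u powr \<alpha> \<noteq> 0" using pos[OF u] by simp
  qed
  then obtain T where "\<And>u. u \<in> {0<..<l} \<Longrightarrow> (T has_vector_derivative - da u / \<omega> u powr \<alpha>) (at u)"
    using einterval_antiderivative[of "ereal 0" "ereal l" "\<lambda>u. - da u / \<omega> u powr \<alpha>"] u0 by auto
  then have T: "(T has_real_derivative - da u / \<omega> u powr \<alpha>) (at u)" if "u \<in> {0<..<l}" for u
    using that by (simp add: has_real_derivative_iff_has_vector_derivative)
  have dec: "T v < T u" if "u < v" "u \<in> {0<..<l}" "v \<in> {0<..<l}" for u v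
  proof (rule DERIV_neg_imp_decreasing[OF that(1)])
    fix x assume "u \<le> x" "x \<le> v"
    then have x: "x \<in> {0<..<l}" using that by auto
    have "- da x / \<omega> x powr \<alpha> < 0"
      using da_pos[OF x] pos[OF x] by (simp add: divide_neg_pos)
    then show "\<exists>y. (T has_real_derivative y) (at x) \<and> y < 0" using T[OF x] by blast
  qed
  have "T u \<le> T v \<longleftrightarrow> v \<le> u" if "u \<in> {0<..<l}" "v \<in> {0<..<l}" for u v
    using dec[of u v] dec[of v u] that by (cases u v rule: linorder_cases) auto
  with T show thesis by (rule that)
qed

text \<open>The front is the inverse of \<open>T\<close>, extended by \<open>l\<close> to the left of the range of \<open>T\<close> and by 0 to
the right of it. The supremum that defines it does so without distinguishing whether the range is bounded. The
equations are clear in the interior of the front and of its two constant parts; at the at most two points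
where these meet, all functions involved are continuous, so the derivatives exist there as well.\<close>

lemma front_of_phase_profile:
  assumes \<omega>: "phase_profile \<sigma> \<omega>"
  obtains V w where "front \<alpha> a c l \<sigma> V w"
proof -
  obtain T where T: "\<And>u. u \<in> {0<..<l} \<Longrightarrow> (T has_real_derivative - da u / \<omega> u powr \<alpha>) (at u)"
    and T_le: "\<And>u v. u \<in> {0<..<l} \<Longrightarrow> v \<in> {0<..<l} \<Longrightarrow> T u \<le> T v \<longleftrightarrow> v \<le> u"
    using phase_profile_time[OF \<omega>] by blast
  note \<omega> = \<omega>[unfolded phase_profile_def]
  have pos: "0 < \<omega> u" if "u \<in> {0<..<l}" for u using \<omega> that by auto
  define S where "S x = insert 0 {u\<in>{0<..<l}. x \<le> T u}" for x
  define V where "V x = Sup (S x)" for x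
  have S_bdd: "bdd_above (S x)" for x
    by (rule bdd_aboveI[of _ l]) (use u0 in \<open>auto simp: S_def\<close>)
  have V0: "0 \<le> V x" for x
    unfolding V_def by (rule cSup_upper[OF _ S_bdd]) (simp add: S_def)
  have Vl: "V x \<le> l" for x
    unfolding V_def by (rule cSup_least) (use u0 in \<open>auto simp: S_def\<close>)
  have anti: "antimono V"
    unfolding V_def by (intro antimonoI cSup_subset_mono S_bdd) (auto simp: S_def)
  have VT: "V (T u) = u" if "u \<in> {0<..<l}" for u
    unfolding V_def by (rule cSup_eq_maximum) (use that T_le in \<open>auto simp: S_def\<close>)
  have V_less: "V x < u \<longleftrightarrow> T u < x" if u: "u \<in> {0<..<l}" and "V x \<noteq> u" for u x
    using antimonoD[OF anti, of x "T u"] antimonoD[OF anti, of "T u" x] VT[OF u] that(2)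
    by (cases "T u < x") auto
  have Vc: "(V \<longlongrightarrow> V x) (at x)" for x
  proof (rule order_tendstoI)
    fix y assume y: "y < V x"
    show "eventually (\<lambda>z. y < V z) (at x)"
    proof (cases "y < 0")
      case True
      then have "y < V z" for z using V0[of z] by linarith
      then show ?thesis by simp
    next
      case False
      define u where "u = (y + V x) / 2"
      have u: "u \<in> {0<..<l}" "y < u" "u < V x" using y False Vl[of x] by (auto simp: u_def)
      then have "x < T u" using V_less[of u x] antimonoD[OF anti, of "T u" x] VT[OF u(1)]
        by (metis linorder_not_less)
      then have "eventually (\<lambda>z. z < T u) (at x)"
        by (intro order_tendstoD(2)[OF tendsto_ident_at])
      then show ?thesis
        by eventually_elim (metis VT[OF u(1)] antimonoD[OF anti] less_imp_le order.strict_trans2[OF u(2)])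
    qed
  next
    fix y assume y: "V x < y"
    show "eventually (\<lambda>z. V z < y) (at x)"
    proof (cases "l < y")
      case True
      then have "V z < y" for z using Vl[of z] by linarith
      then show ?thesis by simp
    next
      case False
      define u where "u = (y + V x) / 2"
      have u: "u \<in> {0<..<l}" "u < y" "V x < u" using y False V0[of x] by (auto simp: u_def)
      then have "T u < x" using V_less[of u x] by auto
      then have "eventually (\<lambda>z. T u < z) (at x)"
        by (intro order_tendstoD(1)[OF tendsto_ident_at])
      then show ?thesis
        by eventually_elim (metis VT[OF u(1)] antimonoD[OF anti] less_imp_le order.strict_trans1[OF _ u(2)])
    qed
  qed
  then have V_isCont: "isCont V x" for x by (simp add: isCont_def)
  then have V_cont: "continuous_on A V" for A by (simp add: continuous_at_imp_continuous_on)
  have V_bot: "(V \<longlongrightarrow> l) at_bot"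
  proof (rule order_tendstoI)
    fix y assume "y < l"
    define u where "u = (max y 0 + l) / 2"
    have u: "u \<in> {0<..<l}" "y < u" using \<open>y < l\<close> u0 by (auto simp: u_def)
    show "eventually (\<lambda>z. y < V z) at_bot"
      by (rule eventually_at_bot_linorderI[of "T u"])
        (metis VT[OF u(1)] antimonoD[OF anti] order.strict_trans2[OF u(2)])
  qed (intro always_eventually allI le_less_trans[OF Vl])
  have V_top: "(V \<longlongrightarrow> 0) at_top"
  proof (rule order_tendstoI)
    fix y :: real assume "0 < y"
    define u where "u = min y l / 2"
    have u: "u \<in> {0<..<l}" "u < y" using \<open>0 < y\<close> u0 by (auto simp: u_def min_def)
    show "eventually (\<lambda>z. V z < y) at_top"
      by (rule eventually_at_top_linorderI[of "T u"])
        (metis VT[OF u(1)] antimonoD[OF anti] order.strict_trans1[OF _ u(2)])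
  qed (intro always_eventually allI less_le_trans[OF _ V0])
  have TV: "T (V x) = x" if x: "V x \<in> {0<..<l}" for x
  proof (rule order_antisym)
    have "isCont T (V x)" using T[OF x] by (rule DERIV_isCont)
    then have lim: "(T \<longlongrightarrow> T (V x)) (at_right (V x))" "(T \<longlongrightarrow> T (V x)) (at_left (V x))"
      by (auto simp: isCont_def intro: tendsto_within_subset)
    show "T (V x) \<le> x"
    proof (rule tendsto_upperbound[OF lim(1)])
      show "eventually (\<lambda>v. T v \<le> x) (at_right (V x))"
      proof (rule eventually_at_rightI[of _ l])
        fix v assume "v \<in> {V x<..<l}"
        then have "v \<in> {0<..<l}" "V x \<noteq> v" "V x < v" using x by auto
        then show "T v \<le> x" using V_less[of v x] by simp
      qed (use x in auto)
    qed simp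
    show "x \<le> T (V x)"
    proof (rule tendsto_lowerbound[OF lim(2)])
      show "eventually (\<lambda>v. x \<le> T v) (at_left (V x))"
      proof (rule eventually_at_leftI[of 0])
        fix v assume "v \<in> {0<..<V x}"
        then have "v \<in> {0<..<l}" "V x \<noteq> v" "\<not> V x < v" using x by auto
        then show "x \<le> T v" using V_less[of v x] by simp
      qed (use x in auto)
    qed simp
  qed
  have V_DERIV: "(V has_real_derivative - (\<omega> (V x) powr \<alpha>) / da (V x)) (at x)" if x: "V x \<in> {0<..<l}" for x
  proof -
    have "open (V -` {0<..<l})" using V_cont by (simp add: open_vimage)
    then obtain e where e: "e > 0" "ball x e \<subseteq> V -` {0<..<l}"
      using x by (metis open_contains_ball vimage_eq)
    have "(V has_real_derivative inverse (- da (V x) / \<omega> (V x) powr \<alpha>)) (at x)"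
    proof (rule DERIV_inverse_function[where f = T and g = V and x = x and a = "x - e" and b = "x + e", OF T[OF x]])
      show "- da (V x) / \<omega> (V x) powr \<alpha> \<noteq> 0" using da_pos[OF x] pos[OF x] by simp
      show "T (V y) = y" if "x - e < y" "y < x + e" for y
      proof -
        have "y \<in> ball x e" using that by (simp add: dist_real_def abs_less_iff)
        then show ?thesis using e TV by auto
      qed
    qed (use e V_isCont in auto)
    then show ?thesis by simp
  qed
  \<comment> \<open>The first zero of \<open>V\<close> and the last point where it is \<open>l\<close>, if they exist.\<close>
  define E where "E = {x. V x = 0 \<and> (\<forall>z<x. V z \<noteq> 0)} \<union> {x. V x = l \<and> (\<forall>z>x. V z \<noteq> l)}"
  have "finite E"
  proof -
    have "x = y" if "x \<in> {x. V x = 0 \<and> (\<forall>z<x. V z \<noteq> 0)}" "y \<in> {x. V x = 0 \<and> (\<forall>z<x. V z \<noteq> 0)}" for x y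
      using that by (cases x y rule: linorder_cases) auto
    then have "finite {x. V x = 0 \<and> (\<forall>z<x. V z \<noteq> 0)}"
      by (metis (no_types, lifting) finite.simps finite_subset insertI1 insert_absorb singletonD singletonI subsetI)
    moreover have "x = y" if "x \<in> {x. V x = l \<and> (\<forall>z>x. V z \<noteq> l)}" "y \<in> {x. V x = l \<and> (\<forall>z>x. V z \<noteq> l)}" for x y
      using that by (cases x y rule: linorder_cases) auto
    then have "finite {x. V x = l \<and> (\<forall>z>x. V z \<noteq> l)}"
      by (metis (no_types, lifting) finite.simps finite_subset insertI1 insert_absorb singletonD singletonI subsetI)
    ultimately show ?thesis by (simp add: E_def)
  qed
  have DERIV_comp: "((\<lambda>x. F (V x)) has_real_derivative G (V x)) (at x)"
    if F: "continuous_on {0..l} F" and G: "continuous_on {0..l} G" "G 0 = 0" "G l = 0"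
      and D: "\<And>x. V x \<in> {0<..<l} \<Longrightarrow> ((\<lambda>x. F (V x)) has_real_derivative G (V x)) (at x)" for F G x
  proof (rule DERIV_except_finite[OF _ _ \<open>finite E\<close>])
    show "continuous_on UNIV (\<lambda>x. F (V x))" "continuous_on UNIV (\<lambda>x. G (V x))"
      using V0 Vl by (auto intro!: continuous_on_compose2[OF F V_cont] continuous_on_compose2[OF G(1) V_cont])
    fix x assume x: "x \<notin> E"
    consider "V x \<in> {0<..<l}" | "V x = 0" | "V x = l" using V0[of x] Vl[of x] by force
    then show "((\<lambda>x. F (V x)) has_real_derivative G (V x)) (at x)"
    proof cases
      case 1
      then show ?thesis by (rule D)
    next
      case 2
      then obtain z where z: "z < x" "V z = 0" using x by (auto simp: E_def)
      have "V y = 0" if "z < y" for y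
        using antimonoD[OF anti, of z y] z V0[of y] that by simp
      then have "((\<lambda>x. F (V x)) has_real_derivative 0) (at x)"
        by (intro has_field_derivative_transform_within_open[OF DERIV_const[of "F 0"], of "{z<..}"])
          (use z in auto)
      then show ?thesis using 2 G by simp
    next
      case 3
      then obtain z where z: "x < z" "V z = l" using x by (auto simp: E_def)
      have "V y = l" if "y < z" for y
        using antimonoD[OF anti, of y z] z Vl[of y] that by simp
      then have "((\<lambda>x. F (V x)) has_real_derivative 0) (at x)"
        by (intro has_field_derivative_transform_within_open[OF DERIV_const[of "F l"], of "{..<z}"])
          (use z in auto)
      then show ?thesis using 3 G by simp
    qed
  qed
  have \<omega>_nonneg: "0 \<le> \<omega> u" if "u \<in> {0..l}" for u
    using \<omega> that by (cases "u = 0 \<or> u = l") (auto intro: less_imp_le[OF pos])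
  have "((\<lambda>x. a (V x)) has_real_derivative - (\<omega> (V x) powr \<alpha>)) (at x)" for x
  proof (rule DERIV_comp[OF a_cont, where G = "\<lambda>u. - (\<omega> u powr \<alpha>)"])
    show "continuous_on {0..l} (\<lambda>u. - (\<omega> u powr \<alpha>))"
      using \<omega> \<omega>_nonneg \<alpha> by (intro continuous_intros continuous_on_powr') auto
    fix x assume x: "V x \<in> {0<..<l}"
    show "((\<lambda>x. a (V x)) has_real_derivative - (\<omega> (V x) powr \<alpha>)) (at x)"
      using DERIV_chain2[OF a_DERIV[OF x] V_DERIV[OF x]] da_pos[OF x] by simp
  qed (use \<omega> in auto)
  moreover have "((\<lambda>x. \<omega> (V x) - \<sigma> * V x) has_real_derivative c (V x)) (at x)" for x
  proof (rule DERIV_comp[OF _ c_cont c_ends, where F = "\<lambda>u. \<omega> u - \<sigma> * u"])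
    show "continuous_on {0..l} (\<lambda>u. \<omega> u - \<sigma> * u)"
      using \<omega> by (intro continuous_intros) auto
    fix x assume x: "V x \<in> {0<..<l}"
    let ?W = "\<omega> (V x) powr \<alpha>"
    have "(\<omega> has_real_derivative \<sigma> - c (V x) * da (V x) / ?W) (at (V x))" using \<omega> x by blast
    from DERIV_diff[OF DERIV_chain2[OF this V_DERIV[OF x]] DERIV_cmult[OF V_DERIV[OF x], of \<sigma>]]
    have "((\<lambda>x. \<omega> (V x) - \<sigma> * V x) has_real_derivative
        (\<sigma> - c (V x) * da (V x) / ?W) * (- ?W / da (V x)) - \<sigma> * (- ?W / da (V x))) (at x)" .
    moreover have "0 < ?W" using pos[OF x] by simp
    then have "(\<sigma> - c (V x) * da (V x) / ?W) * (- ?W / da (V x)) - \<sigma> * (- ?W / da (V x)) = c (V x)"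
      using da_pos[OF x] by (simp add: field_simps)
    ultimately show "((\<lambda>x. \<omega> (V x) - \<sigma> * V x) has_real_derivative c (V x)) (at x)" by simp
  qed
  moreover have "continuous_on UNIV (\<lambda>x. \<omega> (V x))"
    by (rule continuous_on_compose2[OF _ V_cont]) (use \<omega> V0 Vl in auto)
  ultimately have "front \<alpha> a c l \<sigma> V (\<lambda>x. \<omega> (V x))"
    unfolding front_def using V_cont anti V_bot V_top V0 Vl \<omega>_nonneg by auto
  then show thesis by (rule that)
qed

end

section \<open>The reaction potential and the theorem\<close>

text \<open>By the fundamental theorem of calculus the positive function \<open>a'\<close> is integrable, with the increment of
\<open>a\<close> as its integral, however fast it grows at the ends.\<close>

lemma derivative_times_continuous_integrable:
  fixes a c :: "real \<Rightarrow> real"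
  assumes "0 < l" and a: "continuous_on {0..l} a" "a C1_differentiable_on {0<..<l}"
    and pos: "\<And>u. u \<in> {0<..<l} \<Longrightarrow> 0 < deriv a u" and c: "continuous_on {0..l} c"
  shows "(\<lambda>u. c u * deriv a u) absolutely_integrable_on {0<..<l}"
proof -
  have D: "(a has_real_derivative deriv a u) (at u)" if "u \<in> {0<..<l}" for u
    using a(2) that
    by (auto simp: C1_differentiable_on_eq DERIV_deriv_iff_real_differentiable)
  have "(deriv a has_integral a l - a 0) {0..l}"
    using \<open>0 < l\<close> a D
    by (intro fundamental_theorem_of_calculus_interior) (auto simp flip: has_real_derivative_iff_has_vector_derivative)
  then have "deriv a integrable_on {0<..<l}"
    by (simp add: has_integral_integrable flip: integrable_on_Icc_iff_Ioo)
  then have "deriv a absolutely_integrable_on {0<..<l}"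
    using pos by (intro nonnegative_absolutely_integrable_1) (auto intro: less_imp_le)
  moreover have "c \<in> borel_measurable (lebesgue_on {0<..<l})"
    by (intro continuous_imp_measurable_on_sets_lebesgue continuous_on_subset[OF c]) auto
  moreover have "bounded (c ` {0<..<l})"
    by (rule bounded_subset[OF compact_imp_bounded[OF compact_continuous_image[OF c compact_Icc]]]) auto
  ultimately show ?thesis
    by (intro absolutely_integrable_bounded_measurable_product_real) auto
qed

lemma reaction_potential:
  fixes a c :: "real \<Rightarrow> real"
  assumes "0 < l" and a: "continuous_on {0..l} a" "a C1_differentiable_on {0<..<l}"
    and pos: "\<And>u. u \<in> {0<..<l} \<Longrightarrow> 0 < deriv a u" and c: "continuous_on {0..l} c"
  defines "K \<equiv> \<lambda>u. LINT r:{0<..<u}|lebesgue. c r * deriv a r"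
  shows "continuous_on {0..l} K" "K 0 = 0"
    and "\<And>u. u \<in> {0<..<l} \<Longrightarrow> (K has_real_derivative c u * deriv a u) (at u)"
    and "\<And>u. u \<in> {0..l} \<Longrightarrow> (LINT r:{u<..<l}|lebesgue. c r * deriv a r) = K l - K u"
proof -
  define f where "f u = c u * deriv a u" for u
  have abs: "f absolutely_integrable_on {0<..<l}"
    unfolding f_def[abs_def] by (rule derivative_times_continuous_integrable[OF assms(1-5)])
  then have int: "f integrable_on {0..l}"
    by (simp add: absolutely_integrable_on_def integrable_on_Icc_iff_Ioo)
  have LINT: "(LINT r:{u<..<v}|lebesgue. f r) = integral {u..v} f" if "0 \<le> u" "v \<le> l" for u v
  proof -
    have "f absolutely_integrable_on {u<..<v}"
      by (rule set_integrable_subset[OF abs]) (use that in auto)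
    then show ?thesis
      by (simp add: set_lebesgue_integral_eq_integral(2) integral_open_interval_real)
  qed
  have K: "K u = integral {0..u} f" if "u \<le> l" for u
    using LINT[OF order_refl that] by (simp add: K_def f_def)
  show "continuous_on {0..l} K"
    by (rule continuous_on_eq[OF indefinite_integral_continuous_1[OF int]]) (simp add: K)
  show "K 0 = 0" using K[of 0] \<open>0 < l\<close> by simp
  show "(LINT r:{u<..<l}|lebesgue. c r * deriv a r) = K l - K u" if u: "u \<in> {0..l}" for u
  proof -
    have "integral {0..u} f + integral {u..l} f = integral {0..l} f"
      by (rule Henstock_Kurzweil_Integration.integral_combine[OF _ _ int]) (use u in auto)
    then show ?thesis using LINT[of u l] K[of u] K[of l] u by (simp add: f_def)
  qed
  fix u assume u: "u \<in> {0<..<l}"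
  have "continuous_on {0<..<l} (deriv a)"
  proof -
    obtain D where D: "\<And>x. x \<in> {0<..<l} \<Longrightarrow> (a has_vector_derivative D x) (at x)" "continuous_on {0<..<l} D"
      using a(2) unfolding C1_differentiable_on_def by blast
    have "deriv a x = D x" if "x \<in> {0<..<l}" for x
      using D(1)[OF that] by (intro DERIV_imp_deriv) (simp add: has_real_derivative_iff_has_vector_derivative)
    then show ?thesis using continuous_on_eq[OF D(2)] by simp
  qed
  then have "isCont (deriv a) u" using u by (simp add: continuous_on_eq_continuous_at)
  moreover have "isCont c u"
  proof -
    have "continuous_on {0<..<l} c" by (rule continuous_on_subset[OF c]) auto
    then show ?thesis using u by (simp add: continuous_on_eq_continuous_at)
  qed
  ultimately have "isCont f u" unfolding f_def[abs_def] by (intro continuous_intros)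
  then have "continuous (at u within {0..l}) f" by (rule continuous_at_imp_continuous_at_within)
  then have "((\<lambda>v. integral {0..v} f) has_vector_derivative f u) (at u within {0..l})"
    using integral_has_vector_derivative_continuous_at[OF int, of u "{}"] u by simp
  then have "((\<lambda>v. integral {0..v} f) has_real_derivative f u) (at u)"
    using u by (simp add: has_real_derivative_iff_has_vector_derivative at_within_Icc_at)
  then show "(K has_real_derivative c u * deriv a u) (at u)"
    unfolding f_def[symmetric]
    by (rule has_field_derivative_transform_within_open[where S = "{0<..<l}"]) (use u K in auto)
qed

theorem theorem4p8:
  fixes p \<alpha> l u0 \<kappa> :: real and a c G H :: "real \<Rightarrow> real"
  assumes p: "p > 1" and alpha: "\<alpha> = 1 / (p - 1)"
    and l: "0 < l"
    and a_cont: "continuous_on {0..l} a"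
    and a_C1: "a C1_differentiable_on {0<..<l}"
    and a_deriv_pos: "\<And>u. u \<in> {0<..<l} \<Longrightarrow> deriv a u > 0"
    and a_0: "a 0 = 0"
    and c_cont: "continuous_on {0..l} c"
    and c_ends: "c 0 = 0" "c l = 0"
    and u0: "u0 \<in> {0<..<l}"
    and c_nonpos: "\<And>u. u \<in> {0..u0} \<Longrightarrow> c u \<le> 0"
    and c_nonneg: "\<And>u. u \<in> {u0..l} \<Longrightarrow> c u \<ge> 0"
    and kappa: "\<kappa> = (LINT s:{0<..<l}|lebesgue. c s * deriv a s)"
    and G: "\<And>u. u \<in> {0..l} \<Longrightarrow>
      G u = \<bar>(\<alpha> + 1) * (LINT r:{0<..<u}|lebesgue. c r * deriv a r)\<bar> powr (1 / (\<alpha> + 1))"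
    and H: "\<And>u. u \<in> {0..l} \<Longrightarrow>
      H u = \<bar>(\<alpha> + 1) * (LINT r:{u<..<l}|lebesgue. c r * deriv a r)\<bar> powr (1 / (\<alpha> + 1))"
    and cases:
      "(\<kappa> > 0 \<and> (\<forall>u\<in>{u0<..<l}. c u > 0)) \<or>
       (\<kappa> = 0 \<and> (\<forall>u\<in>{0<..<u0}. G u > 0) \<and> (\<forall>u\<in>{u0<..<l}. H u > 0)) \<or>
       (\<kappa> < 0 \<and> (\<forall>u\<in>{0<..<u0}. c u < 0))"
  shows "\<exists>\<sigma>. (\<exists>V. wavefront_profile p a c l \<sigma> V \<and>
                  (\<forall>W. wavefront_profile p a c l \<sigma> W \<longrightarrow> indistinct V W)) \<and>
             (\<forall>s. s \<noteq> \<sigma> \<longrightarrow> \<not> (\<exists>V. wavefront_profile p a c l s V))"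
proof -
  define K where "K u = (LINT r:{0<..<u}|lebesgue. c r * deriv a r)" for u
  note potential = reaction_potential[OF l a_cont a_C1 a_deriv_pos c_cont, folded K_def]
  have K_l: "K l = \<kappa>" by (simp add: K_def kappa)
  obtain D where D: "\<And>x. x \<in> {0<..<l} \<Longrightarrow> (a has_vector_derivative D x) (at x)" "continuous_on {0<..<l} D"
    using a_C1 unfolding C1_differentiable_on_def by blast
  have Da: "(a has_real_derivative D x) (at x)" if "x \<in> {0<..<l}" for x
    using D(1)[OF that] by (simp add: has_real_derivative_iff_has_vector_derivative)
  then have deriv_a: "deriv a x = D x" if "x \<in> {0<..<l}" for x
    using that by (intro DERIV_imp_deriv)
  interpret bistable \<alpha> l u0 a "deriv a" c K
  proof
    show "continuous_on {0<..<l} (deriv a)"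
      using continuous_on_eq[OF D(2)] deriv_a by simp
  qed (use p alpha u0 a_cont a_deriv_pos c_cont c_ends c_nonpos c_nonneg potential Da deriv_a in auto)
  interpret R: bistable \<alpha> l "l - u0" "\<lambda>u. - a (l - u)" "\<lambda>u. deriv a (l - u)" "\<lambda>u. - c (l - u)"
    "\<lambda>u. K (l - u) - K l"
    by (rule reflected)
  have K_right: "K u \<le> K l" if "u \<in> {u0..l}" for u
    using R.K_nonpos[of "l - u"] that by simp
  have "nondegenerate"
    using cases unfolding nondegenerate_def K_l
  proof (elim disjE conjE)
    assume "\<kappa> = 0" and G0: "\<forall>u\<in>{0<..<u0}. G u > 0" and H0: "\<forall>u\<in>{u0<..<l}. H u > 0"
    have left: "K u < 0" if u: "u \<in> {0<..<u0}" for u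
    proof -
      have "G u > 0" using G0 u by blast
      then have "K u \<noteq> 0" using G[of u] u u0 by (auto simp: K_def)
      then show ?thesis using K_nonpos[of u] u by simp
    qed
    have right: "K u < 0" if u: "u \<in> {u0<..<l}" for u
    proof -
      have "H u > 0" using H0 u by blast
      then have "K l - K u \<noteq> 0" using H[of u] potential(4)[of u] u u0 by auto
      then show ?thesis using K_right[of u] u K_l \<open>\<kappa> = 0\<close> by simp
    qed
    have "K u0 < 0" using left[of "u0 / 2"] K_antimono_left[of "u0 / 2" u0] u0 by simp
    then have "K u < 0" if "u \<in> {0<..<l}" for u
      using left[of u] right[of u] that by (cases u u0 rule: linorder_cases) auto
    then show "0 < \<kappa> \<and> (\<forall>u\<in>{u0<..<l}. 0 < c u) \<or> \<kappa> = 0 \<and> (\<forall>u\<in>{0<..<l}. K u < 0) \<or>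
        \<kappa> < 0 \<and> (\<forall>u\<in>{0<..<u0}. c u < 0)"
      using \<open>\<kappa> = 0\<close> by blast
  qed blast+
  obtain \<sigma> \<omega> where "phase_profile \<sigma> \<omega>"
    using phase_profile_exists[OF \<open>nondegenerate\<close>] by blast
  then obtain V w where V: "front \<alpha> a c l \<sigma> V w"
    using front_of_phase_profile by blast
  have to_front: "\<exists>w. front \<alpha> a c l s W w" if "wavefront_profile p a c l s W" for s W
    using wavefront_profile_imp_front[OF p alpha l a_cont a_mono c_cont that] by blast
  show ?thesis
  proof (intro exI conjI allI impI notI)
    show "wavefront_profile p a c l \<sigma> V"
      by (rule front_imp_wavefront_profile[OF p alpha l c_cont V])
    show "indistinct V W" if "wavefront_profile p a c l \<sigma> W" for W
      using to_front[OF that] front_unique[OF V _ \<open>nondegenerate\<close>] by blast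
    show False if "s \<noteq> \<sigma>" "\<exists>W. wavefront_profile p a c l s W" for s
      using to_front that front_speed_unique[OF V _ \<open>nondegenerate\<close>] by blast
  qed
qed

end
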